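(* Let $\mathcal{N}$ be a Hadamard channel and $0\le\lambda\le1$. Suppose the admissible state $\rho$ attains the supremum defining $g_\lambda(\mathcal{N})$. Then the point $(I(AX;B)_\rho,\ H(A|X)_\rho)$ lies on the CE trade-off curve of $\mathcal{N}$; more precisely it belongs to $\mathcal{C}_{\mathrm{CE}}(\mathcal{N})$ and for every $(C,E)\in\mathcal{C}_{\mathrm{CE}}(\mathcal{N})$ one has $C-\lambda E\le I(AX;B)_\rho-\lambda H(A|X)_\rho=g_\lambda(\mathcal{N})$.
   Context: For a quantum channel $\mathcal{N}^{A'\to B}$ with isometric extension $U_{\mathcal{N}}^{A'\to BE}$, the complementary channel is $\mathcal{N}^c(\sigma)=\mathrm{Tr}_B\{U_{\mathcal{N}}\sigma U_{\mathcal{N}}^\dagger\}$; $\mathcal{N}$ is a Hadamard channel if $\mathcal{N}^c$ is entanglement-breaking (of the form $\sigma\mapsto\sum_y\mathrm{Tr}\{\Lambda_y\sigma\}\omega_y$ for a POVM $\{\Lambda_y\}$ and states $\omega_y$). An admissible state is $\rho^{XABE}=\sum_x p_X(x)|x\rangle\langle x|^X\otimes U_{\mathcal{N}}(\phi_x^{AA'})U_{\mathcal{N}}^\dagger$ with $X$ a finite alphabet, $p_X$ a probability distribution, $A$ a finite-dimensional reference, each $\phi_x^{AA'}$ pure. Entropies base 2. $g_\lambda(\mathcal{N})\equiv\sup_\rho[I(AX;B)_\rho-\lambda H(A|X)_\rho]$ over admissible states. The one-shot CE region $\mathcal{C}^{(1)}_{\mathrm{CE}}(\mathcal{N})$ is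 the union over admissible $\rho$ of $\{(C,E):0\le C\le I(AX;B)_\rho,\ E\ge H(A|X)_\rho\}$, and $\mathcal{C}_{\mathrm{CE}}(\mathcal{N})=\overline{\bigcup_{k\ge1}\frac1k\mathcal{C}^{(1)}_{\mathrm{CE}}(\mathcal{N}^{\otimes k})}$. The CE trade-off curve is the set of Pareto-optimal points of $\mathcal{C}_{\mathrm{CE}}(\mathcal{N})$ (points $(C,E)$ of the region with no other point $(C',E')$ of the region satisfying $C'\ge C$, $E'\le E$).
   Formalization: "Lies on the CE trade-off curve" is taken only in its "more precisely" form; Pareto optimality is not stated: it follows at once for λ>0 but fails at λ=0 (completely dephasing qubit channel, maximally entangled input: (1,1) attains g_0 but (1,0) is in the region). *)

theory Defs
  imports "Jordan_Normal_Form.Spectral_Radius" "Jordan_Normal_Form.Schur_Decomposition"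
          "HOL-Analysis.Elementary_Topology"
begin

definition mtrace :: "complex mat \<Rightarrow> complex" where
  "mtrace M = (\<Sum>i<dim_row M. M $$ (i,i))"

definition matsum :: "nat \<Rightarrow> nat \<Rightarrow> (nat \<Rightarrow> complex mat) \<Rightarrow> complex mat" where
  "matsum d m f = mat d d (\<lambda>(i,j). \<Sum>y<m. f y $$ (i,j))"

definition tensor :: "complex mat \<Rightarrow> complex mat \<Rightarrow> complex mat" where
  "tensor A B = mat (dim_row A * dim_row B) (dim_col A * dim_col B)
     (\<lambda>(i,j). A $$ (i div dim_row B, j div dim_col B) * B $$ (i mod dim_row B, j mod dim_col B))"

definition ptrace_right :: "nat \<Rightarrow> nat \<Rightarrow> complex mat \<Rightarrow> complex mat" where
  "ptrace_right dL dR M = mat dL dL (\<lambda>(i,j). \<Sum>k<dR. M $$ (i * dR + k, j * dR + k))"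

definition ptrace_left :: "nat \<Rightarrow> nat \<Rightarrow> complex mat \<Rightarrow> complex mat" where
  "ptrace_left dL dR M = mat dR dR (\<lambda>(i,j). \<Sum>k<dL. M $$ (k * dR + i, k * dR + j))"

definition ketbra :: "nat \<Rightarrow> nat \<Rightarrow> complex mat" where
  "ketbra n x = mat n n (\<lambda>(i,j). if i = x \<and> j = x then 1 else 0)"

definition proj :: "complex vec \<Rightarrow> complex mat" where
  "proj v = mat (dim_vec v) (dim_vec v) (\<lambda>(i,j). v $ i * cnj (v $ j))"

definition psd :: "nat \<Rightarrow> complex mat \<Rightarrow> bool" where
  "psd d M \<longleftrightarrow> M \<in> carrier_mat d d \<and> mat_adjoint M = M \<and>
     (\<forall>v \<in> carrier_vec d. 0 \<le> Re (conjugate v \<bullet> (M *\<^sub>v v)))"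

definition density :: "nat \<Rightarrow> complex mat \<Rightarrow> bool" where
  "density d M \<longleftrightarrow> psd d M \<and> mtrace M = 1"

definition isometry :: "complex mat \<Rightarrow> nat \<Rightarrow> nat \<Rightarrow> bool" where
  "isometry V dIn dOut \<longleftrightarrow> V \<in> carrier_mat dOut dIn \<and> mat_adjoint V * V = 1\<^sub>m dIn"

definition eta :: "real \<Rightarrow> real" where
  "eta t = (if 0 < t then t * log 2 t else 0)"

definition vN_entropy :: "complex mat \<Rightarrow> real" where
  "vN_entropy \<rho> = - (\<Sum>\<mu> \<in> spectrum \<rho>. real (order \<mu> (char_poly \<rho>)) * eta (Re \<mu>))"

section \<open>Channels given by an isometric extension V : A' -> B (x) E\<close>

text \<open>V \<in> carrier_mat (dB*dE) dA'; output ordering B then E.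
  Complementary channel: sigma |-> Tr_B (V sigma V^dagger).\<close>
definition compl_channel :: "complex mat \<Rightarrow> nat \<Rightarrow> nat \<Rightarrow> complex mat \<Rightarrow> complex mat" where
  "compl_channel V dB dE \<sigma> = ptrace_left dB dE (V * \<sigma> * mat_adjoint V)"

definition POVM :: "nat \<Rightarrow> nat \<Rightarrow> (nat \<Rightarrow> complex mat) \<Rightarrow> bool" where
  "POVM d m \<Lambda> \<longleftrightarrow> (\<forall>y<m. psd d (\<Lambda> y)) \<and> matsum d m \<Lambda> = 1\<^sub>m d"

definition entanglement_breaking :: "nat \<Rightarrow> nat \<Rightarrow> (complex mat \<Rightarrow> complex mat) \<Rightarrow> bool" where
  "entanglement_breaking dIn dOut T \<longleftrightarrow>
     (\<exists>m \<Lambda> \<omega>. POVM dIn m \<Lambda> \<and> (\<forall>y<m. density dOut (\<omega> y)) \<and>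
        (\<forall>\<sigma> \<in> carrier_mat dIn dIn. T \<sigma> = matsum dOut m (\<lambda>y. mtrace (\<Lambda> y * \<sigma>) \<cdot>\<^sub>m \<omega> y)))"

definition hadamard :: "complex mat \<Rightarrow> nat \<Rightarrow> nat \<Rightarrow> bool" where
  "hadamard V dB dE \<longleftrightarrow> entanglement_breaking (dim_col V) dE (compl_channel V dB dE)"

text \<open>X = {0..<n}, distribution p, reference A of dimension dA, pure states phi_x = |psi_x><psi_x|
  on A (x) A' (ordering A then A').\<close>
definition admissible :: "nat \<Rightarrow> nat \<Rightarrow> (nat \<Rightarrow> real) \<Rightarrow> nat \<Rightarrow> (nat \<Rightarrow> complex vec) \<Rightarrow> bool" where
  "admissible dA' n p dA \<psi> \<longleftrightarrow> 0 < dA \<and> (\<forall>x<n. 0 \<le> p x) \<and> (\<Sum>x<n. p x) = 1 \<and>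
     (\<forall>x<n. \<psi> x \<in> carrier_vec (dA * dA') \<and> (\<Sum>i<dA * dA'. (cmod (\<psi> x $ i))\<^sup>2) = 1)"

text \<open>rho^{XABE} = sum_x p(x) |x><x| (x) (1_A (x) V) phi_x (1_A (x) V)^dagger,
  systems ordered X, A, B, E.\<close>
definition cq_state :: "complex mat \<Rightarrow> nat \<Rightarrow> (nat \<Rightarrow> real) \<Rightarrow> nat \<Rightarrow> (nat \<Rightarrow> complex vec) \<Rightarrow> complex mat" where
  "cq_state V n p dA \<psi> = matsum (n * (dA * dim_row V)) n
     (\<lambda>x. complex_of_real (p x) \<cdot>\<^sub>m tensor (ketbra n x)
        (tensor (1\<^sub>m dA) V * proj (\<psi> x) * mat_adjoint (tensor (1\<^sub>m dA) V)))"

definition I_AX_B :: "complex mat \<Rightarrow> nat \<Rightarrow> nat \<Rightarrow> nat \<Rightarrow> (nat \<Rightarrow> real) \<Rightarrow> nat \<Rightarrow> (nat \<Rightarrow> complex vec) \<Rightarrow> real" where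
  "I_AX_B V dB dE n p dA \<psi> =
     (let \<rho> = cq_state V n p dA \<psi> in
        vN_entropy (ptrace_right (n * dA) (dB * dE) \<rho>)
      + vN_entropy (ptrace_right dB dE (ptrace_left (n * dA) (dB * dE) \<rho>))
      - vN_entropy (ptrace_right (n * dA * dB) dE \<rho>))"

definition H_A_given_X :: "complex mat \<Rightarrow> nat \<Rightarrow> nat \<Rightarrow> nat \<Rightarrow> (nat \<Rightarrow> real) \<Rightarrow> nat \<Rightarrow> (nat \<Rightarrow> complex vec) \<Rightarrow> real" where
  "H_A_given_X V dB dE n p dA \<psi> =
     (let \<rho> = cq_state V n p dA \<psi> in
        vN_entropy (ptrace_right (n * dA) (dB * dE) \<rho>)
      - vN_entropy (ptrace_right n (dA * (dB * dE)) \<rho>))"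

definition g_lambda :: "complex mat \<Rightarrow> nat \<Rightarrow> nat \<Rightarrow> real \<Rightarrow> real" where
  "g_lambda V dB dE lam = Sup {I_AX_B V dB dE n p dA \<psi> - lam * H_A_given_X V dB dE n p dA \<psi> |
      n p dA \<psi>. admissible (dim_col V) n p dA \<psi>}"

definition CE_one_shot :: "complex mat \<Rightarrow> nat \<Rightarrow> nat \<Rightarrow> (real \<times> real) set" where
  "CE_one_shot V dB dE = {(C, E) | C E n p dA \<psi>. admissible (dim_col V) n p dA \<psi> \<and>
      0 \<le> C \<and> C \<le> I_AX_B V dB dE n p dA \<psi> \<and> H_A_given_X V dB dE n p dA \<psi> \<le> E}"

text \<open>Reordering unitary C^{d1} (x) C^{d2} (x) C^{d3} (x) C^{d4} -> C^{d1} (x) C^{d3} (x) C^{d2} (x) C^{d4}.\<close>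
definition swap_mid :: "nat \<Rightarrow> nat \<Rightarrow> nat \<Rightarrow> nat \<Rightarrow> complex mat" where
  "swap_mid d1 d2 d3 d4 = mat (d1 * d2 * d3 * d4) (d1 * d2 * d3 * d4) (\<lambda>(r, s).
     (let e = s mod d4; c = (s div d4) mod d3; b = (s div (d4 * d3)) mod d2; a = s div (d4 * d3 * d2)
      in if r = ((a * d3 + c) * d2 + b) * d4 + e then 1 else 0))"

text \<open>Isometric extension of N^{(x) k}: C^{dA'^k} -> C^{dB^k} (x) C^{dE^k}
  (outputs reordered as B_1..B_k, E_1..E_k).\<close>
fun pow_iso :: "complex mat \<Rightarrow> nat \<Rightarrow> nat \<Rightarrow> nat \<Rightarrow> complex mat" where
  "pow_iso V dB dE 0 = 1\<^sub>m 1"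
| "pow_iso V dB dE (Suc k) = swap_mid (dB ^ k) (dE ^ k) dB dE * tensor (pow_iso V dB dE k) V"

definition CE_region :: "complex mat \<Rightarrow> nat \<Rightarrow> nat \<Rightarrow> (real \<times> real) set" where
  "CE_region V dB dE = closure (\<Union>k \<in> {1..}.
     (\<lambda>(C, E). (C / real k, E / real k)) ` CE_one_shot (pow_iso V dB dE k) (dB ^ k) (dE ^ k))"

end

theory Submission
  imports Defs
begin

text \<open>In terms of unnormalised pure signal amplitudes on R A', purity of the global state given x turns
  I(AX;B) - lam H(A|X) into H(B) plus the sum over x of (1 - lam) h(R) - h(E) - lam eta(weight), where h is
  the entropy of an unnormalised reduced state. It suffices to bound this value for N2 (x) N1, with N1 the
  Hadamard channel and N2 arbitrary, by the sum of the optimal values of N2 and N1.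

  Refined to rank one, the complement of N1 measures with vectors l_k and prepares pure states w_k. The
  ensemble for N1 takes the input of N2 as an additional reference; the ensemble for N2 consists of the
  states conditioned on the outcome k. The term H(B) is subadditive, and the remaining terms are affine in
  lam, so that only lam = 0 and lam = 1 matter; both cases follow from strong subadditivity, applied with k
  coherent or classical.

  Strong subadditivity follows from the monotonicity of relative entropy under partial trace. The latter is
  reduced, by differentiating in a parameter, to a quantity with a variational formula in which the partial
  trace only restricts the set of test operators.\<close>

section \<open>Spectral decompositions and entropy\<close>

text \<open>The obstacle is an input entangled across both channels: its entropies do not factorise.
  What helps is that E1 can be prepared from k alone: given k it is in the pure state w_k,
  uncorrelated with everything else, so k can join the alphabet for N2. At lam = 1 this classical
  use of k suffices, since E2 has at least as much entropy given E1 as given k. At lam = 0 the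
  entropy of the reference counts too: k is first kept coherent, which brings in the entropy of R B2
  by purity, and then dephased, which brings in the same entropy with the opposite sign, so that it
  cancels. One channel is left arbitrary so that an induction over tensor powers can peel off one
  copy at a time.

  States are amplitudes with several arguments over finite sets, so that regrouping systems is a
  bijection of index sets and every reduced state comes with a purification. Weights stay inside the
  amplitudes, so that the entropy of a classical mixture is a plain sum over its blocks. Operator
  logarithms are replaced by two eigenbases and the squared overlaps between them; the second
  argument of the relative entropy must be invertible, which forces a shift by epsilon and a
  limit.\<close>

definition orthonormal :: "'a set \<Rightarrow> 'i set \<Rightarrow> ('i \<Rightarrow> 'a \<Rightarrow> complex) \<Rightarrow> bool" where
  "orthonormal S I u \<longleftrightarrow> (\<forall>i\<in>I. \<forall>j\<in>I. (\<Sum>a\<in>S. cnj (u i a) * u j a) = (if i = j then 1 else 0))"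

text \<open>The family may be incomplete, so null eigenvalues can be left out. Later proofs can then
  exhibit rank-one states, Schmidt partners and products with a fixed vector without completing them
  to bases.\<close>

definition spectral :: "'a set \<Rightarrow> ('a \<Rightarrow> 'a \<Rightarrow> complex) \<Rightarrow> 'i set \<Rightarrow> ('i \<Rightarrow> real) \<Rightarrow> ('i \<Rightarrow> 'a \<Rightarrow> complex) \<Rightarrow> bool" where
  "spectral S \<rho> I l u \<longleftrightarrow> finite I \<and> orthonormal S I u \<and>
     (\<forall>a\<in>S. \<forall>b\<in>S. \<rho> a b = (\<Sum>i\<in>I. of_real (l i) * u i a * cnj (u i b)))"

lemma orthonormalD:
  "orthonormal S I u \<Longrightarrow> i \<in> I \<Longrightarrow> j \<in> I \<Longrightarrow> (\<Sum>a\<in>S. cnj (u i a) * u j a) = (if i = j then 1 else 0)"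
  by (simp add: orthonormal_def)

lemma spectral_eigen:
  assumes "spectral S \<rho> I l u" "i \<in> I" "a \<in> S"
  shows "(\<Sum>b\<in>S. \<rho> a b * u i b) = of_real (l i) * u i a"
proof -
  have fin: "finite I" and on: "orthonormal S I u"
    using assms by (auto simp: spectral_def)
  have "(\<Sum>b\<in>S. \<rho> a b * u i b) = (\<Sum>b\<in>S. \<Sum>j\<in>I. of_real (l j) * u j a * (cnj (u j b) * u i b))"
    using assms by (intro sum.cong refl) (simp add: spectral_def sum_distrib_right mult.assoc)
  also have "\<dots> = (\<Sum>j\<in>I. of_real (l j) * u j a * (\<Sum>b\<in>S. cnj (u j b) * u i b))"
    by (subst sum.swap) (simp add: sum_distrib_left)
  also have "\<dots> = (\<Sum>j\<in>I. if j = i then of_real (l j) * u j a else 0)"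
    using on assms by (intro sum.cong refl) (simp add: orthonormalD)
  also have "\<dots> = of_real (l i) * u i a" using fin assms by simp
  finally show ?thesis .
qed

lemma spectral_hermitian:
  assumes "spectral S \<rho> I l u" "a \<in> S" "b \<in> S"
  shows "cnj (\<rho> b a) = \<rho> a b"
  using assms by (simp add: spectral_def mult_ac)

text \<open>Both sides are the inner product of \<open>v j\<close> with \<rho> applied to
  \<open>u i\<close>, with \<rho> moved to either factor. Hence vectors of two decompositions are
  orthogonal unless their eigenvalues agree.\<close>

lemma spectral_overlap:
  assumes "spectral S \<rho> I l u" "spectral S \<rho> J m v" "i \<in> I" "j \<in> J"
  shows "of_real (l i) * (\<Sum>a\<in>S. cnj (v j a) * u i a) = of_real (m j) * (\<Sum>a\<in>S. cnj (v j a) * u i a)"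
proof -
  have "of_real (l i) * (\<Sum>a\<in>S. cnj (v j a) * u i a) = (\<Sum>a\<in>S. cnj (v j a) * (\<Sum>b\<in>S. \<rho> a b * u i b))"
    by (simp add: spectral_eigen[OF assms(1,3)] sum_distrib_left mult_ac)
  also have "\<dots> = (\<Sum>b\<in>S. \<Sum>a\<in>S. cnj (v j a) * (\<rho> a b * u i b))"
    by (subst sum.swap) (simp add: sum_distrib_left)
  also have "\<dots> = (\<Sum>b\<in>S. cnj (\<Sum>a\<in>S. \<rho> b a * v j a) * u i b)"
    by (intro sum.cong refl)
      (simp add: sum_distrib_left sum_distrib_right spectral_hermitian[OF assms(1)] mult_ac)
  also have "\<dots> = of_real (m j) * (\<Sum>a\<in>S. cnj (v j a) * u i a)"
    by (simp add: spectral_eigen[OF assms(2,4)] sum_distrib_left mult_ac)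
  finally show ?thesis .
qed

text \<open>A vector with nonzero eigenvalue lies in the range of \<rho>, hence in the span of the
  \<open>v j\<close>. Concretely, \<open>l i\<close> times the sum is the expectation of \<rho> in
  \<open>u i\<close>, expanded in the second decomposition, and that expectation is
  \<open>l i\<close>.\<close>

lemma spectral_parseval:
  assumes "finite S" "spectral S \<rho> I l u" "spectral S \<rho> J m v" "i \<in> I" "l i \<noteq> 0"
  shows "(\<Sum>j\<in>J. (cmod (\<Sum>a\<in>S. cnj (v j a) * u i a))\<^sup>2) = 1"
proof -
  have on: "orthonormal S I u" using assms by (auto simp: spectral_def)
  have "of_real (l i) * (of_real (\<Sum>j\<in>J. (cmod (\<Sum>a\<in>S. cnj (v j a) * u i a))\<^sup>2) :: complex)
     = (\<Sum>j\<in>J. of_real (m j) * (\<Sum>a\<in>S. cnj (v j a) * u i a) * cnj (\<Sum>a\<in>S. cnj (v j a) * u i a))"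
    using spectral_overlap[OF assms(2,3,4)] unfolding of_real_sum
    by (subst sum_distrib_left, intro sum.cong[OF refl]) (simp only: complex_norm_square mult.assoc[symmetric])
  also have "\<dots> = (\<Sum>j\<in>J. \<Sum>a\<in>S. \<Sum>b\<in>S. cnj (u i a) * (of_real (m j) * v j a * cnj (v j b)) * u i b)"
    by (intro sum.cong refl, subst sum.swap) (simp add: sum_distrib_left sum_distrib_right mult_ac)
  also have "\<dots> = (\<Sum>a\<in>S. \<Sum>b\<in>S. \<Sum>j\<in>J. cnj (u i a) * (of_real (m j) * v j a * cnj (v j b)) * u i b)"
    by (subst sum.swap, rule sum.cong[OF refl], subst sum.swap, simp)
  also have "\<dots> = (\<Sum>a\<in>S. cnj (u i a) * (\<Sum>b\<in>S. \<rho> a b * u i b))"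
    using assms(3) by (intro sum.cong refl)
      (simp add: spectral_def sum_distrib_left sum_distrib_right mult_ac)
  also have "\<dots> = of_real (l i) * (\<Sum>a\<in>S. cnj (u i a) * u i a)"
    by (simp add: spectral_eigen[OF assms(2,4)] sum_distrib_left mult_ac)
  also have "\<dots> = of_real (l i) * 1" using on assms(4) by (simp add: orthonormalD)
  finally have "(of_real (\<Sum>j\<in>J. (cmod (\<Sum>a\<in>S. cnj (v j a) * u i a))\<^sup>2) :: complex) = 1"
    using assms(5) by simp
  thus ?thesis using of_real_eq_1_iff by blast
qed

text \<open>The squared overlaps couple the two lists of eigenvalues: they vanish unless
  \<open>l i = m j\<close>, and the rows and columns of nonzero eigenvalues sum to one. The null
  eigenvalues contribute nothing because \<open>f 0 = 0\<close>.\<close>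

lemma spectral_sum_eq:
  fixes f :: "real \<Rightarrow> real"
  assumes "finite S" "spectral S \<rho> I l u" "spectral S \<rho> J m v" "f 0 = 0"
  shows "(\<Sum>i\<in>I. f (l i)) = (\<Sum>j\<in>J. f (m j))"
proof -
  define c where "c i j = (cmod (\<Sum>a\<in>S. cnj (v j a) * u i a))\<^sup>2" for i j
  have c': "c i j = (cmod (\<Sum>a\<in>S. cnj (u i a) * v j a))\<^sup>2" for i j
  proof -
    have "(\<Sum>a\<in>S. cnj (u i a) * v j a) = cnj (\<Sum>a\<in>S. cnj (v j a) * u i a)"
      by (simp add: mult_ac)
    thus ?thesis by (simp only: c_def complex_mod_cnj)
  qed
  have "(\<Sum>i\<in>I. f (l i)) = (\<Sum>i\<in>I. f (l i) * (\<Sum>j\<in>J. c i j))"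
  proof (intro sum.cong refl)
    fix i assume "i \<in> I"
    thus "f (l i) = f (l i) * (\<Sum>j\<in>J. c i j)"
      using spectral_parseval[OF assms(1-3)] assms(4) by (cases "l i = 0") (auto simp: c_def)
  qed
  also have "\<dots> = (\<Sum>i\<in>I. \<Sum>j\<in>J. f (m j) * c i j)"
    unfolding sum_distrib_left
  proof (intro sum.cong refl)
    fix i j assume "i \<in> I" "j \<in> J"
    from spectral_overlap[OF assms(2,3) this] have "c i j = 0 \<or> l i = m j"
      by (auto simp: c_def)
    thus "f (l i) * c i j = f (m j) * c i j" by auto
  qed
  also have "\<dots> = (\<Sum>j\<in>J. f (m j) * (\<Sum>i\<in>I. c i j))"
    by (subst sum.swap) (simp add: sum_distrib_left)
  also have "\<dots> = (\<Sum>j\<in>J. f (m j))"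
  proof (intro sum.cong refl)
    fix j assume "j \<in> J"
    thus "f (m j) * (\<Sum>i\<in>I. c i j) = f (m j)"
      using spectral_parseval[OF assms(1,3,2)] assms(4) by (cases "m j = 0") (auto simp: c')
  qed
  finally show ?thesis .
qed

section \<open>Existence of orthonormal eigenvectors\<close>

definition hermitian :: "'a set \<Rightarrow> ('a \<Rightarrow> 'a \<Rightarrow> complex) \<Rightarrow> bool" where
  "hermitian S \<rho> \<longleftrightarrow> (\<forall>a\<in>S. \<forall>b\<in>S. cnj (\<rho> b a) = \<rho> a b)"

lemma hermitian_adjoint:
  assumes "hermitian S \<rho>"
  shows "(\<Sum>a\<in>S. cnj (x a) * (\<Sum>b\<in>S. \<rho> a b * y b)) = (\<Sum>b\<in>S. cnj (\<Sum>a\<in>S. \<rho> b a * x a) * y b)"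
proof -
  have "(\<Sum>a\<in>S. cnj (x a) * (\<Sum>b\<in>S. \<rho> a b * y b)) = (\<Sum>b\<in>S. \<Sum>a\<in>S. cnj (x a) * (\<rho> a b * y b))"
    by (subst sum.swap) (simp add: sum_distrib_left)
  also have "\<dots> = (\<Sum>b\<in>S. cnj (\<Sum>a\<in>S. \<rho> b a * x a) * y b)"
  proof (intro sum.cong refl)
    fix b assume b: "b \<in> S"
    have "(\<Sum>a\<in>S. cnj (x a) * (\<rho> a b * y b)) = (\<Sum>a\<in>S. cnj (\<rho> b a * x a) * y b)"
      using assms b by (intro sum.cong refl) (simp add: hermitian_def mult_ac)
    thus "(\<Sum>a\<in>S. cnj (x a) * (\<rho> a b * y b)) = cnj (\<Sum>a\<in>S. \<rho> b a * x a) * y b"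
      by (simp add: sum_distrib_right)
  qed
  finally show ?thesis .
qed

lemma index_mult_mat_sum:
  assumes "A \<in> carrier_mat n m" "B \<in> carrier_mat m k" "i < n" "j < k"
  shows "(A * B) $$ (i,j) = (\<Sum>l<m. A $$ (i,l) * B $$ (l,j))"
  using assms by (auto simp: scalar_prod_def atLeast0LessThan intro!: sum.cong)

lemma mtrace_mult_commute:
  assumes "A \<in> carrier_mat n m" "B \<in> carrier_mat m n"
  shows "mtrace (A * B) = mtrace (B * A)"
proof -
  have "mtrace (A * B) = (\<Sum>i<n. \<Sum>j<m. A $$ (i,j) * B $$ (j,i))"
    using assms by (simp add: mtrace_def scalar_prod_def atLeast0LessThan)
  also have "\<dots> = mtrace (B * A)"
    using assms by (subst sum.swap) (simp add: mtrace_def scalar_prod_def atLeast0LessThan mult.commute)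
  finally show ?thesis .
qed

lemma mtrace_sum_eigenvalues:
  assumes A: "A \<in> carrier_mat n n" and c: "char_poly A = (\<Prod>e\<leftarrow>es. [:- e, 1:])"
  shows "mtrace A = sum_list es"
proof -
  obtain B P Q where s: "schur_decomposition A es = (B, P, Q)"
    by (cases "schur_decomposition A es") auto
  from schur_decomposition[OF A c s]
  have sim: "similar_mat_wit A B P Q" and d: "diag_mat B = es" by auto
  note w = similar_mat_witD2[OF A sim]
  have "mtrace A = mtrace (P * B * Q)" by (subst w(3)) (rule refl)
  also have "\<dots> = mtrace (Q * (P * B))"
    by (rule mtrace_mult_commute[of _ n n]) (rule mult_carrier_mat[OF w(6) w(5)], rule w(7))
  also have "Q * (P * B) = Q * P * B"
    by (rule assoc_mult_mat[OF w(7) w(6) w(5), symmetric])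
  also have "Q * P * B = B"
    unfolding w(2) by (rule left_mult_one_mat[OF w(5)])
  also have "mtrace B = sum_list es"
    unfolding d[symmetric] diag_mat_def mtrace_def
    by (simp add: sum_list_sum_nth atLeast0LessThan)
  finally show ?thesis .
qed

text \<open>Deflation without restriction to a subspace: \<rho>' has the known \<open>u i\<close> as
  eigenvectors for one common eigenvalue \<open>t\<close>, so an eigenvector for any other
  eigenvalue is orthogonal to all of them, and on such a vector \<rho>' acts as \<rho>.\<close>

lemma hermitian_eigenvectors:
  fixes \<rho> :: "nat \<Rightarrow> nat \<Rightarrow> complex"
  assumes herm: "hermitian {..<n} \<rho>"
  shows "k \<le> n \<Longrightarrow> \<exists>u l. orthonormal {..<n} {..<k} u \<and>
     (\<forall>i<k. \<forall>a<n. (\<Sum>b<n. \<rho> a b * u i b) = complex_of_real (l i) * u i a)"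
proof (induction k)
  case 0
  show ?case by (simp add: orthonormal_def)
next
  case (Suc k)
  then obtain u l where on: "orthonormal {..<n} {..<k} u"
    and ev: "\<And>i a. i < k \<Longrightarrow> a < n \<Longrightarrow> (\<Sum>b<n. \<rho> a b * u i b) = complex_of_real (l i) * u i a"
    by auto
  have kn: "k < n" using Suc.prems by simp
  define R where "R = (\<Sum>a<n. \<rho> a a)"
  \<comment> \<open>Shifting the known eigenvalues to a common t different from the mean of the
      remaining ones forces an eigenvalue other than t.\<close>
  define t where "t = (Re R - (\<Sum>i<k. l i)) / real (n - k) + 1"
  define \<rho>' where "\<rho>' a b = \<rho> a b + (\<Sum>i<k. of_real (t - l i) * u i a * cnj (u i b))" for a b
  define A where "A = mat n n (\<lambda>(a,b). \<rho>' a b)"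
  have A: "A \<in> carrier_mat n n" by (simp add: A_def)
  have herm': "hermitian {..<n} \<rho>'"
    using herm by (simp add: hermitian_def \<rho>'_def mult_ac)
  have act: "(\<Sum>b<n. \<rho>' a b * y b) = (\<Sum>b<n. \<rho> a b * y b)
      + (\<Sum>i<k. of_real (t - l i) * u i a * (\<Sum>b<n. cnj (u i b) * y b))" for a y
    unfolding \<rho>'_def by (simp add: distrib_right sum.distrib sum_distrib_left sum_distrib_right mult.assoc)
      (rule sum.swap)
  have ev': "(\<Sum>b<n. \<rho>' a b * u i b) = of_real t * u i a" if "i < k" "a < n" for i a
  proof -
    have "(\<Sum>j<k. of_real (t - l j) * u j a * (\<Sum>b<n. cnj (u j b) * u i b))
        = (\<Sum>j<k. if j = i then of_real (t - l j) * u j a else 0)"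
      using on that by (intro sum.cong refl) (simp add: orthonormalD)
    also have "\<dots> = of_real (t - l i) * u i a" using that by simp
    finally show ?thesis using ev[OF that] by (simp only: act) (simp add: algebra_simps)
  qed
  have "mtrace A = R + (\<Sum>a<n. \<Sum>i<k. of_real (t - l i) * u i a * cnj (u i a))"
    by (simp add: mtrace_def A_def \<rho>'_def R_def sum.distrib)
  also have "(\<Sum>a<n. \<Sum>i<k. of_real (t - l i) * u i a * cnj (u i a))
     = (\<Sum>i<k. of_real (t - l i) * (\<Sum>a<n. cnj (u i a) * u i a))"
    by (subst sum.swap) (simp add: sum_distrib_left mult_ac)
  also have "\<dots> = (\<Sum>i<k. of_real (t - l i))"
    using on by (intro sum.cong refl) (simp add: orthonormalD)
  finally have tr: "mtrace A = R + (\<Sum>i<k. of_real (t - l i))" .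
  obtain es where c: "char_poly A = (\<Prod>e\<leftarrow>es. [:- e, 1:])" and len: "length es = n"
    using char_poly_factorized[OF A] by auto
  \<comment> \<open>If all eigenvalues were \<open>t\<close>, the trace would be
    \<open>n * t\<close>, so \<open>(n - k) * t\<close> would be \<open>Re R\<close> minus the sum
    of the \<open>l i\<close>; the summand 1 in the definition of \<open>t\<close> excludes
    this.\<close>
  have "\<exists>e\<in>set es. e \<noteq> of_real t"
  proof (rule ccontr)
    assume "\<not> ?thesis"
    hence "es = replicate n (of_real t)" using len by (intro replicate_eqI) auto
    hence "mtrace A = of_nat n * of_real t"
      by (simp add: mtrace_sum_eigenvalues[OF A c] sum_list_replicate)
    hence "Re (of_nat n * of_real t) = Re (R + (\<Sum>i<k. of_real (t - l i)))" by (simp only: tr)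
    hence "Re R + (\<Sum>i<k. t - l i) = real n * t" by simp
    hence "Re R - (\<Sum>i<k. l i) = real (n - k) * t"
      using kn by (simp add: sum_subtractf of_nat_diff algebra_simps)
    moreover have "real (n - k) * t = (Re R - (\<Sum>i<k. l i)) + real (n - k)"
      using kn by (simp add: t_def distrib_left)
    ultimately show False using kn by simp
  qed
  then obtain e where e: "e \<in> set es" "e \<noteq> of_real t" by auto
  have "poly (char_poly A) e = 0" using e(1) unfolding c by (simp add: poly_prod_list prod_list_zero_iff)
  then obtain v where v: "eigenvector A v e"
    using eigenvalue_root_char_poly[OF A] by (auto simp: eigenvalue_def)
  hence vc: "v \<in> carrier_vec n" and v0: "v \<noteq> 0\<^sub>v n" and Av: "A *\<^sub>v v = e \<cdot>\<^sub>v v"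
    using A by (auto simp: eigenvector_def)
  have evv: "(\<Sum>b<n. \<rho>' a b * v $ b) = e * v $ a" if "a < n" for a
  proof -
    have "(A *\<^sub>v v) $ a = (\<Sum>b<n. \<rho>' a b * v $ b)"
      using that vc by (simp add: A_def scalar_prod_def atLeast0LessThan)
    thus ?thesis using Av vc that by simp
  qed
  define N where "N = (\<Sum>a<n. (cmod (v $ a))\<^sup>2)"
  obtain a0 where "a0 < n" "v $ a0 \<noteq> 0" using v0 vc by (auto simp: vec_eq_iff)
  hence N: "N > 0" unfolding N_def by (intro sum_pos2[where i = a0]) auto
  define w where "w a = v $ a / of_real (sqrt N)" for a
  have evw: "(\<Sum>b<n. \<rho>' a b * w b) = e * w a" if "a < n" for a
    using evv[OF that] by (simp add: w_def sum_divide_distrib[symmetric])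
  have ww: "(\<Sum>a<n. cnj (w a) * w a) = 1"
  proof -
    have "(\<Sum>a<n. cnj (w a) * w a) = (\<Sum>a<n. of_real ((cmod (v $ a))\<^sup>2) / of_real N)"
    proof (intro sum.cong refl)
      fix a
      have "complex_of_real (sqrt N) * of_real (sqrt N) = of_real N"
        using N by (simp flip: of_real_mult)
      thus "cnj (w a) * w a = of_real ((cmod (v $ a))\<^sup>2) / of_real N"
        by (simp add: w_def complex_norm_square mult_ac del: of_real_power)
    qed
    also have "\<dots> = of_real N / of_real N"
      by (simp only: N_def of_real_sum sum_divide_distrib)
    finally show ?thesis using N by simp
  qed
  have e_real: "e = of_real (Re e)"
  proof -
    have "e * (\<Sum>a<n. cnj (w a) * w a) = (\<Sum>a<n. cnj (w a) * (\<Sum>b<n. \<rho>' a b * w b))"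
      by (simp add: evw) (simp add: sum_distrib_left mult_ac)
    also have "\<dots> = cnj e * (\<Sum>a<n. cnj (w a) * w a)"
      by (subst hermitian_adjoint[OF herm']) (simp add: evw, simp add: sum_distrib_left mult_ac)
    finally have "e = cnj e" by (simp add: ww)
    thus ?thesis by (simp add: complex_eq_iff)
  qed
  have orth: "(\<Sum>a<n. cnj (u i a) * w a) = 0" if "i < k" for i
  proof -
    have "e * (\<Sum>a<n. cnj (u i a) * w a) = (\<Sum>a<n. cnj (u i a) * (\<Sum>b<n. \<rho>' a b * w b))"
      by (simp add: evw) (simp add: sum_distrib_left mult_ac)
    also have "\<dots> = of_real t * (\<Sum>a<n. cnj (u i a) * w a)"
      using that by (subst hermitian_adjoint[OF herm']) (simp add: ev', simp add: sum_distrib_left mult_ac)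
    finally show ?thesis using e(2) by simp
  qed
  have orth': "(\<Sum>a<n. cnj (w a) * u i a) = 0" if "i < k" for i
  proof -
    have "(\<Sum>a<n. cnj (w a) * u i a) = cnj (\<Sum>a<n. cnj (u i a) * w a)" by (simp add: mult_ac)
    thus ?thesis by (simp only: orth[OF that] complex_cnj_zero)
  qed
  have evw': "(\<Sum>b<n. \<rho> a b * w b) = of_real (Re e) * w a" if "a < n" for a
  proof -
    have "(\<Sum>b<n. \<rho>' a b * w b) = (\<Sum>b<n. \<rho> a b * w b)" by (simp add: act orth)
    thus ?thesis using evw[OF that] e_real by simp
  qed
  have "orthonormal {..<n} {..<Suc k} (u(k := w))"
    unfolding orthonormal_def
  proof (intro ballI)
    fix i j assume "i \<in> {..<Suc k}" "j \<in> {..<Suc k}"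
    hence "i < k \<or> i = k" "j < k \<or> j = k" by auto
    thus "(\<Sum>a<n. cnj ((u(k := w)) i a) * (u(k := w)) j a) = (if i = j then 1 else 0)"
      using on ww orth orth' by (auto simp: orthonormalD)
  qed
  moreover have "\<forall>i<Suc k. \<forall>a<n. (\<Sum>b<n. \<rho> a b * (u(k := w)) i b)
      = of_real ((l(k := Re e)) i) * (u(k := w)) i a"
    using ev evw' by (auto simp: less_Suc_eq)
  ultimately show ?case by blast
qed

text \<open>A left inverse of a square matrix is a right inverse.\<close>

lemma orthonormal_complete:
  fixes n :: nat
  assumes "orthonormal {..<n} {..<n} u" "a < n" "b < n"
  shows "(\<Sum>i<n. u i a * cnj (u i b)) = (if a = b then 1 else 0 :: complex)"
proof -
  define U where "U = mat n n (\<lambda>(a,i). u i a)"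
  define W where "W = mat n n (\<lambda>(i,a). cnj (u i a))"
  have "W * U = 1\<^sub>m n"
    using assms(1) by (intro eq_matI)
      (auto simp: U_def W_def scalar_prod_def atLeast0LessThan orthonormalD)
  hence "U * W = 1\<^sub>m n" by (intro mat_mult_left_right_inverse[of W n U]) (auto simp: U_def W_def)
  hence "(U * W) $$ (a,b) = (if a = b then 1 else 0)" using assms by simp
  thus ?thesis using assms by (simp add: U_def W_def scalar_prod_def atLeast0LessThan)
qed

lemma spectral_exists_nat:
  fixes n :: nat
  assumes "hermitian {..<n} \<rho>"
  shows "\<exists>l u. spectral {..<n} \<rho> {..<n} l u \<and>
    (\<forall>a<n. \<forall>b<n. (\<Sum>i<n. u i a * cnj (u i b)) = (if a = b then 1 else 0))"
proof -
  obtain u l where on: "orthonormal {..<n} {..<n} u"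
    and ev: "\<And>i a. i < n \<Longrightarrow> a < n \<Longrightarrow> (\<Sum>b<n. \<rho> a b * u i b) = complex_of_real (l i) * u i a"
    using hermitian_eigenvectors[OF assms order.refl] by blast
  have "\<rho> a b = (\<Sum>i<n. of_real (l i) * u i a * cnj (u i b))" if "a < n" "b < n" for a b
  proof -
    have "(\<Sum>i<n. of_real (l i) * u i a * cnj (u i b)) = (\<Sum>i<n. (\<Sum>c<n. \<rho> a c * u i c) * cnj (u i b))"
      using that by (simp add: ev)
    also have "\<dots> = (\<Sum>c<n. \<rho> a c * (\<Sum>i<n. u i c * cnj (u i b)))"
      unfolding sum_distrib_right sum_distrib_left by (subst sum.swap) (simp add: mult_ac)
    also have "\<dots> = (\<Sum>c<n. if c = b then \<rho> a c else 0)"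
      using that by (intro sum.cong refl) (simp add: orthonormal_complete[OF on])
    also have "\<dots> = \<rho> a b" using that by simp
    finally show ?thesis by simp
  qed
  hence "spectral {..<n} \<rho> {..<n} l u" using on by (simp add: spectral_def)
  thus ?thesis using orthonormal_complete[OF on] by blast
qed

section \<open>Complete eigenbases over arbitrary finite index sets, and the entropy they
  define\<close>

definition eigenbasis :: "'a set \<Rightarrow> ('a \<Rightarrow> 'a \<Rightarrow> complex) \<Rightarrow> 'i set \<Rightarrow> ('i \<Rightarrow> real) \<Rightarrow> ('i \<Rightarrow> 'a \<Rightarrow> complex) \<Rightarrow> bool" where
  "eigenbasis S \<rho> I l u \<longleftrightarrow> spectral S \<rho> I l u \<and>
     (\<forall>a\<in>S. \<forall>b\<in>S. (\<Sum>i\<in>I. u i a * cnj (u i b)) = (if a = b then 1 else 0))"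

lemma spectral_reindex:
  assumes "bij_betw \<pi> T S" "spectral S \<rho> I l u"
  shows "spectral T (\<lambda>a b. \<rho> (\<pi> a) (\<pi> b)) I l (\<lambda>i a. u i (\<pi> a))"
proof -
  note r = sum.reindex_bij_betw[OF assms(1), of "\<lambda>a. cnj (u i a) * u j a" for i j]
  show ?thesis using assms(2) bij_betwE[OF assms(1)]
    by (auto simp: spectral_def orthonormal_def r)
qed

lemma eigenbasis_reindex:
  assumes "bij_betw \<pi> T S" "eigenbasis S \<rho> I l u"
  shows "eigenbasis T (\<lambda>a b. \<rho> (\<pi> a) (\<pi> b)) I l (\<lambda>i a. u i (\<pi> a))"
  using spectral_reindex[OF assms(1), of \<rho> I l u] assms(2) bij_betwE[OF assms(1)]
    bij_betw_imp_inj_on[OF assms(1)]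
  by (auto simp: eigenbasis_def inj_on_eq_iff)

lemma eigenbasis_exists:
  assumes "finite S" "hermitian S \<rho>"
  shows "\<exists>l u. eigenbasis S \<rho> {..<card S} l u"
proof -
  obtain \<pi> where \<pi>: "bij_betw \<pi> {..<card S} S"
    using assms(1) bij_betw_from_nat_into_finite by blast
  define \<sigma> where "\<sigma> = inv_into {..<card S} \<pi>"
  have \<sigma>: "bij_betw \<sigma> S {..<card S}" unfolding \<sigma>_def using \<pi> by (rule bij_betw_inv_into)
  have \<pi>\<sigma>: "\<pi> (\<sigma> a) = a" "\<sigma> a < card S" if "a \<in> S" for a
    using that \<pi> bij_betwE[OF \<sigma>] by (auto simp: \<sigma>_def bij_betw_inv_into_right)
  have herm: "hermitian {..<card S} (\<lambda>a b. \<rho> (\<pi> a) (\<pi> b))"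
    using assms(2) bij_betwE[OF \<pi>] by (auto simp: hermitian_def)
  obtain l u where
    sp: "spectral {..<card S} (\<lambda>a b. \<rho> (\<pi> a) (\<pi> b)) {..<card S} l u"
    and co: "\<And>a b. a < card S \<Longrightarrow> b < card S \<Longrightarrow> (\<Sum>i<card S. u i a * cnj (u i b)) = (if a = b then 1 else 0)"
    using spectral_exists_nat[OF herm] by blast
  have "spectral S \<rho> {..<card S} l (\<lambda>i a. u i (\<sigma> a))"
    using spectral_reindex[OF \<sigma> sp] by (simp add: spectral_def \<pi>\<sigma>)
  moreover have "(\<Sum>i<card S. u i (\<sigma> a) * cnj (u i (\<sigma> b))) = (if a = b then 1 else 0)"
    if "a \<in> S" "b \<in> S" for a b
    using that by (subst co) (auto simp: \<pi>\<sigma> dest: arg_cong[of _ _ \<pi>])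
  ultimately have "eigenbasis S \<rho> {..<card S} l (\<lambda>i a. u i (\<sigma> a))" by (simp add: eigenbasis_def)
  thus ?thesis by blast
qed

text \<open>A definition cannot quantify over index types, so the choice ranges over decompositions
  indexed by initial segments of the naturals. By \<open>ent_eq\<close> the value is the same for
  every decomposition, with an index set of any type.\<close>

definition ent :: "'a set \<Rightarrow> ('a \<Rightarrow> 'a \<Rightarrow> complex) \<Rightarrow> real" where
  "ent S \<rho> = (SOME h. \<exists>n l u. spectral S \<rho> {..<n::nat} l u \<and> h = - (\<Sum>i<n. eta (l i)))"

lemma eta_0 [simp]: "eta 0 = 0" by (simp add: eta_def)

lemma ent_eq:
  assumes "finite S" "spectral S \<rho> I l u"
  shows "ent S \<rho> = - (\<Sum>i\<in>I. eta (l i))"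
proof -
  have "hermitian S \<rho>" using spectral_hermitian[OF assms(2)] by (simp add: hermitian_def)
  from eigenbasis_exists[OF assms(1) this]
  have "\<exists>h n l u. spectral S \<rho> {..<n::nat} l u \<and> h = - (\<Sum>i<n. eta (l i))"
    unfolding eigenbasis_def by blast
  from someI_ex[OF this] obtain n l' u' where
    "spectral S \<rho> {..<n::nat} l' u'" "ent S \<rho> = - (\<Sum>i<n. eta (l' i))"
    unfolding ent_def by auto
  with spectral_sum_eq[OF assms this(1), of eta] show ?thesis by simp
qed

lemma spectral_cong:
  assumes "\<And>a b. a \<in> S \<Longrightarrow> b \<in> S \<Longrightarrow> \<rho> a b = \<rho>' a b"
  shows "spectral S \<rho> I l u = spectral S \<rho>' I l u"
  using assms by (auto simp: spectral_def)

lemma ent_cong: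
  assumes "\<And>a b. a \<in> S \<Longrightarrow> b \<in> S \<Longrightarrow> \<rho> a b = \<rho>' a b"
  shows "ent S \<rho> = ent S \<rho>'"
  by (simp add: ent_def spectral_cong[OF assms])

lemma ent_reindex:
  assumes "finite S" "hermitian S \<rho>" "bij_betw \<pi> T S"
  shows "ent T (\<lambda>a b. \<rho> (\<pi> a) (\<pi> b)) = ent S \<rho>"
proof -
  obtain l u where sp: "spectral S \<rho> {..<card S} l u" using eigenbasis_exists[OF assms(1,2)] by (auto simp: eigenbasis_def)
  have "finite T" using assms by (simp add: bij_betw_finite)
  from ent_eq[OF this spectral_reindex[OF assms(3) sp]] ent_eq[OF assms(1) sp] show ?thesis by simp
qed

text \<open>Diagonalisation makes \<open>M\<close> similar to the diagonal matrix of the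
  \<open>l i\<close>. The order of a root of the characteristic polynomial therefore counts the
  indices carrying that eigenvalue, and grouping the sum over indices by eigenvalue gives the sum
  over the spectrum.\<close>

lemma vN_entropy_ent:
  assumes M: "M \<in> carrier_mat d d" and herm: "hermitian {..<d} (\<lambda>i j. M $$ (i,j))"
  shows "vN_entropy M = ent {..<d} (\<lambda>i j. M $$ (i,j))"
proof -
  obtain l u where sp: "spectral {..<d} (\<lambda>i j. M $$ (i,j)) {..<d} l u"
    and co: "\<And>a b. a < d \<Longrightarrow> b < d \<Longrightarrow> (\<Sum>i<d. u i a * cnj (u i b)) = (if a = b then 1 else 0)"
    using spectral_exists_nat[OF herm] by blast
  define U where "U = mat d d (\<lambda>(a,i). u i a)"
  define W where "W = mat d d (\<lambda>(i,a). cnj (u i a))"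
  define D where "D = mat d d (\<lambda>(i,j). if i = j then complex_of_real (l i) else 0)"
  have [simp]: "U \<in> carrier_mat d d" "W \<in> carrier_mat d d" "D \<in> carrier_mat d d"
    by (auto simp: U_def W_def D_def)
  have [simp]: "U * D \<in> carrier_mat d d" by (rule mult_carrier_mat[of _ d d]) auto
  have UW: "U * W = 1\<^sub>m d"
    using co by (intro eq_matI) (auto simp: U_def W_def scalar_prod_def atLeast0LessThan)
  have WU: "W * U = 1\<^sub>m d"
    by (rule mat_mult_left_right_inverse[OF _ _ UW]) auto
  have "M = U * D * W"
  proof (rule eq_matI)
    fix a b assume "a < dim_row (U * D * W)" "b < dim_col (U * D * W)"
    hence ab: "a < d" "b < d" by (simp_all add: U_def W_def)
    have UD: "(U * D) $$ (a,i) = of_real (l i) * u i a" if "i < d" for i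
    proof -
      have "(U * D) $$ (a,i) = (\<Sum>j<d. U $$ (a,j) * D $$ (j,i))"
        using that ab by (intro index_mult_mat_sum) auto
      also have "\<dots> = (\<Sum>j<d. if j = i then of_real (l i) * u i a else 0)"
        using that ab by (intro sum.cong refl) (auto simp: U_def D_def)
      finally show ?thesis using that by simp
    qed
    have "(U * D * W) $$ (a,b) = (\<Sum>i<d. (U * D) $$ (a,i) * W $$ (i,b))"
      using ab by (intro index_mult_mat_sum) auto
    also have "\<dots> = (\<Sum>i<d. of_real (l i) * u i a * cnj (u i b))"
      using ab by (intro sum.cong refl) (simp add: UD W_def)
    also have "\<dots> = M $$ (a,b)" using ab sp by (simp add: spectral_def)
    finally show "M $$ (a,b) = (U * D * W) $$ (a,b)" by simp
  qed (use M in \<open>auto simp: U_def W_def\<close>)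
  hence "similar_mat M D"
    using M UW WU by (intro similar_matI[of _ _ U W d]) auto
  hence "char_poly M = char_poly D" by (rule char_poly_similar)
  also have "\<dots> = (\<Prod>a\<leftarrow>diag_mat D. [:- a, 1:])"
    by (rule char_poly_upper_triangular[of _ d]) (auto simp: upper_triangular_def D_def)
  also have "\<dots> = (\<Prod>i<d. [:- complex_of_real (l i), 1:])"
  proof -
    have "diag_mat D = map (\<lambda>i. complex_of_real (l i)) [0..<d]"
      by (simp add: diag_mat_def D_def)
    thus ?thesis by (simp add: prod.list_conv_set_nth atLeast0LessThan)
  qed
  finally have cp: "char_poly M = (\<Prod>i<d. [:- complex_of_real (l i), 1:])" .
  have ord: "order \<mu> (char_poly M) = card {i. i < d \<and> complex_of_real (l i) = \<mu>}" for \<mu>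
  proof -
    have "order \<mu> (\<Prod>i\<in>I. [:- complex_of_real (l i), 1:]) = card {i\<in>I. complex_of_real (l i) = \<mu>}"
      if "finite I" for I
      using that
    proof (induction I)
      case (insert x F)
      have "{i \<in> insert x F. complex_of_real (l i) = \<mu>} = (if complex_of_real (l x) = \<mu> then insert x {i\<in>F. complex_of_real (l i) = \<mu>} else {i\<in>F. complex_of_real (l i) = \<mu>})"
        by auto
      moreover have "order \<mu> [:- complex_of_real (l x), 1:] = (if complex_of_real (l x) = \<mu> then 1 else 0)"
        by (auto simp: order_linear' order_0I)
      ultimately show ?case using insert
        by (simp add: order_mult prod_zero_iff del: mult_pCons_left)
    qed (simp add: order_0I)
    from this[of "{..<d}"] show ?thesis unfolding cp by (simp add: lessThan_def)
  qed
  have spec: "spectrum M = (\<lambda>i. complex_of_real (l i)) ` {..<d}"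
    unfolding spectrum_root_char_poly[OF M] unfolding cp by (auto simp: poly_prod)
  have "(\<Sum>i<d. eta (l i)) = (\<Sum>\<mu>\<in>spectrum M. \<Sum>i\<in>{i. i < d \<and> complex_of_real (l i) = \<mu>}. eta (l i))"
    unfolding spec by (subst sum.image_gen[of _ _ "\<lambda>i. complex_of_real (l i)"]) (auto intro!: sum.cong)
  also have "\<dots> = (\<Sum>\<mu>\<in>spectrum M. real (order \<mu> (char_poly M)) * eta (Re \<mu>))"
    unfolding ord
  proof (intro sum.cong refl)
    fix \<mu>
    have "(\<Sum>i\<in>{i. i < d \<and> complex_of_real (l i) = \<mu>}. eta (l i))
        = (\<Sum>i\<in>{i. i < d \<and> complex_of_real (l i) = \<mu>}. eta (Re \<mu>))"
      by (intro sum.cong) auto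
    thus "(\<Sum>i\<in>{i. i < d \<and> complex_of_real (l i) = \<mu>}. eta (l i))
        = real (card {i. i < d \<and> complex_of_real (l i) = \<mu>}) * eta (Re \<mu>)" by simp
  qed
  finally show ?thesis using ent_eq[OF _ sp] by (simp add: vN_entropy_def)
qed

section \<open>Monotonicity of relative entropy\<close>

lemma spectral_quadratic:
  assumes "spectral S \<rho> I r e"
  shows "(\<Sum>a\<in>S. \<Sum>b\<in>S. cnj (x a) * \<rho> a b * x b) = of_real (\<Sum>i\<in>I. r i * (cmod (\<Sum>a\<in>S. cnj (x a) * e i a))\<^sup>2)"
proof -
  have "(\<Sum>a\<in>S. \<Sum>b\<in>S. cnj (x a) * \<rho> a b * x b)
     = (\<Sum>a\<in>S. \<Sum>b\<in>S. \<Sum>i\<in>I. of_real (r i) * ((cnj (x a) * e i a) * cnj (cnj (x b) * e i b)))"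
    using assms by (intro sum.cong refl) (simp add: spectral_def sum_distrib_left sum_distrib_right mult_ac)
  also have "\<dots> = (\<Sum>i\<in>I. \<Sum>a\<in>S. \<Sum>b\<in>S. of_real (r i) * ((cnj (x a) * e i a) * cnj (cnj (x b) * e i b)))"
    by (subst (2) sum.swap, subst sum.swap) (rule refl)
  also have "\<dots> = (\<Sum>i\<in>I. of_real (r i) * of_real ((cmod (\<Sum>a\<in>S. cnj (x a) * e i a))\<^sup>2))"
    unfolding complex_norm_square cnj_sum sum_product by (simp add: sum_distrib_left)
  finally show ?thesis by simp
qed

lemma complete_inner:
  assumes "finite S" "\<forall>a\<in>S. \<forall>b\<in>S. (\<Sum>j\<in>J. f j a * cnj (f j b)) = (if a = b then 1 else 0 :: complex)"
  shows "(\<Sum>j\<in>J. cnj (\<Sum>a\<in>S. cnj (f j a) * y a) * (\<Sum>a\<in>S. cnj (f j a) * x a)) = (\<Sum>a\<in>S. cnj (y a) * x a)"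
proof -
  have "(\<Sum>j\<in>J. cnj (\<Sum>a\<in>S. cnj (f j a) * y a) * (\<Sum>a\<in>S. cnj (f j a) * x a))
      = (\<Sum>j\<in>J. \<Sum>a\<in>S. \<Sum>b\<in>S. cnj (y a) * x b * (f j a * cnj (f j b)))"
    by (simp add: sum_product mult_ac) (rule sum.cong[OF refl], rule sum.swap)
  also have "\<dots> = (\<Sum>a\<in>S. \<Sum>b\<in>S. cnj (y a) * x b * (\<Sum>j\<in>J. f j a * cnj (f j b)))"
    by (subst sum.swap, rule sum.cong[OF refl], subst sum.swap) (simp add: sum_distrib_left)
  also have "\<dots> = (\<Sum>a\<in>S. \<Sum>b\<in>S. if b = a then cnj (y a) * x b else 0)"
    using assms(2) by (intro sum.cong refl) auto
  also have "\<dots> = (\<Sum>a\<in>S. cnj (y a) * x a)" using assms(1) by simp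
  finally show ?thesis .
qed

lemma complete_norm:
  assumes "finite S" "\<forall>a\<in>S. \<forall>b\<in>S. (\<Sum>j\<in>J. f j a * cnj (f j b)) = (if a = b then 1 else 0 :: complex)"
  shows "(\<Sum>j\<in>J. of_real ((cmod (\<Sum>a\<in>S. cnj (f j a) * x a))\<^sup>2)) = (\<Sum>a\<in>S. cnj (x a) * x a)"
  using complete_inner[OF assms, of x x] by (simp add: complex_norm_square mult.commute del: of_real_power)

text \<open>The trace of \<open>Y^* \<sigma> Y\<close>, with \<open>Y^*\<close> the adjoint: the
  quadratic form of left multiplication by \<sigma> for the Hilbert-Schmidt inner product. At the
  adjoint of \<open>Z\<close> and with \<rho> in place of \<sigma> it is the form of right
  multiplication by \<rho> at \<open>Z\<close>.\<close>

definition quad_form :: "'a set \<Rightarrow> ('a \<Rightarrow> 'a \<Rightarrow> complex) \<Rightarrow> ('a \<Rightarrow> 'a \<Rightarrow> complex) \<Rightarrow> complex" where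
  "quad_form S \<sigma> Y = (\<Sum>a\<in>S. \<Sum>b\<in>S. \<Sum>c\<in>S. cnj (Y b a) * \<sigma> b c * Y c a)"

text \<open>Let sigma act by left and rho by right multiplication, so that the two commute. As tau tends to infinity,
  ln (sigma + tau rho) - ln sigma - ln tau tends to ln rho - ln sigma, and the expectation of its derivative
  in tau is, up to the term from ln tau, the supremum over Z of the following functional.\<close>

definition quad_fun :: "'a set \<Rightarrow> ('a \<Rightarrow> 'a \<Rightarrow> complex) \<Rightarrow> ('a \<Rightarrow> 'a \<Rightarrow> complex) \<Rightarrow> real \<Rightarrow> ('a \<Rightarrow> 'a \<Rightarrow> complex) \<Rightarrow> real" where
  "quad_fun S \<rho> \<sigma> \<tau> Z = Re (2 * (\<Sum>a\<in>S. \<Sum>b\<in>S. Z a b * \<rho> b a)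
     - quad_form S \<sigma> Z - of_real \<tau> * quad_form S \<rho> (\<lambda>a b. cnj (Z b a)))"

lemma quad_form_eq:
  assumes S: "finite S" and sp: "spectral S \<sigma> J s f"
    and co: "\<forall>a\<in>S. \<forall>b\<in>S. (\<Sum>k\<in>M. g k a * cnj (g k b)) = (if a = b then 1 else 0)"
  shows "quad_form S \<sigma> Y = (\<Sum>j\<in>J. \<Sum>k\<in>M. of_real (s j * (cmod (\<Sum>a\<in>S. cnj (g k a) * (\<Sum>b\<in>S. cnj (Y b a) * f j b)))\<^sup>2))"
proof -
  define h where "h j a = (\<Sum>b\<in>S. cnj (Y b a) * f j b)" for j a
  have "quad_form S \<sigma> Y = (\<Sum>j\<in>J. of_real (s j) * (\<Sum>a\<in>S. cnj (h j a) * h j a))"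
    unfolding quad_form_def spectral_quadratic[OF sp] of_real_sum h_def[symmetric]
    by (subst sum.swap) (simp add: sum_distrib_left complex_norm_square mult.commute del: of_real_power)
  thus ?thesis
    unfolding complete_norm[OF S co, symmetric] h_def by (simp add: sum_distrib_left)
qed

text \<open>The Hilbert-Schmidt inner product of \<rho> with its image under the inverse of left
  multiplication by \<sigma> plus \<tau> times right multiplication by \<rho>. The matrix units
  built from \<open>f j\<close> and \<open>e i\<close> are eigenvectors of that map, with eigenvalue
  \<open>s j + \<tau> * r i\<close>.\<close>

definition rel_resolvent where
  "rel_resolvent S I r e J s f \<tau> =
     (\<Sum>i\<in>I. \<Sum>j\<in>J. (cmod (\<Sum>a\<in>S. cnj (f j a) * e i a))\<^sup>2 * (r i)\<^sup>2 / (s j + \<tau> * r i :: real))"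

context
  fixes S :: "'a set" and \<rho> \<sigma> :: "'a \<Rightarrow> 'a \<Rightarrow> complex"
    and I :: "'i set" and r :: "'i \<Rightarrow> real" and e :: "'i \<Rightarrow> 'a \<Rightarrow> complex"
    and J :: "'j set" and s :: "'j \<Rightarrow> real" and f :: "'j \<Rightarrow> 'a \<Rightarrow> complex"
  assumes fin: "finite S"
    and eig_\<rho>: "eigenbasis S \<rho> I r e" and eig_\<sigma>: "eigenbasis S \<sigma> J s f"
begin

private definition ov :: "'i \<Rightarrow> 'j \<Rightarrow> complex" where
  "ov i j = (\<Sum>a\<in>S. cnj (f j a) * e i a)"

text \<open>The matrix entry of \<open>Z\<close> between \<open>f j\<close> and \<open>e i\<close>.
  In this mixed basis left multiplication by \<sigma> and right multiplication by \<rho> are both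
  diagonal, so \<open>quad_fun\<close> becomes a sum of independent scalar quadratics, one for each
  entry.\<close>

private definition entry :: "('a \<Rightarrow> 'a \<Rightarrow> complex) \<Rightarrow> 'i \<Rightarrow> 'j \<Rightarrow> complex" where
  "entry Z i j = (\<Sum>a\<in>S. cnj (f j a) * (\<Sum>b\<in>S. Z a b * e i b))"

private lemma fact_\<rho>: "a \<in> S \<Longrightarrow> b \<in> S \<Longrightarrow> \<rho> a b = (\<Sum>i\<in>I. of_real (r i) * e i a * cnj (e i b))"
  and finI: "finite I" and finJ: "finite J"
  and on_e: "orthonormal S I e" and on_f: "orthonormal S J f"
  and co_e: "\<forall>a\<in>S. \<forall>b\<in>S. (\<Sum>i\<in>I. e i a * cnj (e i b)) = (if a = b then 1 else 0)"
  and co_f: "\<forall>a\<in>S. \<forall>b\<in>S. (\<Sum>j\<in>J. f j a * cnj (f j b)) = (if a = b then 1 else 0)"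
  using eig_\<rho> eig_\<sigma> by (auto simp: eigenbasis_def spectral_def)

private lemma entry_adj: "entry Z i j = cnj (\<Sum>b\<in>S. cnj (e i b) * (\<Sum>a\<in>S. cnj (Z a b) * f j a))"
  unfolding entry_def cnj_sum complex_cnj_mult complex_cnj_cnj sum_distrib_left
  by (subst sum.swap) (simp add: mult_ac)

private lemma quad_1: "(\<Sum>a\<in>S. \<Sum>b\<in>S. Z a b * \<rho> b a) = (\<Sum>i\<in>I. \<Sum>j\<in>J. of_real (r i) * (cnj (ov i j) * entry Z i j))"
proof -
  have "(\<Sum>a\<in>S. \<Sum>b\<in>S. Z a b * \<rho> b a) = (\<Sum>a\<in>S. \<Sum>b\<in>S. \<Sum>i\<in>I. of_real (r i) * (cnj (e i a) * (Z a b * e i b)))"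
    by (intro sum.cong refl) (simp add: fact_\<rho> sum_distrib_left mult_ac)
  also have "\<dots> = (\<Sum>i\<in>I. \<Sum>a\<in>S. \<Sum>b\<in>S. of_real (r i) * (cnj (e i a) * (Z a b * e i b)))"
    by (subst (2) sum.swap, subst sum.swap) simp
  also have "\<dots> = (\<Sum>i\<in>I. of_real (r i) * (\<Sum>a\<in>S. cnj (e i a) * (\<Sum>b\<in>S. Z a b * e i b)))"
    by (simp add: sum_distrib_left)
  also have "\<dots> = (\<Sum>i\<in>I. of_real (r i) * (\<Sum>j\<in>J. cnj (ov i j) * entry Z i j))"
    unfolding ov_def entry_def by (simp only: complete_inner[OF fin co_f])
  finally show ?thesis by (simp add: sum_distrib_left)
qed

private lemma quad_2: "quad_form S \<rho> (\<lambda>a b. cnj (Z b a)) = (\<Sum>i\<in>I. \<Sum>j\<in>J. of_real (r i * (cmod (entry Z i j))\<^sup>2))"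
  using quad_form_eq[OF fin _ co_f, of \<rho> I r e] eig_\<rho> by (simp add: eigenbasis_def entry_def)

private lemma quad_3: "quad_form S \<sigma> Z = (\<Sum>i\<in>I. \<Sum>j\<in>J. of_real (s j * (cmod (entry Z i j))\<^sup>2))"
  unfolding entry_adj complex_mod_cnj
  using quad_form_eq[OF fin _ co_e, of \<sigma> J s f] eig_\<sigma> by (subst sum.swap) (simp add: eigenbasis_def)

private lemma quad_fun_eq: "quad_fun S \<rho> \<sigma> \<tau> Z =
   (\<Sum>i\<in>I. \<Sum>j\<in>J. 2 * Re (of_real (r i) * (cnj (ov i j) * entry Z i j)) - (s j + \<tau> * r i) * (cmod (entry Z i j))\<^sup>2)"
  unfolding quad_fun_def quad_1 quad_2 quad_3
  by (simp add: sum_subtractf sum.distrib sum_distrib_left distrib_right mult.assoc algebra_simps del: of_real_mult of_real_power flip: of_real_sum of_real_mult)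

text \<open>Completing the square entry by entry: the defect is the squared modulus of
  \<open>r i * ov i j - D * entry Z i j\<close> divided by \<open>D\<close>, and \<open>D\<close> is
  positive because \<open>s j\<close> is.\<close>

lemma quad_fun_le:
  assumes "\<And>i. i \<in> I \<Longrightarrow> 0 \<le> r i" "\<And>j. j \<in> J \<Longrightarrow> 0 < s j" "0 \<le> \<tau>"
  shows "quad_fun S \<rho> \<sigma> \<tau> Z \<le> rel_resolvent S I r e J s f \<tau>"
  unfolding quad_fun_eq rel_resolvent_def ov_def[symmetric]
proof (intro sum_mono)
  fix i j assume ij: "i \<in> I" "j \<in> J"
  define D where "D = s j + \<tau> * r i"
  have D: "D > 0" using assms ij by (simp add: D_def add_pos_nonneg)
  have "0 \<le> (cmod (of_real (r i) * ov i j - of_real D * entry Z i j))\<^sup>2" by simp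
  also have "\<dots> = (cmod (ov i j))\<^sup>2 * (r i)\<^sup>2
      - D * (2 * Re (of_real (r i) * (cnj (ov i j) * entry Z i j)) - D * (cmod (entry Z i j))\<^sup>2)"
    unfolding cmod_power2 by (simp add: power2_eq_square algebra_simps)
  finally have "2 * Re (of_real (r i) * (cnj (ov i j) * entry Z i j)) - D * (cmod (entry Z i j))\<^sup>2
      \<le> (cmod (ov i j))\<^sup>2 * (r i)\<^sup>2 / D"
    using D by (simp add: field_simps)
  thus "2 * Re (of_real (r i) * (cnj (ov i j) * entry Z i j)) - (s j + \<tau> * r i) * (cmod (entry Z i j))\<^sup>2
      \<le> (cmod (ov i j))\<^sup>2 * (r i)\<^sup>2 / (s j + \<tau> * r i)" by (simp only: D_def)
qed

lemma quad_fun_attained: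
  assumes "\<And>i. i \<in> I \<Longrightarrow> 0 \<le> r i" "\<And>j. j \<in> J \<Longrightarrow> 0 < s j" "0 \<le> \<tau>"
  shows "\<exists>Z. quad_fun S \<rho> \<sigma> \<tau> Z = rel_resolvent S I r e J s f \<tau>"
proof -
  \<comment> \<open>The vertex of each scalar quadratic; \<open>Z\<close> is the matrix with these
    entries in the mixed basis.\<close>
  define z where "z i j = of_real (r i / (s j + \<tau> * r i)) * ov i j" for i j
  define Z where "Z a b = (\<Sum>j\<in>J. f j a * (\<Sum>i\<in>I. z i j * cnj (e i b)))" for a b
  have entry: "entry Z i j = z i j" if ij: "i \<in> I" "j \<in> J" for i j
  proof -
    have "(\<Sum>b\<in>S. Z a b * e i b) = (\<Sum>k\<in>J. f k a * z i k)" for a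
    proof -
      have "(\<Sum>b\<in>S. Z a b * e i b) = (\<Sum>b\<in>S. \<Sum>k\<in>J. \<Sum>l\<in>I. f k a * z l k * (cnj (e l b) * e i b))"
        by (simp add: Z_def sum_distrib_left sum_distrib_right mult.assoc)
      also have "\<dots> = (\<Sum>k\<in>J. \<Sum>l\<in>I. f k a * z l k * (\<Sum>b\<in>S. cnj (e l b) * e i b))"
        by (subst sum.swap, rule sum.cong[OF refl], subst sum.swap) (simp add: sum_distrib_left)
      also have "\<dots> = (\<Sum>k\<in>J. \<Sum>l\<in>I. if l = i then f k a * z l k else 0)"
        using ij on_e by (intro sum.cong refl) (simp add: orthonormalD)
      finally show ?thesis using ij finI by simp
    qed
    hence "entry Z i j = (\<Sum>a\<in>S. \<Sum>k\<in>J. z i k * (cnj (f j a) * f k a))"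
      by (simp add: entry_def sum_distrib_left mult_ac)
    also have "\<dots> = (\<Sum>k\<in>J. z i k * (\<Sum>a\<in>S. cnj (f j a) * f k a))"
      by (subst sum.swap) (simp add: sum_distrib_left)
    also have "\<dots> = (\<Sum>k\<in>J. if k = j then z i k else 0)"
      using ij on_f by (intro sum.cong refl) (simp add: orthonormalD)
    finally show ?thesis using ij finJ by simp
  qed
  have "quad_fun S \<rho> \<sigma> \<tau> Z = rel_resolvent S I r e J s f \<tau>"
    unfolding quad_fun_eq rel_resolvent_def ov_def[symmetric]
  proof (intro sum.cong refl)
    fix i j assume ij: "i \<in> I" "j \<in> J"
    define D where "D = s j + \<tau> * r i"
    have D: "D > 0" using assms ij by (simp add: D_def add_pos_nonneg)
    have 1: "Re (of_real (r i) * (cnj (ov i j) * z i j)) = (r i)\<^sup>2 / D * (cmod (ov i j))\<^sup>2"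
      unfolding z_def D_def[symmetric] cmod_power2
      by (simp add: power2_eq_square algebra_simps add_divide_distrib)
    have 2: "(cmod (z i j))\<^sup>2 = (r i / D)\<^sup>2 * (cmod (ov i j))\<^sup>2"
      unfolding z_def D_def[symmetric] by (simp add: norm_mult norm_divide power_mult_distrib power_divide)
    show "2 * Re (of_real (r i) * (cnj (ov i j) * entry Z i j)) - (s j + \<tau> * r i) * (cmod (entry Z i j))\<^sup>2
        = (cmod (ov i j))\<^sup>2 * (r i)\<^sup>2 / (s j + \<tau> * r i)"
      unfolding entry[OF ij] D_def[symmetric] 1 2 using D by (simp add: power2_eq_square field_simps)
  qed
  thus ?thesis by blast
qed

end

section \<open>Passage to marginals, and recovery of the logarithm from its derivative\<close>

lemma sum_product_set: "(\<Sum>x\<in>S \<times> T. g x) = (\<Sum>a\<in>S. \<Sum>t\<in>T. g (a, t))"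
  by (simp add: sum.cartesian_product)

lemma quad_form_partial_trace:
  assumes T: "finite T"
  shows "quad_form (S \<times> T) \<sigma> (\<lambda>x y. if snd x = snd y then Y (fst x) (fst y) else 0) = quad_form S (\<lambda>a b. \<Sum>t\<in>T. \<sigma> (a, t) (b, t)) Y"
proof -
  let ?Y = "\<lambda>x y. if snd x = snd y then Y (fst x) (fst y) else 0"
  have "(\<Sum>y\<in>S \<times> T. \<Sum>w\<in>S \<times> T. cnj (?Y y (a, t)) * \<sigma> y w * ?Y w (a, t)) = (\<Sum>b\<in>S. \<Sum>c\<in>S. cnj (Y b a) * \<sigma> (b, t) (c, t) * Y c a)"
    if "t \<in> T" for a t
  proof -
    have "(\<Sum>y\<in>S \<times> T. \<Sum>w\<in>S \<times> T. cnj (?Y y (a, t)) * \<sigma> y w * ?Y w (a, t))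
      = (\<Sum>b\<in>S. \<Sum>t'\<in>T. if t' = t then (\<Sum>c\<in>S. \<Sum>u\<in>T. if u = t then cnj (Y b a) * \<sigma> (b, t') (c, u) * Y c a else 0) else 0)"
      unfolding sum_product_set by (intro sum.cong refl) (auto intro!: sum.cong)
    thus ?thesis using T that by simp
  qed
  hence "quad_form (S \<times> T) \<sigma> ?Y = (\<Sum>a\<in>S. \<Sum>t\<in>T. \<Sum>b\<in>S. \<Sum>c\<in>S. cnj (Y b a) * \<sigma> (b, t) (c, t) * Y c a)"
    unfolding quad_form_def by (subst sum_product_set) simp
  also have "\<dots> = (\<Sum>a\<in>S. \<Sum>b\<in>S. \<Sum>c\<in>S. \<Sum>t\<in>T. cnj (Y b a) * \<sigma> (b, t) (c, t) * Y c a)"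
    by (rule sum.cong[OF refl], subst sum.swap, rule sum.cong[OF refl], rule sum.swap)
  finally show ?thesis by (simp add: quad_form_def sum_distrib_left sum_distrib_right)
qed

text \<open>The test operator on the left is \<open>Z\<close> tensored with the identity on
  \<open>T\<close>, so only the partial traces over \<open>T\<close> enter. Hence the value at any
  test operator for the marginals is also a value for the joint pair.\<close>

lemma quad_fun_partial_trace:
  assumes T: "finite T"
  shows "quad_fun (S \<times> T) \<rho> \<sigma> \<tau> (\<lambda>x y. if snd x = snd y then Z (fst x) (fst y) else 0)
     = quad_fun S (\<lambda>a b. \<Sum>t\<in>T. \<rho> (a, t) (b, t)) (\<lambda>a b. \<Sum>t\<in>T. \<sigma> (a, t) (b, t)) \<tau> Z"
proof -
  let ?Z = "\<lambda>x y. if snd x = snd y then Z (fst x) (fst y) else 0"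
  have "(\<Sum>x\<in>S \<times> T. \<Sum>y\<in>S \<times> T. ?Z x y * \<rho> y x) = (\<Sum>a\<in>S. \<Sum>t\<in>T. \<Sum>b\<in>S. \<Sum>u\<in>T. if u = t then Z a b * \<rho> (b, u) (a, t) else 0)"
    unfolding sum_product_set by (intro sum.cong refl) auto
  also have "\<dots> = (\<Sum>a\<in>S. \<Sum>t\<in>T. \<Sum>b\<in>S. Z a b * \<rho> (b, t) (a, t))" using T by simp
  also have "\<dots> = (\<Sum>a\<in>S. \<Sum>b\<in>S. Z a b * (\<Sum>t\<in>T. \<rho> (b, t) (a, t)))"
    by (rule sum.cong[OF refl], subst sum.swap) (simp add: sum_distrib_left)
  finally have 1: "(\<Sum>x\<in>S \<times> T. \<Sum>y\<in>S \<times> T. ?Z x y * \<rho> y x) = (\<Sum>a\<in>S. \<Sum>b\<in>S. Z a b * (\<Sum>t\<in>T. \<rho> (b, t) (a, t)))" .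
  have adj: "(\<lambda>x y. cnj (?Z y x)) = (\<lambda>x y. if snd x = snd y then cnj (Z (fst y) (fst x)) else 0)" by (intro ext) auto
  show ?thesis
    unfolding quad_fun_def 1 adj quad_form_partial_trace[OF T] quad_form_partial_trace[OF T, where Y = "\<lambda>a b. cnj (Z b a)"] ..
qed

text \<open>The difference \<open>G\<close> of the two sides with
  \<open>ln (s + \<tau> * r) - ln s\<close> is zero at \<tau> = 0, and its derivative is the
  difference of the resolvent sums, so \<open>G\<close> stays nonnegative. As \<tau> grows, each
  logarithm behaves like \<open>ln r + ln \<tau>\<close>; the terms in \<open>ln \<tau>\<close>
  cancel between the two sides because the total weights agree.\<close>

lemma log_sum_mono:
  fixes c r s :: "'p \<Rightarrow> real" and c' r' s' :: "'q \<Rightarrow> real"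
  assumes fin: "finite P" "finite Q"
    and pos: "\<And>x. x \<in> P \<Longrightarrow> 0 \<le> r x" "\<And>x. x \<in> P \<Longrightarrow> 0 < s x"
    and pos': "\<And>x. x \<in> Q \<Longrightarrow> 0 \<le> r' x" "\<And>x. x \<in> Q \<Longrightarrow> 0 < s' x"
    and tr: "(\<Sum>x\<in>P. c x * r x) = (\<Sum>x\<in>Q. c' x * r' x)"
    and res: "\<And>\<tau>. 0 \<le> \<tau> \<Longrightarrow> (\<Sum>x\<in>Q. c' x * (r' x)\<^sup>2 / (s' x + \<tau> * r' x)) \<le> (\<Sum>x\<in>P. c x * (r x)\<^sup>2 / (s x + \<tau> * r x))"
  shows "(\<Sum>x\<in>Q. c' x * r' x * (ln (r' x) - ln (s' x))) \<le> (\<Sum>x\<in>P. c x * r x * (ln (r x) - ln (s x)))"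
proof -
  define G where "G \<tau> = (\<Sum>x\<in>P. c x * r x * (ln (s x + \<tau> * r x) - ln (s x)))
      - (\<Sum>x\<in>Q. c' x * r' x * (ln (s' x + \<tau> * r' x) - ln (s' x)))" for \<tau>
  have G: "0 \<le> G \<tau>" if "0 \<le> \<tau>" for \<tau>
  proof -
    have "G 0 \<le> G \<tau>"
    proof (rule DERIV_nonneg_imp_nondecreasing[OF that])
      fix t :: real assume t: "0 \<le> t"
      have d: "((\<lambda>\<tau>. c * r * (ln (s + \<tau> * r) - ln s)) has_real_derivative c * r\<^sup>2 / (s + t * r)) (at t)"
        if "0 \<le> r" "0 < s" for c r s :: real
      proof -
        have "s + t * r > 0" using t that by (simp add: add_pos_nonneg)
        thus ?thesis by (auto intro!: derivative_eq_intros simp: power2_eq_square)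
      qed
      have "(G has_real_derivative (\<Sum>x\<in>P. c x * (r x)\<^sup>2 / (s x + t * r x)) - (\<Sum>x\<in>Q. c' x * (r' x)\<^sup>2 / (s' x + t * r' x))) (at t)"
        unfolding G_def using pos pos' by (intro DERIV_diff DERIV_sum d) auto
      thus "\<exists>y. (G has_real_derivative y) (at t) \<and> 0 \<le> y" using res[OF t] by (intro exI conjI) auto
    qed
    thus ?thesis by (simp add: G_def)
  qed
  \<comment> \<open>For \<open>r = 0\<close> the factor \<open>r\<close> makes the expression
    constantly zero, so the value assigned to \<open>ln 0\<close> does not matter.\<close>
  have lim: "((\<lambda>\<tau>. c * r * (ln (s + \<tau> * r) - ln s - ln \<tau>)) \<longlongrightarrow> c * r * (ln r - ln s)) at_top"
    if "0 \<le> r" "0 < s" for c r s :: real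
  proof (cases "r = 0")
    case False
    hence r: "r > 0" using that by simp
    have "((\<lambda>\<tau>. c * r * (ln (s / \<tau> + r) - ln s)) \<longlongrightarrow> c * r * (ln (0 + r) - ln s)) at_top"
      using r by (intro tendsto_intros tendsto_divide_0[OF tendsto_const] filterlim_at_top_imp_at_infinity filterlim_ident) auto
    moreover have "eventually (\<lambda>\<tau>. c * r * (ln (s / \<tau> + r) - ln s) = c * r * (ln (s + \<tau> * r) - ln s - ln \<tau>)) at_top"
      using eventually_gt_at_top[of 0]
    proof eventually_elim
      case (elim \<tau>)
      have "s / \<tau> + r = (s + \<tau> * r) / \<tau>" using elim by (simp add: field_simps)
      moreover have "s + \<tau> * r > 0" using elim r that by (simp add: add_pos_pos)
      ultimately show ?case using elim by (simp add: ln_div)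
    qed
    ultimately show ?thesis by (simp add: tendsto_cong)
  qed simp
  have "((\<lambda>\<tau>. (\<Sum>x\<in>P. c x * r x * (ln (s x + \<tau> * r x) - ln (s x) - ln \<tau>))
      - (\<Sum>x\<in>Q. c' x * r' x * (ln (s' x + \<tau> * r' x) - ln (s' x) - ln \<tau>)))
    \<longlongrightarrow> (\<Sum>x\<in>P. c x * r x * (ln (r x) - ln (s x))) - (\<Sum>x\<in>Q. c' x * r' x * (ln (r' x) - ln (s' x)))) at_top"
    using pos pos' by (intro tendsto_diff tendsto_sum lim) auto
  moreover have "eventually (\<lambda>\<tau>. 0 \<le> (\<Sum>x\<in>P. c x * r x * (ln (s x + \<tau> * r x) - ln (s x) - ln \<tau>))
      - (\<Sum>x\<in>Q. c' x * r' x * (ln (s' x + \<tau> * r' x) - ln (s' x) - ln \<tau>))) at_top"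
    using eventually_ge_at_top[of 0]
  proof eventually_elim
    case (elim \<tau>)
    have "(\<Sum>x\<in>P. c x * r x * (ln (s x + \<tau> * r x) - ln (s x) - ln \<tau>))
      - (\<Sum>x\<in>Q. c' x * r' x * (ln (s' x + \<tau> * r' x) - ln (s' x) - ln \<tau>))
      = G \<tau> - ln \<tau> * ((\<Sum>x\<in>P. c x * r x) - (\<Sum>x\<in>Q. c' x * r' x))"
      by (simp add: G_def right_diff_distrib sum_subtractf sum_distrib_left mult_ac)
    thus ?case using G[OF elim] tr by simp
  qed
  ultimately have "0 \<le> (\<Sum>x\<in>P. c x * r x * (ln (r x) - ln (s x))) - (\<Sum>x\<in>Q. c' x * r' x * (ln (r' x) - ln (s' x)))"
    by (intro tendsto_lowerbound[where F = at_top]) auto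
  thus ?thesis by simp
qed

text \<open>Each side is a relative entropy written in eigenbases: the expectation of the logarithm
  of \<sigma> in the state \<rho> is the sum over \<open>j\<close> of \<open>ln (s j)\<close> times
  the \<rho>-weight of \<open>f j\<close>, and this weight is the sum of the \<open>r i\<close>
  against the squared overlaps.\<close>

lemma relative_entropy_mono:
  assumes S: "finite S" and T: "finite T"
    and \<rho>: "eigenbasis (S \<times> T) \<rho> I r e" and \<sigma>: "eigenbasis (S \<times> T) \<sigma> J s f"
    and \<rho>': "eigenbasis S (\<lambda>a b. \<Sum>t\<in>T. \<rho> (a, t) (b, t)) I' r' e'"
    and \<sigma>': "eigenbasis S (\<lambda>a b. \<Sum>t\<in>T. \<sigma> (a, t) (b, t)) J' s' f'"
    and pos: "\<And>i. i \<in> I \<Longrightarrow> 0 \<le> r i" "\<And>j. j \<in> J \<Longrightarrow> 0 < s j"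
    and pos': "\<And>i. i \<in> I' \<Longrightarrow> 0 \<le> r' i" "\<And>j. j \<in> J' \<Longrightarrow> 0 < s' j"
  shows "(\<Sum>i\<in>I'. r' i * ln (r' i)) - (\<Sum>j\<in>J'. ln (s' j) * (\<Sum>i\<in>I'. r' i * (cmod (\<Sum>a\<in>S. cnj (f' j a) * e' i a))\<^sup>2))
    \<le> (\<Sum>i\<in>I. r i * ln (r i)) - (\<Sum>j\<in>J. ln (s j) * (\<Sum>i\<in>I. r i * (cmod (\<Sum>x\<in>S \<times> T. cnj (f j x) * e i x))\<^sup>2))"
proof -
  \<comment> \<open>The squared overlaps are nonnegative and sum to one over \<open>j\<close> for
    each fixed \<open>i\<close>; weighted by \<open>r i\<close> they sum to the trace of \<rho>,
    which the partial trace preserves.\<close>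
  define c where "c = (\<lambda>(i, j). (cmod (\<Sum>x\<in>S \<times> T. cnj (f j x) * e i x))\<^sup>2)"
  define c' where "c' = (\<lambda>(i, j). (cmod (\<Sum>a\<in>S. cnj (f' j a) * e' i a))\<^sup>2)"
  have fin: "finite I" "finite J" "finite I'" "finite J'"
    using \<rho> \<sigma> \<rho>' \<sigma>' by (auto simp: eigenbasis_def spectral_def)
  have one: "(\<Sum>j\<in>K. (cmod (\<Sum>a\<in>A. cnj (g j a) * v i a))\<^sup>2) = 1"
    if "finite A" "eigenbasis A \<omega> K m g" "eigenbasis A \<omega>' M q v" "i \<in> M" for A :: "'z set" and \<omega> \<omega>' and K :: "'k set" and m g M q v and i :: 'm
  proof -
    have "(\<Sum>j\<in>K. complex_of_real ((cmod (\<Sum>a\<in>A. cnj (g j a) * v i a))\<^sup>2)) = (\<Sum>a\<in>A. cnj (v i a) * v i a)"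
      using that by (intro complete_norm) (auto simp: eigenbasis_def)
    also have "\<dots> = 1" using that orthonormalD[of A M v i i] by (simp add: eigenbasis_def spectral_def)
    finally show ?thesis by (simp only: of_real_sum[symmetric] of_real_eq_1_iff)
  qed
  have tr: "complex_of_real (\<Sum>i\<in>M. q i) = (\<Sum>a\<in>A. \<omega> a a)" if "eigenbasis A \<omega> M q v" for A :: "'z set" and \<omega> and M :: "'m set" and q v
  proof -
    have "(\<Sum>a\<in>A. \<omega> a a) = (\<Sum>a\<in>A. \<Sum>i\<in>M. of_real (q i) * (cnj (v i a) * v i a))"
      using that by (intro sum.cong refl) (simp add: eigenbasis_def spectral_def mult_ac)
    also have "\<dots> = (\<Sum>i\<in>M. of_real (q i) * (\<Sum>a\<in>A. cnj (v i a) * v i a))"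
      by (subst sum.swap) (simp add: sum_distrib_left)
    also have "\<dots> = (\<Sum>i\<in>M. of_real (q i))"
    proof (intro sum.cong refl)
      fix i assume "i \<in> M"
      thus "of_real (q i) * (\<Sum>a\<in>A. cnj (v i a) * v i a) = of_real (q i)"
        using that orthonormalD[of A M v i i] by (simp add: eigenbasis_def spectral_def)
    qed
    finally show ?thesis by simp
  qed
  have sc: "(\<Sum>x\<in>I \<times> J. c x * r (fst x)) = (\<Sum>i\<in>I. r i)"
    unfolding sum_product_set[of _ I J] c_def
    using one[OF _ \<sigma> \<rho>] S T by (simp add: sum_distrib_right[symmetric])
  have sc': "(\<Sum>x\<in>I' \<times> J'. c' x * r' (fst x)) = (\<Sum>i\<in>I'. r' i)"
    unfolding sum_product_set[of _ I' J'] c'_def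
    using one[OF _ \<sigma>' \<rho>'] S by (simp add: sum_distrib_right[symmetric])
  have "complex_of_real (\<Sum>i\<in>I'. r' i) = complex_of_real (\<Sum>i\<in>I. r i)"
    unfolding tr[OF \<rho>] tr[OF \<rho>'] sum_product_set ..
  hence tr_eq: "(\<Sum>x\<in>I \<times> J. c x * r (fst x)) = (\<Sum>x\<in>I' \<times> J'. c' x * r' (fst x))"
    unfolding sc sc' by (simp only: of_real_eq_iff)
  have "(\<Sum>x\<in>I' \<times> J'. c' x * r' (fst x) * (ln (r' (fst x)) - ln (s' (snd x))))
      \<le> (\<Sum>x\<in>I \<times> J. c x * r (fst x) * (ln (r (fst x)) - ln (s (snd x))))"
  proof (rule log_sum_mono)
    fix \<tau> :: real assume \<tau>: "0 \<le> \<tau>"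
    \<comment> \<open>The maximiser for the marginals, tensored with the identity, is an admissible
      test operator for the joint pair, whose resolvent form it bounds from below.\<close>
    obtain Z where Z: "quad_fun S (\<lambda>a b. \<Sum>t\<in>T. \<rho> (a, t) (b, t)) (\<lambda>a b. \<Sum>t\<in>T. \<sigma> (a, t) (b, t)) \<tau> Z
        = rel_resolvent S I' r' e' J' s' f' \<tau>"
      using quad_fun_attained[OF S \<rho>' \<sigma>' pos' \<tau>] by auto
    have "rel_resolvent S I' r' e' J' s' f' \<tau> \<le> rel_resolvent (S \<times> T) I r e J s f \<tau>"
      unfolding Z[symmetric] quad_fun_partial_trace[OF T, symmetric]
      using S T pos \<tau> by (intro quad_fun_le[OF _ \<rho> \<sigma>]) auto
    thus "(\<Sum>x\<in>I' \<times> J'. c' x * (r' (fst x))\<^sup>2 / (s' (snd x) + \<tau> * r' (fst x)))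
       \<le> (\<Sum>x\<in>I \<times> J. c x * (r (fst x))\<^sup>2 / (s (snd x) + \<tau> * r (fst x)))"
      by (simp add: rel_resolvent_def sum_product_set[of _ I J] sum_product_set[of _ I' J'] c_def c'_def)
  qed (use fin pos pos' tr_eq in auto)
  moreover have "(\<Sum>x\<in>I \<times> J. c x * r (fst x) * (ln (r (fst x)) - ln (s (snd x))))
     = (\<Sum>i\<in>I. r i * ln (r i)) - (\<Sum>j\<in>J. ln (s j) * (\<Sum>i\<in>I. r i * c (i, j)))"
  proof -
    have "(\<Sum>x\<in>I \<times> J. c x * r (fst x) * (ln (r (fst x)) - ln (s (snd x))))
      = (\<Sum>i\<in>I. r i * ln (r i) * (\<Sum>j\<in>J. c (i, j))) - (\<Sum>i\<in>I. \<Sum>j\<in>J. ln (s j) * (r i * c (i, j)))"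
      unfolding sum_product_set[of _ I J] by (simp add: right_diff_distrib sum_subtractf sum_distrib_left mult_ac)
    also have "(\<Sum>i\<in>I. r i * ln (r i) * (\<Sum>j\<in>J. c (i, j))) = (\<Sum>i\<in>I. r i * ln (r i))"
      using one[OF _ \<sigma> \<rho>] S T by (simp add: c_def)
    also have "(\<Sum>i\<in>I. \<Sum>j\<in>J. ln (s j) * (r i * c (i, j))) = (\<Sum>j\<in>J. ln (s j) * (\<Sum>i\<in>I. r i * c (i, j)))"
      by (subst sum.swap) (simp add: sum_distrib_left)
    finally show ?thesis .
  qed
  moreover have "(\<Sum>x\<in>I' \<times> J'. c' x * r' (fst x) * (ln (r' (fst x)) - ln (s' (snd x))))
     = (\<Sum>i\<in>I'. r' i * ln (r' i)) - (\<Sum>j\<in>J'. ln (s' j) * (\<Sum>i\<in>I'. r' i * c' (i, j)))"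
  proof -
    have "(\<Sum>x\<in>I' \<times> J'. c' x * r' (fst x) * (ln (r' (fst x)) - ln (s' (snd x))))
      = (\<Sum>i\<in>I'. r' i * ln (r' i) * (\<Sum>j\<in>J'. c' (i, j))) - (\<Sum>i\<in>I'. \<Sum>j\<in>J'. ln (s' j) * (r' i * c' (i, j)))"
      unfolding sum_product_set[of _ I' J'] by (simp add: right_diff_distrib sum_subtractf sum_distrib_left mult_ac)
    also have "(\<Sum>i\<in>I'. r' i * ln (r' i) * (\<Sum>j\<in>J'. c' (i, j))) = (\<Sum>i\<in>I'. r' i * ln (r' i))"
      using one[OF _ \<sigma>' \<rho>'] S by (simp add: c'_def)
    also have "(\<Sum>i\<in>I'. \<Sum>j\<in>J'. ln (s' j) * (r' i * c' (i, j))) = (\<Sum>j\<in>J'. ln (s' j) * (\<Sum>i\<in>I'. r' i * c' (i, j)))"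
      by (subst sum.swap) (simp add: sum_distrib_left)
    finally show ?thesis .
  qed
  ultimately show ?thesis by (simp add: c_def c'_def)
qed

section \<open>Strong subadditivity\<close>

text \<open>The reduced state on \<open>S\<close> of the possibly unnormalised pure vector with
  amplitude \<open>m\<close> on \<open>S\<close> and \<open>T\<close>. Positivity is built in, and
  passing to another subsystem only splits the arguments of the same amplitude differently.\<close>

definition gram :: "'t set \<Rightarrow> ('a \<Rightarrow> 't \<Rightarrow> complex) \<Rightarrow> 'a \<Rightarrow> 'a \<Rightarrow> complex" where
  "gram T m a b = (\<Sum>t\<in>T. m a t * cnj (m b t))"

definition red_ent :: "'a set \<Rightarrow> 't set \<Rightarrow> ('a \<Rightarrow> 't \<Rightarrow> complex) \<Rightarrow> real" where
  "red_ent S T m = ent S (gram T m)"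

lemma gram_hermitian: "hermitian S (gram T m)"
  by (simp add: hermitian_def gram_def mult.commute)

lemma gram_quadratic:
  "(\<Sum>a\<in>S. \<Sum>b\<in>S. cnj (x a) * gram T m a b * x b) = of_real (\<Sum>t\<in>T. (cmod (\<Sum>a\<in>S. cnj (x a) * m a t))\<^sup>2)"
proof -
  have "(\<Sum>a\<in>S. \<Sum>b\<in>S. cnj (x a) * gram T m a b * x b)
     = (\<Sum>a\<in>S. \<Sum>b\<in>S. \<Sum>t\<in>T. (cnj (x a) * m a t) * cnj (cnj (x b) * m b t))"
    by (simp add: gram_def sum_distrib_left sum_distrib_right mult_ac)
  also have "\<dots> = (\<Sum>t\<in>T. \<Sum>a\<in>S. \<Sum>b\<in>S. (cnj (x a) * m a t) * cnj (cnj (x b) * m b t))"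
    by (subst (2) sum.swap, subst sum.swap) (rule refl)
  also have "\<dots> = (\<Sum>t\<in>T. of_real ((cmod (\<Sum>a\<in>S. cnj (x a) * m a t))\<^sup>2))"
    unfolding complex_norm_square cnj_sum sum_product by (rule refl)
  finally show ?thesis by simp
qed

lemma spectral_expectation:
  assumes "spectral S \<rho> I r e" "i \<in> I"
  shows "(\<Sum>a\<in>S. \<Sum>b\<in>S. cnj (e i a) * \<rho> a b * e i b) = of_real (r i)"
proof -
  have "(\<Sum>a\<in>S. \<Sum>b\<in>S. cnj (e i a) * \<rho> a b * e i b) = (\<Sum>a\<in>S. cnj (e i a) * (\<Sum>b\<in>S. \<rho> a b * e i b))"
    by (simp add: sum_distrib_left mult.assoc)
  also have "\<dots> = of_real (r i) * (\<Sum>a\<in>S. cnj (e i a) * e i a)"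
    using spectral_eigen[OF assms] by (simp add: sum_distrib_left mult_ac)
  also have "\<dots> = of_real (r i)"
    using assms orthonormalD[of S I e i i] by (simp add: spectral_def)
  finally show ?thesis .
qed

lemma gram_eigenvalue_nonneg:
  assumes "spectral S (gram T m) I r e" "i \<in> I"
  shows "0 \<le> r i"
proof -
  have "r i = (\<Sum>t\<in>T. (cmod (\<Sum>a\<in>S. cnj (e i a) * m a t))\<^sup>2)"
    using spectral_expectation[OF assms] unfolding gram_quadratic by (simp only: of_real_eq_iff)
  thus ?thesis by (simp add: sum_nonneg)
qed

text \<open>The operator \<tau> + \<epsilon> 1 tensored with the identity on the second factor. The
  shift makes the eigenvalues positive, as \<open>relative_entropy_mono\<close> demands of its
  second operator.\<close>

definition extend_id :: "real \<Rightarrow> ('a \<Rightarrow> 'a \<Rightarrow> complex) \<Rightarrow> 'a \<times> 'c \<Rightarrow> 'a \<times> 'c \<Rightarrow> complex" where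
  "extend_id \<epsilon> \<tau> z w = (if snd z = snd w then \<tau> (fst z) (fst w) + (if fst z = fst w then of_real \<epsilon> else 0) else 0)"

definition extend_vec :: "('j \<Rightarrow> 'a \<Rightarrow> complex) \<Rightarrow> 'j \<times> 'c \<Rightarrow> 'a \<times> 'c \<Rightarrow> complex" where
  "extend_vec f k z = (if snd z = snd k then f (fst k) (fst z) else 0)"

lemma eigenbasis_extend:
  assumes C: "finite C" and eb: "eigenbasis X \<tau> J s f"
  shows "eigenbasis (X \<times> C) (extend_id \<epsilon> \<tau>) (J \<times> C) (\<lambda>k. s (fst k) + \<epsilon>) (extend_vec f)"
proof -
  have J: "finite J" and on: "orthonormal X J f"
    and \<tau>: "\<And>x y. x \<in> X \<Longrightarrow> y \<in> X \<Longrightarrow> \<tau> x y = (\<Sum>j\<in>J. of_real (s j) * f j x * cnj (f j y))"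
    and co: "\<And>x y. x \<in> X \<Longrightarrow> y \<in> X \<Longrightarrow> (\<Sum>j\<in>J. f j x * cnj (f j y)) = (if x = y then 1 else 0)"
    using eb by (auto simp: eigenbasis_def spectral_def)
  have "orthonormal (X \<times> C) (J \<times> C) (extend_vec f)"
    unfolding orthonormal_def
  proof (intro ballI)
    fix k l assume kl: "k \<in> J \<times> C" "l \<in> J \<times> C"
    have "(\<Sum>z\<in>X \<times> C. cnj (extend_vec f k z) * extend_vec f l z)
       = (\<Sum>x\<in>X. \<Sum>c\<in>C. if c = snd k then (if snd k = snd l then cnj (f (fst k) x) * f (fst l) x else 0) else 0)" (is "?lhs = _")
      unfolding sum_product_set by (intro sum.cong refl) (auto simp: extend_vec_def)
    also have "\<dots> = (if snd k = snd l then \<Sum>x\<in>X. cnj (f (fst k) x) * f (fst l) x else 0)"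
      using kl C by auto
    also have "\<dots> = (if k = l then 1 else 0)" (is "_ = ?rhs")
      using kl on by (auto simp: orthonormalD prod_eq_iff)
    finally show "?lhs = ?rhs" .
  qed
  moreover have sum_ext: "(\<Sum>k\<in>J \<times> C. g (fst k) * extend_vec f k z * cnj (extend_vec f k w))
      = (if snd z = snd w then \<Sum>j\<in>J. g j * f j (fst z) * cnj (f j (fst w)) else 0)"
    if "z \<in> X \<times> C" "w \<in> X \<times> C" for g z w
  proof -
    have "(\<Sum>k\<in>J \<times> C. g (fst k) * extend_vec f k z * cnj (extend_vec f k w))
       = (\<Sum>j\<in>J. \<Sum>c\<in>C. if c = snd z then (if snd z = snd w then g j * f j (fst z) * cnj (f j (fst w)) else 0) else 0)"
      unfolding sum_product_set by (intro sum.cong refl) (auto simp: extend_vec_def)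
    thus ?thesis using that C by auto
  qed
  moreover have "(\<Sum>k\<in>J \<times> C. extend_vec f k z * cnj (extend_vec f k w)) = (if z = w then 1 else 0)"
    if "z \<in> X \<times> C" "w \<in> X \<times> C" for z w
    using sum_ext[OF that, of "\<lambda>_. 1"] that co[of "fst z" "fst w"] by (auto simp: prod_eq_iff)
  moreover have "extend_id \<epsilon> \<tau> z w = (\<Sum>k\<in>J \<times> C. of_real (s (fst k) + \<epsilon>) * extend_vec f k z * cnj (extend_vec f k w))"
    if "z \<in> X \<times> C" "w \<in> X \<times> C" for z w
  proof -
    have "(\<Sum>j\<in>J. of_real (s j + \<epsilon>) * f j (fst z) * cnj (f j (fst w)))
       = \<tau> (fst z) (fst w) + of_real \<epsilon> * (\<Sum>j\<in>J. f j (fst z) * cnj (f j (fst w)))"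
      using that \<tau>[of "fst z" "fst w"] by (auto simp: distrib_right sum.distrib sum_distrib_left mult.assoc)
    thus ?thesis
      unfolding sum_ext[OF that, of "\<lambda>j. of_real (s j + \<epsilon>)"] extend_id_def
      using that co[of "fst z" "fst w"] by auto
  qed
  ultimately show ?thesis using J C by (simp add: eigenbasis_def spectral_def)
qed

text \<open>An operator acting only on \<open>X\<close> has the same expectation in \<rho> as in the
  marginal \<tau>; here the operator is a function of \<tau> with eigenvalues \<open>g j\<close>.
  This turns the cross term of a relative entropy into an entropy-like sum of the marginal.\<close>

lemma extend_overlap:
  assumes C: "finite C" and \<rho>: "spectral (X \<times> C) \<rho> I r e" and eb: "eigenbasis X \<tau> J s f"
    and marg: "\<And>x y. x \<in> X \<Longrightarrow> y \<in> X \<Longrightarrow> \<tau> x y = (\<Sum>c\<in>C. \<rho> (x, c) (y, c))"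
  shows "(\<Sum>k\<in>J \<times> C. g (fst k) * (\<Sum>i\<in>I. r i * (cmod (\<Sum>z\<in>X \<times> C. cnj (extend_vec f k z) * e i z))\<^sup>2))
     = (\<Sum>j\<in>J. g j * s j)"
proof -
  have "(\<Sum>c\<in>C. \<Sum>i\<in>I. r i * (cmod (\<Sum>z\<in>X \<times> C. cnj (extend_vec f (j, c) z) * e i z))\<^sup>2) = s j"
    if j: "j \<in> J" for j
  proof -
    have "complex_of_real (\<Sum>c\<in>C. \<Sum>i\<in>I. r i * (cmod (\<Sum>z\<in>X \<times> C. cnj (extend_vec f (j, c) z) * e i z))\<^sup>2)
       = (\<Sum>c\<in>C. \<Sum>z\<in>X \<times> C. \<Sum>w\<in>X \<times> C. cnj (extend_vec f (j, c) z) * \<rho> z w * extend_vec f (j, c) w)"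
      unfolding spectral_quadratic[OF \<rho>] by simp
    also have "\<dots> = (\<Sum>c\<in>C. \<Sum>x\<in>X. \<Sum>y\<in>X. cnj (f j x) * \<rho> (x, c) (y, c) * f j y)"
    proof (intro sum.cong refl)
      fix c assume c: "c \<in> C"
      have "(\<Sum>z\<in>X \<times> C. \<Sum>w\<in>X \<times> C. cnj (extend_vec f (j, c) z) * \<rho> z w * extend_vec f (j, c) w)
         = (\<Sum>x\<in>X. \<Sum>c'\<in>C. if c' = c then (\<Sum>y\<in>X. \<Sum>c''\<in>C. if c'' = c then cnj (f j x) * \<rho> (x, c') (y, c'') * f j y else 0) else 0)"
        unfolding sum_product_set by (intro sum.cong refl) (auto simp: extend_vec_def intro!: sum.cong)
      thus "(\<Sum>z\<in>X \<times> C. \<Sum>w\<in>X \<times> C. cnj (extend_vec f (j, c) z) * \<rho> z w * extend_vec f (j, c) w)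
         = (\<Sum>x\<in>X. \<Sum>y\<in>X. cnj (f j x) * \<rho> (x, c) (y, c) * f j y)" using c C by simp
    qed
    also have "\<dots> = (\<Sum>x\<in>X. \<Sum>y\<in>X. cnj (f j x) * \<tau> x y * f j y)"
      by (subst sum.swap, rule sum.cong[OF refl], subst sum.swap)
        (simp add: marg sum_distrib_left sum_distrib_right)
    also have "\<dots> = of_real (s j)"
      using eb j by (intro spectral_expectation) (auto simp: eigenbasis_def)
    finally show ?thesis by (simp only: of_real_eq_iff)
  qed
  thus ?thesis unfolding sum_product_set[of _ J C] by (simp add: sum_distrib_left[symmetric])
qed

lemma red_ent_ln:
  assumes "finite S" "spectral S (gram T m) I l u"
  shows "red_ent S T m * ln 2 = - (\<Sum>i\<in>I. l i * ln (l i))"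
proof -
  have "eta (l i) * ln 2 = l i * ln (l i)" if "i \<in> I" for i
    using gram_eigenvalue_nonneg[OF assms(2) that] by (auto simp: eta_def log_def)
  thus ?thesis
    unfolding red_ent_def ent_eq[OF assms] by (simp add: sum_distrib_right)
qed

text \<open>\<open>D\<close> purifies the state on A B C. Monotonicity under the trace over
  \<open>A\<close> is applied to that state and to the AB marginal tensored with the identity on
  \<open>C\<close>. The two cross terms become the entropies of AB and of B, and the inequality
  between relative entropies is the claim.\<close>

theorem strong_subadditivity:
  fixes m :: "'a \<Rightarrow> 'b \<Rightarrow> 'c \<Rightarrow> 'd \<Rightarrow> complex"
  assumes fin: "finite A" "finite B" "finite C" "finite D" and "A \<noteq> {}"
  shows "red_ent ((B \<times> A) \<times> C) D (\<lambda>((b, a), c) d. m a b c d) + red_ent B (A \<times> C \<times> D) (\<lambda>b (a, c, d). m a b c d)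
     \<le> red_ent (B \<times> A) (C \<times> D) (\<lambda>(b, a) (c, d). m a b c d) + red_ent (B \<times> C) (A \<times> D) (\<lambda>(b, c) (a, d). m a b c d)"
proof -
  define \<rho> where "\<rho> = gram D (\<lambda>((b, a), c) d. m a b c d)"
  define \<rho>B where "\<rho>B = gram (A \<times> C \<times> D) (\<lambda>b (a, c, d). m a b c d)"
  define \<rho>AB where "\<rho>AB = gram (C \<times> D) (\<lambda>(b, a) (c, d). m a b c d)"
  define \<rho>BC where "\<rho>BC = gram (A \<times> D) (\<lambda>(b, c) (a, d). m a b c d)"
  have "hermitian ((B \<times> A) \<times> C) \<rho>" "finite ((B \<times> A) \<times> C)" using fin by (simp_all add: \<rho>_def gram_hermitian)
  then obtain r e where \<rho>: "eigenbasis ((B \<times> A) \<times> C) \<rho> {..<card ((B \<times> A) \<times> C)} r e"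
    using eigenbasis_exists by blast
  have "hermitian B \<rho>B" "finite B" using fin by (simp_all add: \<rho>B_def gram_hermitian)
  then obtain rb eb where \<rho>B: "eigenbasis B \<rho>B {..<card B} rb eb"
    using eigenbasis_exists by blast
  have "hermitian (B \<times> A) \<rho>AB" "finite (B \<times> A)" using fin by (simp_all add: \<rho>AB_def gram_hermitian)
  then obtain rab eab where \<rho>AB: "eigenbasis (B \<times> A) \<rho>AB {..<card (B \<times> A)} rab eab"
    using eigenbasis_exists by blast
  have "hermitian (B \<times> C) \<rho>BC" "finite (B \<times> C)" using fin by (simp_all add: \<rho>BC_def gram_hermitian)
  then obtain rbc ebc where \<rho>BC: "eigenbasis (B \<times> C) \<rho>BC {..<card (B \<times> C)} rbc ebc"
    using eigenbasis_exists by blast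
  have nn1: "0 \<le> r i" if "i < card ((B \<times> A) \<times> C)" for i
    using gram_eigenvalue_nonneg[OF \<rho>[unfolded \<rho>_def eigenbasis_def, THEN conjunct1]] that by simp
  have nn2: "0 \<le> rb i" if "i < card B" for i
    using gram_eigenvalue_nonneg[OF \<rho>B[unfolded \<rho>B_def eigenbasis_def, THEN conjunct1]] that by simp
  have nn3: "0 \<le> rab i" if "i < card (B \<times> A)" for i
    using gram_eigenvalue_nonneg[OF \<rho>AB[unfolded \<rho>AB_def eigenbasis_def, THEN conjunct1]] that by simp
  have nn4: "0 \<le> rbc i" if "i < card (B \<times> C)" for i
    using gram_eigenvalue_nonneg[OF \<rho>BC[unfolded \<rho>BC_def eigenbasis_def, THEN conjunct1]] that by simp
  note nn = nn1 nn2 nn3 nn4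
  \<comment> \<open>Moves \<open>A\<close> to the last place, where
    \<open>relative_entropy_mono\<close> traces it out.\<close>
  define \<pi> where "\<pi> = (\<lambda>((b, c), a). ((b :: 'b, a :: 'a), c :: 'c))"
  have \<pi>: "bij_betw \<pi> ((B \<times> C) \<times> A) ((B \<times> A) \<times> C)"
    by (rule bij_betw_byWitness[where f' = "\<lambda>((b, a), c). ((b, c), a)"]) (auto simp: \<pi>_def)
  \<comment> \<open>Tracing the shift \<epsilon> times the identity over \<open>A\<close> multiplies
    it by the dimension of \<open>A\<close>; for nonempty \<open>A\<close> the marginal is again
    strictly positive.\<close>
  define N where "N = real (card A)"
  have N: "N > 0" using assms by (simp add: N_def card_gt_0_iff)
  have step: "(\<Sum>i<card (B \<times> C). rbc i * ln (rbc i)) - (\<Sum>j<card B. ln (rb j + \<epsilon> * N) * rb j)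
      \<le> (\<Sum>i<card ((B \<times> A) \<times> C). r i * ln (r i)) - (\<Sum>j<card (B \<times> A). ln (rab j + \<epsilon>) * rab j)"
    if \<epsilon>: "\<epsilon> > 0" for \<epsilon>
  proof -
    have mono: "(\<Sum>i<card (B \<times> C). rbc i * ln (rbc i)) - (\<Sum>k\<in>{..<card B} \<times> C. ln (rb (fst k) + \<epsilon> * N)
          * (\<Sum>i<card (B \<times> C). rbc i * (cmod (\<Sum>z\<in>B \<times> C. cnj (extend_vec eb k z) * ebc i z))\<^sup>2))
      \<le> (\<Sum>i<card ((B \<times> A) \<times> C). r i * ln (r i)) - (\<Sum>k\<in>{..<card (B \<times> A)} \<times> C. ln (rab (fst k) + \<epsilon>)
          * (\<Sum>i<card ((B \<times> A) \<times> C). r i * (cmod (\<Sum>z\<in>(B \<times> C) \<times> A. cnj (extend_vec eab k (\<pi> z)) * e i (\<pi> z)))\<^sup>2))"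
    proof (rule relative_entropy_mono)
      show "eigenbasis ((B \<times> C) \<times> A) (\<lambda>z w. \<rho> (\<pi> z) (\<pi> w)) {..<card ((B \<times> A) \<times> C)} r (\<lambda>i z. e i (\<pi> z))"
        by (rule eigenbasis_reindex[OF \<pi> \<rho>])
      show "eigenbasis ((B \<times> C) \<times> A) (\<lambda>z w. extend_id \<epsilon> \<rho>AB (\<pi> z) (\<pi> w)) ({..<card (B \<times> A)} \<times> C)
          (\<lambda>k. rab (fst k) + \<epsilon>) (\<lambda>k z. extend_vec eab k (\<pi> z))"
        by (rule eigenbasis_reindex[OF \<pi> eigenbasis_extend[OF fin(3) \<rho>AB]])
      have "(\<Sum>a\<in>A. \<rho> (\<pi> (x, a)) (\<pi> (y, a))) = \<rho>BC x y" for x y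
        by (cases x; cases y) (simp add: \<rho>_def \<rho>BC_def gram_def \<pi>_def sum_product_set)
      thus "eigenbasis (B \<times> C) (\<lambda>x y. \<Sum>a\<in>A. \<rho> (\<pi> (x, a)) (\<pi> (y, a))) {..<card (B \<times> C)} rbc ebc"
        using \<rho>BC by simp
      have "(\<Sum>a\<in>A. extend_id \<epsilon> \<rho>AB (\<pi> (x, a)) (\<pi> (y, a))) = extend_id (\<epsilon> * N) \<rho>B x y" for x y
        by (cases x; cases y) (simp add: \<rho>AB_def \<rho>B_def gram_def \<pi>_def sum_product_set extend_id_def sum.distrib N_def)
      thus "eigenbasis (B \<times> C) (\<lambda>x y. \<Sum>a\<in>A. extend_id \<epsilon> \<rho>AB (\<pi> (x, a)) (\<pi> (y, a))) ({..<card B} \<times> C)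
          (\<lambda>k. rb (fst k) + \<epsilon> * N) (extend_vec eb)"
        using eigenbasis_extend[OF fin(3) \<rho>B] by simp
    qed (use fin nn \<epsilon> N in \<open>auto simp: add_nonneg_pos\<close>)
    have re: "(\<Sum>z\<in>(B \<times> C) \<times> A. cnj (extend_vec eab k (\<pi> z)) * e i (\<pi> z))
        = (\<Sum>z\<in>(B \<times> A) \<times> C. cnj (extend_vec eab k z) * e i z)" for k i
      by (rule sum.reindex_bij_betw[OF \<pi>])
    have 1: "(\<Sum>k\<in>{..<card B} \<times> C. ln (rb (fst k) + \<epsilon> * N)
          * (\<Sum>i<card (B \<times> C). rbc i * (cmod (\<Sum>z\<in>B \<times> C. cnj (extend_vec eb k z) * ebc i z))\<^sup>2))
        = (\<Sum>j<card B. ln (rb j + \<epsilon> * N) * rb j)"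
    proof (rule extend_overlap[OF fin(3) _ \<rho>B, of \<rho>BC _ _ _ "\<lambda>j. ln (rb j + \<epsilon> * N)"])
      show "spectral (B \<times> C) \<rho>BC {..<card (B \<times> C)} rbc ebc" using \<rho>BC by (simp add: eigenbasis_def)
      show "\<rho>B x y = (\<Sum>c\<in>C. \<rho>BC (x, c) (y, c))" for x y
        unfolding \<rho>B_def \<rho>BC_def gram_def sum_product_set by (simp, rule sum.swap)
    qed
    have 2: "(\<Sum>k\<in>{..<card (B \<times> A)} \<times> C. ln (rab (fst k) + \<epsilon>)
          * (\<Sum>i<card ((B \<times> A) \<times> C). r i * (cmod (\<Sum>z\<in>(B \<times> A) \<times> C. cnj (extend_vec eab k z) * e i z))\<^sup>2))
        = (\<Sum>j<card (B \<times> A). ln (rab j + \<epsilon>) * rab j)"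
    proof (rule extend_overlap[OF fin(3) _ \<rho>AB, of \<rho> _ _ _ "\<lambda>j. ln (rab j + \<epsilon>)"])
      show "spectral ((B \<times> A) \<times> C) \<rho> {..<card ((B \<times> A) \<times> C)} r e" using \<rho> by (simp add: eigenbasis_def)
      show "\<rho>AB x y = (\<Sum>c\<in>C. \<rho> (x, c) (y, c))" for x y
        by (cases x; cases y) (simp add: \<rho>AB_def \<rho>_def gram_def sum_product_set)
    qed
    show ?thesis using mono unfolding re 1 2 .
  qed
  \<comment> \<open>A null eigenvalue of the marginal gives a term that is zero for every
    \<epsilon>, so the divergence of its logarithm is harmless.\<close>
  have lim: "((\<lambda>\<epsilon>. ln (s + \<epsilon> * c) * s) \<longlongrightarrow> ln s * s) (at_right 0)" if "0 \<le> s" for s c :: real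
  proof (cases "s = 0")
    case False
    have "((\<lambda>\<epsilon>. ln (s + \<epsilon> * c) * s) \<longlongrightarrow> ln (s + 0 * c) * s) (at_right 0)"
      using False by (intro tendsto_intros) auto
    thus ?thesis by simp
  qed simp
  have "(\<Sum>i<card (B \<times> C). rbc i * ln (rbc i)) - (\<Sum>j<card B. ln (rb j) * rb j)
      \<le> (\<Sum>i<card ((B \<times> A) \<times> C). r i * ln (r i)) - (\<Sum>j<card (B \<times> A). ln (rab j) * rab j)"
  proof (rule tendsto_le[where F = "at_right (0 :: real)"])
    show "((\<lambda>\<epsilon>. (\<Sum>i<card (B \<times> C). rbc i * ln (rbc i)) - (\<Sum>j<card B. ln (rb j + \<epsilon> * N) * rb j))
      \<longlongrightarrow> (\<Sum>i<card (B \<times> C). rbc i * ln (rbc i)) - (\<Sum>j<card B. ln (rb j) * rb j)) (at_right 0)"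
      using nn by (intro tendsto_diff tendsto_const tendsto_sum lim) auto
    show "((\<lambda>\<epsilon>. (\<Sum>i<card ((B \<times> A) \<times> C). r i * ln (r i)) - (\<Sum>j<card (B \<times> A). ln (rab j + \<epsilon>) * rab j))
      \<longlongrightarrow> (\<Sum>i<card ((B \<times> A) \<times> C). r i * ln (r i)) - (\<Sum>j<card (B \<times> A). ln (rab j) * rab j)) (at_right 0)"
      using nn lim[of _ 1] by (intro tendsto_diff tendsto_const tendsto_sum) auto
    show "\<forall>\<^sub>F \<epsilon> in at_right 0. (\<Sum>i<card (B \<times> C). rbc i * ln (rbc i)) - (\<Sum>j<card B. ln (rb j + \<epsilon> * N) * rb j)
      \<le> (\<Sum>i<card ((B \<times> A) \<times> C). r i * ln (r i)) - (\<Sum>j<card (B \<times> A). ln (rab j + \<epsilon>) * rab j)"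
      using step eventually_at_right_less[of "0::real"] by (auto elim: eventually_mono)
  qed simp
  moreover have "red_ent ((B \<times> A) \<times> C) D (\<lambda>((b, a), c) d. m a b c d) * ln 2 = - (\<Sum>i<card ((B \<times> A) \<times> C). r i * ln (r i))"
    using fin \<rho> by (intro red_ent_ln) (auto simp: eigenbasis_def \<rho>_def)
  moreover have "red_ent B (A \<times> C \<times> D) (\<lambda>b (a, c, d). m a b c d) * ln 2 = - (\<Sum>i<card B. rb i * ln (rb i))"
    using fin \<rho>B by (intro red_ent_ln) (auto simp: eigenbasis_def \<rho>B_def)
  moreover have "red_ent (B \<times> A) (C \<times> D) (\<lambda>(b, a) (c, d). m a b c d) * ln 2 = - (\<Sum>i<card (B \<times> A). rab i * ln (rab i))"
    using fin \<rho>AB by (intro red_ent_ln) (auto simp: eigenbasis_def \<rho>AB_def)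
  moreover have "red_ent (B \<times> C) (A \<times> D) (\<lambda>(b, c) (a, d). m a b c d) * ln 2 = - (\<Sum>i<card (B \<times> C). rbc i * ln (rbc i))"
    using fin \<rho>BC by (intro red_ent_ln) (auto simp: eigenbasis_def \<rho>BC_def)
  ultimately have "(red_ent ((B \<times> A) \<times> C) D (\<lambda>((b, a), c) d. m a b c d) + red_ent B (A \<times> C \<times> D) (\<lambda>b (a, c, d). m a b c d)) * ln 2
     \<le> (red_ent (B \<times> A) (C \<times> D) (\<lambda>(b, a) (c, d). m a b c d) + red_ent (B \<times> C) (A \<times> D) (\<lambda>(b, c) (a, d). m a b c d)) * ln 2"
    unfolding distrib_right mult.commute[of "ln (rb j)" "rb j" for j] mult.commute[of "ln (rab j)" "rab j" for j]
    by linarith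
  thus ?thesis by simp
qed

section \<open>Entropies of reduced states\<close>

lemma red_ent_cong:
  assumes "\<And>a b. a \<in> S \<Longrightarrow> b \<in> S \<Longrightarrow> gram T m a b = gram T' m' a b"
  shows "red_ent S T m = red_ent S T' m'"
  unfolding red_ent_def by (rule ent_cong[OF assms])

lemma red_ent_eq:
  assumes "finite S" "spectral S (gram T m) I l u"
  shows "red_ent S T m = - (\<Sum>i\<in>I. eta (l i))"
  unfolding red_ent_def by (rule ent_eq[OF assms])

lemma gram_eigenbasis:
  assumes "finite S"
  shows "\<exists>l u. eigenbasis S (gram T m) {..<card S} l u"
  by (rule eigenbasis_exists[OF assms gram_hermitian])

lemma red_ent_reindex:
  assumes "finite S" "bij_betw \<pi> S' S"
  shows "red_ent S' T (\<lambda>a. m (\<pi> a)) = red_ent S T m"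
proof -
  have "gram T (\<lambda>a. m (\<pi> a)) = (\<lambda>a b. gram T m (\<pi> a) (\<pi> b))" by (simp add: gram_def fun_eq_iff)
  thus ?thesis
    unfolding red_ent_def by (simp only: ent_reindex[OF assms(1) gram_hermitian assms(2)])
qed

lemma red_ent_reindex_env:
  assumes "bij_betw \<pi> T' T"
  shows "red_ent S T' (\<lambda>a t. m a (\<pi> t)) = red_ent S T m"
  using sum.reindex_bij_betw[OF assms] by (intro red_ent_cong) (simp add: gram_def)

text \<open>Schmidt decomposition: contracting the amplitude with an eigenvector \<open>u i\<close>
  on \<open>S\<close> yields a vector \<open>y i\<close> on \<open>T\<close>. These are pairwise
  orthogonal with squared norm \<open>l i\<close>, so both reduced states have the same nonzero
  spectrum.\<close>

lemma red_ent_swap: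
  assumes S: "finite S" and T: "finite T"
  shows "red_ent S T m = red_ent T S (\<lambda>t a. m a t)"
proof -
  obtain l u where eb: "eigenbasis S (gram T m) {..<card S} l u" using gram_eigenbasis[OF S] by blast
  hence sp: "spectral S (gram T m) {..<card S} l u" and on: "orthonormal S {..<card S} u"
    and co: "\<And>a b. a \<in> S \<Longrightarrow> b \<in> S \<Longrightarrow> (\<Sum>i<card S. u i a * cnj (u i b)) = (if a = b then 1 else 0)"
    by (auto simp: eigenbasis_def spectral_def)
  have nn: "0 \<le> l i" if "i < card S" for i using gram_eigenvalue_nonneg[OF sp] that by simp
  define y where "y i t = (\<Sum>a\<in>S. cnj (u i a) * m a t)" for i t
  \<comment> \<open>Only nonzero eigenvalues have a Schmidt partner, because \<open>v\<close>
    divides by the square root of \<open>l i\<close>; \<open>y i\<close> itself vanishes for the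
    others.\<close>
  define I where "I = {i. i < card S \<and> l i \<noteq> 0}"
  define v where "v i t = y i t / of_real (sqrt (l i))" for i t
  have yy: "(\<Sum>t\<in>T. cnj (y i t) * y j t) = (if i = j then of_real (l i) else 0)"
    if ij: "i < card S" "j < card S" for i j
  proof -
    have "(\<Sum>t\<in>T. cnj (y i t) * y j t) = (\<Sum>t\<in>T. \<Sum>a\<in>S. \<Sum>b\<in>S. cnj (u j a) * (m a t * cnj (m b t)) * u i b)"
      unfolding y_def cnj_sum sum_product by (rule sum.cong[OF refl], subst sum.swap) (simp add: mult_ac)
    also have "\<dots> = (\<Sum>a\<in>S. \<Sum>b\<in>S. cnj (u j a) * gram T m a b * u i b)"
      by (subst sum.swap, rule sum.cong[OF refl], subst sum.swap)
        (simp add: gram_def sum_distrib_left sum_distrib_right)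
    also have "\<dots> = (\<Sum>a\<in>S. cnj (u j a) * (\<Sum>b\<in>S. gram T m a b * u i b))"
      by (simp add: sum_distrib_left mult.assoc)
    also have "\<dots> = of_real (l i) * (\<Sum>a\<in>S. cnj (u j a) * u i a)"
      using spectral_eigen[OF sp] ij by (simp add: sum_distrib_left mult_ac)
    finally show ?thesis using on ij by (auto simp: orthonormalD)
  qed
  have y0: "y i t = 0" if "i < card S" "l i = 0" "t \<in> T" for i t
  proof -
    have "complex_of_real (\<Sum>t\<in>T. (cmod (y i t))\<^sup>2) = (\<Sum>t\<in>T. cnj (y i t) * y i t)"
      by (simp add: complex_norm_square mult.commute del: of_real_power)
    hence "(\<Sum>t\<in>T. (cmod (y i t))\<^sup>2) = 0" using yy[of i i] that by (simp del: of_real_sum)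
    thus ?thesis using T that by (simp add: sum_nonneg_eq_0_iff)
  qed
  have sq: "complex_of_real (sqrt (l i)) * of_real (sqrt (l i)) = of_real (l i)" if "i < card S" for i
    using nn[OF that] by (simp flip: of_real_mult)
  have "orthonormal T I v"
    unfolding orthonormal_def
  proof (intro ballI)
    fix i j assume ij: "i \<in> I" "j \<in> I"
    have "(\<Sum>t\<in>T. cnj (v i t) * v j t) = (\<Sum>t\<in>T. cnj (y i t) * y j t) / (of_real (sqrt (l i)) * of_real (sqrt (l j)))"
      by (simp add: v_def sum_divide_distrib)
    thus "(\<Sum>t\<in>T. cnj (v i t) * v j t) = (if i = j then 1 else 0)"
      using ij yy[of i j] sq[of i] by (auto simp: I_def)
  qed
  moreover have "gram S (\<lambda>t a. m a t) t t' = (\<Sum>i\<in>I. of_real (l i) * v i t * cnj (v i t'))"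
    if t: "t \<in> T" "t' \<in> T" for t t'
  proof -
    have "gram S (\<lambda>t a. m a t) t t' = (\<Sum>a\<in>S. cnj (m a t') * m a t)" by (simp add: gram_def mult.commute)
    also have "\<dots> = (\<Sum>i<card S. cnj (y i t') * y i t)"
      unfolding y_def using co by (intro complete_inner[OF S, symmetric]) auto
    also have "\<dots> = (\<Sum>i\<in>I. cnj (y i t') * y i t)"
      using y0 t by (intro sum.mono_neutral_right) (auto simp: I_def)
    also have "\<dots> = (\<Sum>i\<in>I. of_real (l i) * v i t * cnj (v i t'))"
    proof (intro sum.cong refl)
      fix i assume "i \<in> I"
      hence i: "i < card S" "l i \<noteq> 0" by (auto simp: I_def)
      have "of_real (l i) * v i t * cnj (v i t') = of_real (l i) * (y i t * cnj (y i t')) / (of_real (sqrt (l i)) * of_real (sqrt (l i)))"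
        by (simp add: v_def)
      thus "cnj (y i t') * y i t = of_real (l i) * v i t * cnj (v i t')"
        unfolding sq[OF i(1)] using i by simp
    qed
    finally show ?thesis .
  qed
  ultimately have "spectral T (gram S (\<lambda>t a. m a t)) I l v" by (simp add: spectral_def I_def)
  from red_ent_eq[OF T this] have "red_ent T S (\<lambda>t a. m a t) = - (\<Sum>i\<in>I. eta (l i))" .
  also have "(\<Sum>i\<in>I. eta (l i)) = (\<Sum>i<card S. eta (l i))"
    by (intro sum.mono_neutral_left) (auto simp: I_def)
  finally show ?thesis using red_ent_eq[OF S sp] by simp
qed

text \<open>The copy of \<open>k\<close> in the environment makes the reduced state block diagonal,
  and the spectrum is the union over the blocks. Since the blocks are unnormalised, their sum
  already contains the entropy of the weights.\<close>

lemma red_ent_block: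
  assumes K: "finite K" and S: "finite S" and T: "finite T"
  shows "red_ent (K \<times> S) (K \<times> T) (\<lambda>(k, a) (k', t). if k = k' then m k a t else 0) = (\<Sum>k\<in>K. red_ent S T (m k))"
proof -
  have "\<forall>k. \<exists>l u. spectral S (gram T (m k)) {..<card S} l u"
    using gram_eigenbasis[OF S] unfolding eigenbasis_def by blast
  then obtain l u where sp: "\<And>k. spectral S (gram T (m k)) {..<card S} (l k) (u k)" by metis
  define v where "v = (\<lambda>(k, i) (k', a). if k = k' then u k i a else (0::complex))"
  have on: "orthonormal S {..<card S} (u k)" for k using sp by (simp add: spectral_def)
  have "orthonormal (K \<times> S) (K \<times> {..<card S}) v"
    unfolding orthonormal_def
  proof (intro ballI)
    fix p q assume pq: "p \<in> K \<times> {..<card S}" "q \<in> K \<times> {..<card S}"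
    obtain k i k' j where [simp]: "p = (k, i)" "q = (k', j)" by (cases p; cases q)
    have "(\<Sum>z\<in>K \<times> S. cnj (v p z) * v q z)
        = (\<Sum>x\<in>K. if x = k then (if k = k' then \<Sum>a\<in>S. cnj (u k i a) * u k j a else 0) else 0)" (is "?lhs = _")
      unfolding sum_product_set by (intro sum.cong refl) (auto simp: v_def)
    also have "\<dots> = (if p = q then 1 else 0)" (is "_ = ?rhs") using pq K on[of k] by (auto simp: orthonormalD)
    finally show "?lhs = ?rhs" .
  qed
  moreover have "gram (K \<times> T) (\<lambda>(k, a) (k', t). if k = k' then m k a t else 0) z w
      = (\<Sum>p\<in>K \<times> {..<card S}. of_real (l (fst p) (snd p)) * v p z * cnj (v p w))"
    if zw: "z \<in> K \<times> S" "w \<in> K \<times> S" for z w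
  proof -
    obtain k a k' b where [simp]: "z = (k, a)" "w = (k', b)" by (cases z; cases w)
    have "gram (K \<times> T) (\<lambda>(k, a) (k', t). if k = k' then m k a t else 0) z w
       = (\<Sum>x\<in>K. if x = k then (if k = k' then gram T (m k) a b else 0) else 0)"
      unfolding gram_def sum_product_set by (intro sum.cong refl) auto
    also have "\<dots> = (\<Sum>x\<in>K. if x = k then (if k = k' then \<Sum>i<card S. of_real (l k i) * u k i a * cnj (u k i b) else 0) else 0)"
    proof -
      have "gram T (m k) a b = (\<Sum>i<card S. of_real (l k i) * u k i a * cnj (u k i b))"
        using sp[of k] zw by (simp add: spectral_def)
      thus ?thesis by (simp only:)
    qed
    also have "\<dots> = (\<Sum>p\<in>K \<times> {..<card S}. of_real (l (fst p) (snd p)) * v p z * cnj (v p w))"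
      unfolding sum_product_set by (intro sum.cong refl) (auto simp: v_def)
    finally show ?thesis .
  qed
  ultimately have "spectral (K \<times> S) (gram (K \<times> T) (\<lambda>(k, a) (k', t). if k = k' then m k a t else 0))
      (K \<times> {..<card S}) (\<lambda>p. l (fst p) (snd p)) v"
    using K by (simp add: spectral_def)
  from red_ent_eq[OF _ this] K S have "red_ent (K \<times> S) (K \<times> T) (\<lambda>(k, a) (k', t). if k = k' then m k a t else 0)
      = - (\<Sum>k\<in>K. \<Sum>i<card S. eta (l k i))"
    by (simp add: sum_product_set)
  also have "\<dots> = (\<Sum>k\<in>K. red_ent S T (m k))"
    using red_ent_eq[OF S sp] by (simp add: sum_negf)
  finally show ?thesis .
qed

lemma red_ent_block_env:
  assumes K: "finite K" and S: "finite S" and T: "finite T" and Y: "bij_betw \<kappa> Y (K \<times> S)" and Z: "bij_betw \<zeta> Z (K \<times> T)"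
    and f: "\<And>y z. y \<in> Y \<Longrightarrow> z \<in> Z \<Longrightarrow> f y z = (if fst (\<kappa> y) = fst (\<zeta> z) then m (fst (\<kappa> y)) (snd (\<kappa> y)) (snd (\<zeta> z)) else 0)"
  shows "red_ent Y Z f = (\<Sum>k\<in>K. red_ent S T (m k))"
proof -
  have "red_ent Y Z f = red_ent Y Z (\<lambda>y z. (\<lambda>(k, a) (k', t). if k = k' then m k a t else 0) (\<kappa> y) (\<zeta> z))"
    using f by (intro red_ent_cong) (simp add: gram_def case_prod_unfold)
  also have "\<dots> = red_ent (K \<times> S) (K \<times> T) (\<lambda>(k, a) (k', t). if k = k' then m k a t else 0)"
    using K S by (subst red_ent_reindex_env[OF Z], subst red_ent_reindex[OF _ Y]) auto
  finally show ?thesis unfolding red_ent_block[OF K S T] .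
qed

lemma red_ent_unit_tensor:
  assumes S: "finite S" and E: "finite E" and w: "(\<Sum>e\<in>E. cnj (w e) * w e) = 1"
  shows "red_ent (E \<times> S) T (\<lambda>(e, a) t. w e * m a t) = red_ent S T m"
proof -
  obtain l u where sp: "spectral S (gram T m) {..<card S} l u"
    using gram_eigenbasis[OF S] unfolding eigenbasis_def by blast
  define v where "v i = (\<lambda>(e, a). w e * u i a)" for i
  have "orthonormal (E \<times> S) {..<card S} v"
    unfolding orthonormal_def
  proof (intro ballI)
    fix i j assume ij: "i \<in> {..<card S}" "j \<in> {..<card S}"
    have "(\<Sum>z\<in>E \<times> S. cnj (v i z) * v j z) = (\<Sum>e\<in>E. cnj (w e) * w e) * (\<Sum>a\<in>S. cnj (u i a) * u j a)"
      unfolding sum_product_set sum_product by (simp add: v_def mult_ac)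
    thus "(\<Sum>z\<in>E \<times> S. cnj (v i z) * v j z) = (if i = j then 1 else 0)"
      using sp ij w orthonormalD[of S "{..<card S}" u i j] by (simp add: spectral_def)
  qed
  moreover have "gram T (\<lambda>(e, a) t. w e * m a t) z z' = (\<Sum>i<card S. of_real (l i) * v i z * cnj (v i z'))"
    if zz: "z \<in> E \<times> S" "z' \<in> E \<times> S" for z z'
  proof -
    obtain e a e' b where [simp]: "z = (e, a)" "z' = (e', b)" by (cases z; cases z')
    have "gram T (\<lambda>(e, a) t. w e * m a t) z z' = w e * cnj (w e') * gram T m a b"
      by (simp add: gram_def sum_distrib_left mult_ac)
    also have "gram T m a b = (\<Sum>i<card S. of_real (l i) * u i a * cnj (u i b))"
      using sp zz by (simp add: spectral_def)
    finally show ?thesis by (simp add: v_def sum_distrib_left mult_ac)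
  qed
  ultimately have "spectral (E \<times> S) (gram T (\<lambda>(e, a) t. w e * m a t)) {..<card S} l v"
    by (simp add: spectral_def)
  from red_ent_eq[OF _ this] red_ent_eq[OF S sp] S E show ?thesis by simp
qed

text \<open>The reduced state has rank one, with the total weight as its only nonzero eigenvalue.
  All explicit \<open>eta\<close> terms of weights arise in this way; they vanish for a normalised
  vector.\<close>

lemma red_ent_unit_vector:
  assumes E: "finite E" and w: "(\<Sum>e\<in>E. cnj (w e) * w e) = 1"
  shows "red_ent E T (\<lambda>e t. w e * m t) = - eta (\<Sum>t\<in>T. (cmod (m t))\<^sup>2)"
proof -
  have "spectral E (gram T (\<lambda>e t. w e * m t)) {()} (\<lambda>_. \<Sum>t\<in>T. (cmod (m t))\<^sup>2) (\<lambda>_. w)"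
  proof -
    have "gram T (\<lambda>e t. w e * m t) a b = of_real (\<Sum>t\<in>T. (cmod (m t))\<^sup>2) * w a * cnj (w b)" for a b
    proof -
      have "gram T (\<lambda>e t. w e * m t) a b = (\<Sum>t\<in>T. (m t * cnj (m t)) * (w a * cnj (w b)))"
        unfolding gram_def by (simp add: mult_ac)
      thus ?thesis unfolding complex_norm_square[symmetric] sum_distrib_right[symmetric] by simp
    qed
    thus ?thesis using w by (simp add: spectral_def orthonormal_def)
  qed
  from red_ent_eq[OF E this] show ?thesis by simp
qed

text \<open>The case of a system \<open>K\<close> that is classical: entropies of systems containing
  \<open>K\<close> become sums over \<open>k\<close> of unnormalised entropies, and in the other two
  \<open>k\<close> is simply traced out.\<close>

lemma strong_subadditivity_classical:
  fixes m :: "'k \<Rightarrow> 'b \<Rightarrow> 'c \<Rightarrow> 'd \<Rightarrow> complex"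
  assumes fin: "finite K" "finite B" "finite C" "finite D" and K: "K \<noteq> {}"
  shows "(\<Sum>k\<in>K. red_ent (B \<times> C) D (\<lambda>(b, c) d. m k b c d)) + red_ent B (K \<times> C \<times> D) (\<lambda>b (k, c, d). m k b c d)
    \<le> (\<Sum>k\<in>K. red_ent B (C \<times> D) (\<lambda>b (c, d). m k b c d)) + red_ent (B \<times> C) (K \<times> D) (\<lambda>(b, c) (k, d). m k b c d)"
proof -
  \<comment> \<open>A second copy of k in the environment dephases it.\<close>
  define m' where "m' = (\<lambda>k b c (k', d). if k = k' then m k b c d else 0)"
  have ssa: "red_ent ((B \<times> K) \<times> C) (K \<times> D) (\<lambda>((b, a), c) d. m' a b c d)
       + red_ent B (K \<times> C \<times> (K \<times> D)) (\<lambda>b (a, c, d). m' a b c d)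
     \<le> red_ent (B \<times> K) (C \<times> (K \<times> D)) (\<lambda>(b, a) (c, d). m' a b c d)
       + red_ent (B \<times> C) (K \<times> (K \<times> D)) (\<lambda>(b, c) (a, d). m' a b c d)"
    using fin K by (intro strong_subadditivity) auto
  have b1: "bij_betw (\<lambda>((b, k), c). (k, b, c)) ((B \<times> K) \<times> C) (K \<times> (B \<times> C))"
    by (rule bij_betw_byWitness[where f' = "\<lambda>(k, b, c). ((b, k), c)"]) auto
  have b2: "bij_betw (\<lambda>(b, k). (k, b)) (B \<times> K) (K \<times> B)"
    by (rule bij_betw_byWitness[where f' = "\<lambda>(k, b). (b, k)"]) auto
  have b3: "bij_betw (\<lambda>(c, k, d). (k, c, d)) (C \<times> (K \<times> D)) (K \<times> (C \<times> D))"
    by (rule bij_betw_byWitness[where f' = "\<lambda>(k, c, d). (c, k, d)"]) auto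
  have 1: "red_ent ((B \<times> K) \<times> C) (K \<times> D) (\<lambda>((b, a), c) d. m' a b c d) = (\<Sum>k\<in>K. red_ent (B \<times> C) D (\<lambda>(b, c) d. m k b c d))"
    by (rule red_ent_block_env[OF _ _ _ b1, where \<zeta> = id]) (use fin in \<open>auto simp: m'_def bij_betw_def\<close>)
  have 2: "red_ent B (K \<times> C \<times> (K \<times> D)) (\<lambda>b (a, c, d). m' a b c d) = red_ent B (K \<times> C \<times> D) (\<lambda>b (k, c, d). m k b c d)"
  proof (rule red_ent_cong)
    fix b b'
    have "gram (K \<times> C \<times> (K \<times> D)) (\<lambda>b (a, c, d). m' a b c d) b b'
       = (\<Sum>k\<in>K. \<Sum>c\<in>C. \<Sum>k'\<in>K. if k' = k then (\<Sum>d\<in>D. m k b c d * cnj (m k b' c d)) else 0)"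
      unfolding gram_def sum_product_set by (intro sum.cong refl) (auto simp: m'_def)
    thus "gram (K \<times> C \<times> (K \<times> D)) (\<lambda>b (a, c, d). m' a b c d) b b' = gram (K \<times> C \<times> D) (\<lambda>b (k, c, d). m k b c d) b b'"
      using fin by (simp add: gram_def sum_product_set)
  qed
  have 3: "red_ent (B \<times> K) (C \<times> (K \<times> D)) (\<lambda>(b, a) (c, d). m' a b c d) = (\<Sum>k\<in>K. red_ent B (C \<times> D) (\<lambda>b (c, d). m k b c d))"
    by (rule red_ent_block_env[OF _ _ _ b2 b3]) (use fin in \<open>auto simp: m'_def\<close>)
  have 4: "red_ent (B \<times> C) (K \<times> (K \<times> D)) (\<lambda>(b, c) (a, d). m' a b c d) = red_ent (B \<times> C) (K \<times> D) (\<lambda>(b, c) (k, d). m k b c d)"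
  proof (rule red_ent_cong)
    fix z z' :: "'b \<times> 'c"
    obtain b c b' c' where [simp]: "z = (b, c)" "z' = (b', c')" by (cases z; cases z')
    have "gram (K \<times> (K \<times> D)) (\<lambda>(b, c) (a, d). m' a b c d) z z'
       = (\<Sum>k\<in>K. \<Sum>k'\<in>K. if k' = k then (\<Sum>d\<in>D. m k b c d * cnj (m k b' c' d)) else 0)"
      unfolding gram_def sum_product_set by (intro sum.cong refl) (auto simp: m'_def)
    thus "gram (K \<times> (K \<times> D)) (\<lambda>(b, c) (a, d). m' a b c d) z z' = gram (K \<times> D) (\<lambda>(b, c) (k, d). m k b c d) z z'"
      using fin by (simp add: gram_def sum_product_set)
  qed
  show ?thesis using ssa unfolding 1 2 3 4 .
qed

section \<open>Additivity for Hadamard channels\<close>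

lemma isometry_inner:
  assumes A: "finite A"
    and L: "\<And>a a'. a \<in> A \<Longrightarrow> a' \<in> A \<Longrightarrow> (\<Sum>p\<in>P. cnj (L p a) * L p a') = (if a = a' then 1 else 0 :: complex)"
  shows "(\<Sum>p\<in>P. (\<Sum>a\<in>A. L p a * f a) * cnj (\<Sum>a\<in>A. L p a * g a)) = (\<Sum>a\<in>A. f a * cnj (g a))"
proof -
  have "(\<Sum>p\<in>P. (\<Sum>a\<in>A. L p a * f a) * cnj (\<Sum>a\<in>A. L p a * g a))
     = (\<Sum>p\<in>P. \<Sum>a\<in>A. \<Sum>b\<in>A. f a * cnj (g b) * (cnj (L p b) * L p a))"
    by (simp add: sum_product mult_ac)
  also have "\<dots> = (\<Sum>a\<in>A. \<Sum>b\<in>A. f a * cnj (g b) * (\<Sum>p\<in>P. cnj (L p b) * L p a))"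
    by (subst sum.swap, rule sum.cong[OF refl], subst sum.swap) (simp add: sum_distrib_left)
  also have "\<dots> = (\<Sum>a\<in>A. \<Sum>b\<in>A. if b = a then f a * cnj (g b) else 0)"
    using L by (intro sum.cong refl) auto
  finally show ?thesis using A by simp
qed

definition chan_isometric :: "'a set \<Rightarrow> 'b set \<Rightarrow> 'e set \<Rightarrow> ('b \<Rightarrow> 'e \<Rightarrow> 'a \<Rightarrow> complex) \<Rightarrow> bool" where
  "chan_isometric A B E W \<longleftrightarrow> (\<forall>a\<in>A. \<forall>a'\<in>A.
     (\<Sum>b\<in>B. \<Sum>e\<in>E. cnj (W b e a) * W b e a') = (if a = a' then 1 else 0))"

lemma chan_isometric_inner:
  assumes A: "finite A" and W: "chan_isometric A B E W"
  shows "(\<Sum>b\<in>B. \<Sum>e\<in>E. (\<Sum>a\<in>A. W b e a * f a) * cnj (\<Sum>a\<in>A. W b e a * g a)) = (\<Sum>a\<in>A. f a * cnj (g a))"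
proof -
  have "(\<Sum>p\<in>B \<times> E. (\<Sum>a\<in>A. W (fst p) (snd p) a * f a) * cnj (\<Sum>a\<in>A. W (fst p) (snd p) a * g a))
      = (\<Sum>a\<in>A. f a * cnj (g a))"
    using W by (intro isometry_inner[OF A]) (simp add: sum_product_set chan_isometric_def)
  thus ?thesis by (simp only: sum_product_set fst_conv snd_conv)
qed

lemma chan_isometric_norm:
  assumes "finite A" "chan_isometric A B E W"
  shows "(\<Sum>b\<in>B. \<Sum>e\<in>E. (cmod (\<Sum>a\<in>A. W b e a * f a))\<^sup>2) = (\<Sum>a\<in>A. (cmod (f a))\<^sup>2)"
proof -
  have "complex_of_real (\<Sum>b\<in>B. \<Sum>e\<in>E. (cmod (\<Sum>a\<in>A. W b e a * f a))\<^sup>2) = complex_of_real (\<Sum>a\<in>A. (cmod (f a))\<^sup>2)"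
    unfolding of_real_sum complex_norm_square by (rule chan_isometric_inner[OF assms])
  thus ?thesis by (simp only: of_real_eq_iff)
qed

lemma chan_isometric_product:
  assumes fin: "finite A1" "finite A2"
    and W1: "chan_isometric A1 B1 E1 W1" and W2: "chan_isometric A2 B2 E2 W2"
  shows "chan_isometric (A2 \<times> A1) (B2 \<times> B1) (E2 \<times> E1) (\<lambda>(b2, b1) (e2, e1) (a2, a1). W2 b2 e2 a2 * W1 b1 e1 a1)"
  unfolding chan_isometric_def
proof (intro ballI)
  fix a a' assume a: "a \<in> A2 \<times> A1" "a' \<in> A2 \<times> A1"
  obtain a2 a1 a2' a1' where [simp]: "a = (a2, a1)" "a' = (a2', a1')" by (cases a; cases a')
  have "(\<Sum>b2\<in>B2. \<Sum>b1\<in>B1. \<Sum>e2\<in>E2. \<Sum>e1\<in>E1. cnj (W2 b2 e2 a2 * W1 b1 e1 a1) * (W2 b2 e2 a2' * W1 b1 e1 a1'))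
     = (\<Sum>b2\<in>B2. \<Sum>e2\<in>E2. \<Sum>b1\<in>B1. \<Sum>e1\<in>E1. (cnj (W2 b2 e2 a2) * W2 b2 e2 a2') * (cnj (W1 b1 e1 a1) * W1 b1 e1 a1'))"
    by (rule sum.cong[OF refl], subst sum.swap) (simp add: mult_ac)
  also have "\<dots> = (\<Sum>b2\<in>B2. \<Sum>e2\<in>E2. (cnj (W2 b2 e2 a2) * W2 b2 e2 a2') * (\<Sum>b1\<in>B1. \<Sum>e1\<in>E1. cnj (W1 b1 e1 a1) * W1 b1 e1 a1'))"
    by (simp only: sum_distrib_left)
  also have "\<dots> = (\<Sum>b2\<in>B2. \<Sum>e2\<in>E2. cnj (W2 b2 e2 a2) * W2 b2 e2 a2') * (\<Sum>b1\<in>B1. \<Sum>e1\<in>E1. cnj (W1 b1 e1 a1) * W1 b1 e1 a1')"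
    by (simp only: sum_distrib_right)
  also have "\<dots> = (if a = a' then 1 else 0)"
    using W1 W2 a by (auto simp: chan_isometric_def)
  finally show "(\<Sum>b\<in>B2 \<times> B1. \<Sum>e\<in>E2 \<times> E1. cnj ((\<lambda>(b2, b1) (e2, e1) (a2, a1). W2 b2 e2 a2 * W1 b1 e1 a1) b e a)
      * (\<lambda>(b2, b1) (e2, e1) (a2, a1). W2 b2 e2 a2 * W1 b1 e1 a1) b e a') = (if a = a' then 1 else 0)"
    unfolding sum_product_set by simp
qed

text \<open>The Hadamard channel enters only through its complement, so its output may be replaced by the register K of the
  isometry sum over k of |k> |w_k> <l_k|.\<close>

locale hadamard_pair =
  fixes R :: "'r set" and A2 :: "'a2 set" and A1 :: "'a1 set" and K :: "'k set" and E1 :: "'e1 set"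
    and B2 :: "'b2 set" and E2 :: "'e2 set"
    and \<psi> :: "'r \<Rightarrow> 'a2 \<Rightarrow> 'a1 \<Rightarrow> complex" and l :: "'k \<Rightarrow> 'a1 \<Rightarrow> complex" and w :: "'k \<Rightarrow> 'e1 \<Rightarrow> complex"
    and W2 :: "'b2 \<Rightarrow> 'e2 \<Rightarrow> 'a2 \<Rightarrow> complex"
  assumes fin: "finite R" "finite A2" "finite A1" "finite K" "finite E1" "finite B2" "finite E2"
    and K: "K \<noteq> {}"
    and iso_l: "\<And>a a'. a \<in> A1 \<Longrightarrow> a' \<in> A1 \<Longrightarrow> (\<Sum>k\<in>K. cnj (l k a) * l k a') = (if a = a' then 1 else 0)"
    and iso_W2: "chan_isometric A2 B2 E2 W2"
    and unit_w: "\<And>k. k \<in> K \<Longrightarrow> (\<Sum>e\<in>E1. cnj (w k e) * w k e) = 1"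
begin

text \<open>The unnormalised amplitude on \<open>R\<close> and \<open>A2\<close> conditioned on the
  outcome \<open>k\<close> of measuring A1; its squared norm \<open>weight k\<close> is the weight
  of that outcome.\<close>

definition \<phi> where "\<phi> k r a = (\<Sum>a1\<in>A1. l k a1 * \<psi> r a a1)"

definition \<chi> where "\<chi> k r b e = (\<Sum>a\<in>A2. W2 b e a * \<phi> k r a)"

lemma sum_\<phi>: "(\<Sum>k\<in>K. \<phi> k r a * cnj (\<phi> k r' a')) = (\<Sum>a1\<in>A1. \<psi> r a a1 * cnj (\<psi> r' a' a1))"
  unfolding \<phi>_def by (rule isometry_inner[OF fin(3) iso_l])

lemma sum_\<chi>: "(\<Sum>b\<in>B2. \<Sum>e\<in>E2. \<chi> k r b e * cnj (\<chi> k r' b e)) = (\<Sum>a\<in>A2. \<phi> k r a * cnj (\<phi> k r' a))"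
  unfolding \<chi>_def by (rule chan_isometric_inner[OF fin(2) iso_W2])

lemma sum_\<chi>': "(\<Sum>e\<in>E2. \<Sum>b\<in>B2. \<chi> k r b e * cnj (\<chi> k r' b e)) = (\<Sum>a\<in>A2. \<phi> k r a * cnj (\<phi> k r' a))"
  by (subst sum.swap) (rule sum_\<chi>)

lemma sum_w: "k \<in> K \<Longrightarrow> (\<Sum>e\<in>E1. w k e * x * cnj (w k e * y)) = x * cnj y"
  using unit_w[of k] by (simp add: mult_ac flip: sum_distrib_left)

definition "weight k = (\<Sum>r\<in>R. \<Sum>a\<in>A2. (cmod (\<phi> k r a))\<^sup>2)"
definition "hE1 = red_ent E1 (K \<times> R \<times> A2) (\<lambda>e (k, r, a). w k e * \<phi> k r a)"
definition "hE12 = red_ent (E1 \<times> E2) (K \<times> R \<times> B2) (\<lambda>(e1, e2) (k, r, b). w k e1 * \<chi> k r b e2)"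
definition "hE2 k = red_ent E2 (R \<times> B2) (\<lambda>e (r, b). \<chi> k r b e)"
text \<open>The environment consists of \<open>K\<close> and \<open>E2\<close> only: given
  \<open>k\<close>, E1 is in the unit vector \<open>w k\<close>, so tracing it out contributes a
  factor one. This entropy links the coherent and the classical use of \<open>k\<close>.\<close>

definition "hRB2 = red_ent (R \<times> B2) (K \<times> E2) (\<lambda>(r, b) (k, e). \<chi> k r b e)"

text \<open>The isometry of N2 acts on the environment of E1 and therefore leaves its reduced state
  unchanged.\<close>

lemma hE1_eq: "red_ent E1 (K \<times> E2 \<times> R \<times> B2) (\<lambda>e1 (k, e2, r, b). w k e1 * \<chi> k r b e2) = hE1"
  unfolding hE1_def
proof (rule red_ent_cong)
  fix e e'
  have "(\<Sum>c\<in>E2. \<Sum>r\<in>R. \<Sum>b\<in>B2. w k e * \<chi> k r b c * cnj (w k e' * \<chi> k r b c))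
     = w k e * cnj (w k e') * (\<Sum>r\<in>R. \<Sum>c\<in>E2. \<Sum>b\<in>B2. \<chi> k r b c * cnj (\<chi> k r b c))" for k
    by (subst sum.swap) (simp add: sum_distrib_left mult_ac)
  thus "gram (K \<times> E2 \<times> R \<times> B2) (\<lambda>e1 (k, e2, r, b). w k e1 * \<chi> k r b e2) e e' = gram (K \<times> R \<times> A2) (\<lambda>e (k, r, a). w k e * \<phi> k r a) e e'"
    unfolding sum_\<chi>' by (simp add: gram_def sum_product_set sum_distrib_left mult_ac)
qed

text \<open>Strong subadditivity with classical \<open>k\<close> and middle system E1. Given
  \<open>k\<close>, E1 is in the pure state \<open>w k\<close>: joining it to E2 does not change the
  entropy of E2, and its own unnormalised entropy is \<open>- eta (weight k)\<close>.\<close>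

lemma entropy_given_outcome:
  "hE1 + (\<Sum>k\<in>K. hE2 k + eta (weight k)) \<le> hE12"
proof -
  have ssa: "(\<Sum>k\<in>K. red_ent (E1 \<times> E2) (R \<times> B2) (\<lambda>(e1, e2) t. w k e1 * (\<lambda>e (r, b). \<chi> k r b e) e2 t))
       + red_ent E1 (K \<times> E2 \<times> R \<times> B2) (\<lambda>e1 (k, e2, t). w k e1 * (\<lambda>e (r, b). \<chi> k r b e) e2 t)
     \<le> (\<Sum>k\<in>K. red_ent E1 (E2 \<times> R \<times> B2) (\<lambda>e1 (e2, t). w k e1 * (\<lambda>e (r, b). \<chi> k r b e) e2 t))
       + red_ent (E1 \<times> E2) (K \<times> R \<times> B2) (\<lambda>(e1, e2) (k, t). w k e1 * (\<lambda>e (r, b). \<chi> k r b e) e2 t)"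
    using fin K by (intro strong_subadditivity_classical) auto
  have 1: "red_ent (E1 \<times> E2) (R \<times> B2) (\<lambda>(e1, e2) t. w k e1 * (\<lambda>e (r, b). \<chi> k r b e) e2 t) = hE2 k" if "k \<in> K" for k
    unfolding hE2_def by (rule red_ent_unit_tensor[OF fin(7) fin(5) unit_w[OF that]])
  have 3: "red_ent E1 (E2 \<times> R \<times> B2) (\<lambda>e1 (e2, t). w k e1 * (\<lambda>e (r, b). \<chi> k r b e) e2 t) = - eta (weight k)" if "k \<in> K" for k
  proof -
    have "complex_of_real (\<Sum>e\<in>E2. \<Sum>r\<in>R. \<Sum>b\<in>B2. (cmod (\<chi> k r b e))\<^sup>2)
       = (\<Sum>r\<in>R. \<Sum>e\<in>E2. \<Sum>b\<in>B2. \<chi> k r b e * cnj (\<chi> k r b e))"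
      by (subst sum.swap) (simp add: complex_norm_square del: of_real_power)
    also have "\<dots> = complex_of_real (weight k)"
      unfolding sum_\<chi>' weight_def by (simp add: complex_norm_square del: of_real_power)
    finally have "(\<Sum>t\<in>E2 \<times> R \<times> B2. (cmod ((\<lambda>(e, r, b). \<chi> k r b e) t))\<^sup>2) = weight k"
      by (simp only: of_real_eq_iff sum_product_set prod.case)
    moreover have "(\<lambda>e1 (e2, t). w k e1 * (\<lambda>e (r, b). \<chi> k r b e) e2 t) = (\<lambda>e1 t. w k e1 * (\<lambda>(e, r, b). \<chi> k r b e) t)"
      by (auto simp: fun_eq_iff)
    ultimately show ?thesis using red_ent_unit_vector[OF fin(5) unit_w[OF that], of "E2 \<times> R \<times> B2"] by simp
  qed
  have 2: "red_ent E1 (K \<times> E2 \<times> R \<times> B2) (\<lambda>e1 (k, e2, t). w k e1 * (\<lambda>e (r, b). \<chi> k r b e) e2 t) = hE1"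
    unfolding hE1_eq[symmetric] by (rule arg_cong[of _ _ "red_ent _ _"]) (auto simp: fun_eq_iff)
  have 4: "red_ent (E1 \<times> E2) (K \<times> R \<times> B2) (\<lambda>(e1, e2) (k, t). w k e1 * (\<lambda>e (r, b). \<chi> k r b e) e2 t) = hE12"
    unfolding hE12_def by (rule arg_cong[of _ _ "red_ent _ _"]) (auto simp: fun_eq_iff)
  show ?thesis using ssa unfolding 2 4 by (simp add: 1 3 sum.distrib sum_negf)
qed

text \<open>Strong subadditivity for \<open>K\<close>, E1, E2 with E1 in the middle and
  \<open>k\<close> in superposition. By purity E1 K E2 has the entropy of R B2, and E1 K has that of
  R B2 E2, which is the entropy of R A2 because N2 acts isometrically.\<close>

lemma coherent_step:
  "hRB2 + hE1 \<le> red_ent (R \<times> A2) A1 (\<lambda>(r, a) a1. \<psi> r a a1) + hE12"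
proof -
  define m where "m = (\<lambda>k e1 e2 (r, b). w k e1 * \<chi> k r b e2)"
  have ssa: "red_ent ((E1 \<times> K) \<times> E2) (R \<times> B2) (\<lambda>((b, a), c) d. m a b c d)
       + red_ent E1 (K \<times> E2 \<times> (R \<times> B2)) (\<lambda>b (a, c, d). m a b c d)
     \<le> red_ent (E1 \<times> K) (E2 \<times> (R \<times> B2)) (\<lambda>(b, a) (c, d). m a b c d)
       + red_ent (E1 \<times> E2) (K \<times> (R \<times> B2)) (\<lambda>(b, c) (a, d). m a b c d)"
    using fin K by (intro strong_subadditivity) auto
  have 1: "red_ent ((E1 \<times> K) \<times> E2) (R \<times> B2) (\<lambda>((b, a), c) d. m a b c d) = hRB2"
    unfolding hRB2_def
  proof (subst red_ent_swap)
    show "red_ent (R \<times> B2) ((E1 \<times> K) \<times> E2) (\<lambda>d z. (\<lambda>((b, a), c) d. m a b c d) z d)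
       = red_ent (R \<times> B2) (K \<times> E2) (\<lambda>(r, b) (k, e). \<chi> k r b e)"
    proof (rule red_ent_cong)
      fix z z' :: "'r \<times> 'b2"
      obtain r b r' b' where [simp]: "z = (r, b)" "z' = (r', b')" by (cases z; cases z')
      have "gram ((E1 \<times> K) \<times> E2) (\<lambda>d z. (\<lambda>((b, a), c) d. m a b c d) z d) z z'
         = (\<Sum>k\<in>K. \<Sum>e\<in>E2. \<Sum>e1\<in>E1. w k e1 * \<chi> k r b e * cnj (w k e1 * \<chi> k r' b' e))" (is "?lhs = _")
        unfolding gram_def sum_product_set m_def
        by (simp add: mult_ac) (subst sum.swap, rule sum.cong[OF refl], rule sum.swap)
      also have "\<dots> = gram (K \<times> E2) (\<lambda>(r, b) (k, e). \<chi> k r b e) z z'" (is "_ = ?rhs")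
        unfolding gram_def sum_product_set by (simp add: sum_w del: complex_cnj_mult)
      finally show "?lhs = ?rhs" .
    qed
  qed (use fin in auto)
  have 2: "red_ent E1 (K \<times> E2 \<times> (R \<times> B2)) (\<lambda>b (a, c, d). m a b c d) = hE1"
    unfolding hE1_eq[symmetric] by (rule arg_cong[of _ _ "red_ent _ _"]) (auto simp: fun_eq_iff m_def)
  have 3: "red_ent (E1 \<times> K) (E2 \<times> (R \<times> B2)) (\<lambda>(b, a) (c, d). m a b c d) = red_ent (R \<times> A2) A1 (\<lambda>(r, a) a1. \<psi> r a a1)"
  proof -
    have "red_ent (E1 \<times> K) (E2 \<times> (R \<times> B2)) (\<lambda>(b, a) (c, d). m a b c d)
       = red_ent (E1 \<times> K) (R \<times> A2) (\<lambda>(e, k) (r, a). w k e * \<phi> k r a)"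
    proof (rule red_ent_cong)
      fix z z' :: "'e1 \<times> 'k"
      obtain e k e' k' where [simp]: "z = (e, k)" "z' = (e', k')" by (cases z; cases z')
      have mixed: "(\<Sum>b\<in>B2. \<Sum>c\<in>E2. \<chi> k r b c * cnj (\<chi> k' r b c)) = (\<Sum>a\<in>A2. \<phi> k r a * cnj (\<phi> k' r a))" for r
        unfolding \<chi>_def by (rule chan_isometric_inner[OF fin(2) iso_W2])
      have "gram (E2 \<times> (R \<times> B2)) (\<lambda>(b, a) (c, d). m a b c d) z z'
         = w k e * cnj (w k' e') * (\<Sum>r\<in>R. \<Sum>b\<in>B2. \<Sum>c\<in>E2. \<chi> k r b c * cnj (\<chi> k' r b c))" (is "?lhs = _")
        unfolding gram_def sum_product_set sum_distrib_left m_def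
        by (simp add: mult_ac) (subst sum.swap, rule sum.cong[OF refl], rule sum.swap)
      also have "\<dots> = gram (R \<times> A2) (\<lambda>(e, k) (r, a). w k e * \<phi> k r a) z z'" (is "_ = ?rhs")
        unfolding mixed gram_def sum_product_set by (simp add: sum_distrib_left mult_ac)
      finally show "?lhs = ?rhs" .
    qed
    also have "\<dots> = red_ent (R \<times> A2) (E1 \<times> K) (\<lambda>t z. (\<lambda>(e, k) (r, a). w k e * \<phi> k r a) z t)"
      using fin by (intro red_ent_swap) auto
    also have "\<dots> = red_ent (R \<times> A2) A1 (\<lambda>(r, a) a1. \<psi> r a a1)"
    proof (rule red_ent_cong)
      fix z z' :: "'r \<times> 'a2"
      obtain r a r' a' where [simp]: "z = (r, a)" "z' = (r', a')" by (cases z; cases z')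
      have "gram (E1 \<times> K) (\<lambda>t z. (\<lambda>(e, k) (r, a). w k e * \<phi> k r a) z t) z z'
         = (\<Sum>k\<in>K. \<Sum>e\<in>E1. w k e * \<phi> k r a * cnj (w k e * \<phi> k r' a'))" (is "?lhs = _")
        unfolding gram_def sum_product_set by (subst sum.swap) simp
      also have "\<dots> = gram A1 (\<lambda>(r, a) a1. \<psi> r a a1) z z'" (is "_ = ?rhs")
        by (simp add: sum_w sum_\<phi> gram_def del: complex_cnj_mult)
      finally show "?lhs = ?rhs" .
    qed
    finally show ?thesis .
  qed
  have 4: "red_ent (E1 \<times> E2) (K \<times> (R \<times> B2)) (\<lambda>(b, c) (a, d). m a b c d) = hE12"
    unfolding hE12_def by (rule arg_cong[of _ _ "red_ent _ _"]) (auto simp: fun_eq_iff m_def)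
  show ?thesis using ssa unfolding 1 2 3 4 .
qed

text \<open>Strong subadditivity with middle system \<open>R\<close>, the system B2 and classical
  \<open>k\<close>. Given \<open>k\<close> the state on R B2 E2 is pure, so R B2 has the entropy of
  E2; averaged over \<open>k\<close>, the state on \<open>R\<close> is the original one because
  \<open>l\<close> is an isometry.\<close>

lemma classical_step:
  "red_ent R (A2 \<times> A1) (\<lambda>r (a, a1). \<psi> r a a1) + (\<Sum>k\<in>K. hE2 k) \<le> (\<Sum>k\<in>K. red_ent R A2 (\<phi> k)) + hRB2"
proof -
  have ssa: "(\<Sum>k\<in>K. red_ent (R \<times> B2) E2 (\<lambda>(r, b) e. \<chi> k r b e)) + red_ent R (K \<times> B2 \<times> E2) (\<lambda>r (k, b, e). \<chi> k r b e)
     \<le> (\<Sum>k\<in>K. red_ent R (B2 \<times> E2) (\<lambda>r (b, e). \<chi> k r b e)) + hRB2"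
    unfolding hRB2_def using fin K by (intro strong_subadditivity_classical) auto
  have 1: "red_ent (R \<times> B2) E2 (\<lambda>(r, b) e. \<chi> k r b e) = hE2 k" for k
    unfolding hE2_def using fin by (subst red_ent_swap) (auto intro!: arg_cong[of _ _ "red_ent _ _"] simp: fun_eq_iff)
  have 2: "red_ent R (K \<times> B2 \<times> E2) (\<lambda>r (k, b, e). \<chi> k r b e) = red_ent R (A2 \<times> A1) (\<lambda>r (a, a1). \<psi> r a a1)"
  proof (rule red_ent_cong)
    fix r r'
    have "gram (K \<times> B2 \<times> E2) (\<lambda>r (k, b, e). \<chi> k r b e) r r' = (\<Sum>a\<in>A2. \<Sum>k\<in>K. \<phi> k r a * cnj (\<phi> k r' a))" (is "?lhs = _")
      by (subst sum.swap) (simp add: gram_def sum_product_set sum_\<chi>)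
    also have "\<dots> = gram (A2 \<times> A1) (\<lambda>r (a, a1). \<psi> r a a1) r r'" (is "_ = ?rhs")
      unfolding sum_\<phi> gram_def sum_product_set by simp
    finally show "?lhs = ?rhs" .
  qed
  have 3: "red_ent R (B2 \<times> E2) (\<lambda>r (b, e). \<chi> k r b e) = red_ent R A2 (\<phi> k)" for k
    using sum_\<chi> by (intro red_ent_cong) (simp add: gram_def sum_product_set)
  show ?thesis using ssa unfolding 1 2 3 by simp
qed

lemma pair_bound:
  assumes "0 \<le> lam" "lam \<le> 1"
  shows "(1 - lam) * red_ent R (A2 \<times> A1) (\<lambda>r (a, a1). \<psi> r a a1) - hE12
    \<le> ((1 - lam) * red_ent (R \<times> A2) A1 (\<lambda>(r, a) a1. \<psi> r a a1) - hE1)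
      + (\<Sum>k\<in>K. (1 - lam) * red_ent R A2 (\<phi> k) - hE2 k - lam * eta (weight k))"
proof -
  define x where "x = red_ent R (A2 \<times> A1) (\<lambda>r (a, a1). \<psi> r a a1)"
  define y where "y = red_ent (R \<times> A2) A1 (\<lambda>(r, a) a1. \<psi> r a a1)"
  define u where "u = (\<Sum>k\<in>K. red_ent R A2 (\<phi> k))"
  define v where "v = (\<Sum>k\<in>K. hE2 k)"
  define t where "t = (\<Sum>k\<in>K. eta (weight k))"
  \<comment> \<open>The case \<open>lam = 0\<close>: adding \<open>coherent_step\<close> and
    \<open>classical_step\<close> cancels \<open>hRB2\<close>.\<close>
  have 0: "x - hE12 \<le> y - hE1 + (u - v)"
    using coherent_step classical_step unfolding x_def y_def u_def v_def by linarith
  \<comment> \<open>The case \<open>lam = 1\<close>, where the reference entropies drop out.\<close>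
  have 1: "- hE12 \<le> - hE1 + (- v - t)"
    using entropy_given_outcome unfolding v_def t_def sum.distrib by linarith
  have "(1 - lam) * (x - hE12) \<le> (1 - lam) * (y - hE1 + (u - v))"
    using assms by (intro mult_left_mono[OF 0]) simp
  moreover have "lam * (- hE12) \<le> lam * (- hE1 + (- v - t))"
    using assms by (intro mult_left_mono[OF 1]) simp
  ultimately have "(1 - lam) * x - hE12 \<le> ((1 - lam) * y - hE1) + ((1 - lam) * u - v - lam * t)"
    by (simp add: algebra_simps)
  thus ?thesis
    by (simp add: x_def y_def u_def v_def t_def sum_subtractf sum_distrib_left)
qed

end

text \<open>Strong subadditivity with a one-point middle system. The entropy of that system is
  \<open>- eta 1 = 0\<close>, which is where the normalisation enters.\<close>

lemma subadditivity:
  fixes m :: "'a \<Rightarrow> 'c \<Rightarrow> 'd \<Rightarrow> complex"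
  assumes fin: "finite A" "finite C" "finite D"
    and norm: "(\<Sum>a\<in>A. \<Sum>c\<in>C. \<Sum>d\<in>D. (cmod (m a c d))\<^sup>2) = 1"
  shows "red_ent (A \<times> C) D (\<lambda>(a, c) d. m a c d)
     \<le> red_ent A (C \<times> D) (\<lambda>a (c, d). m a c d) + red_ent C (A \<times> D) (\<lambda>c (a, d). m a c d)"
proof -
  have A: "A \<noteq> {}" using norm by auto
  have ssa: "red_ent (({()} \<times> A) \<times> C) D (\<lambda>((b, a), c) d. m a c d) + red_ent {()} (A \<times> C \<times> D) (\<lambda>b (a, c, d). m a c d)
     \<le> red_ent ({()} \<times> A) (C \<times> D) (\<lambda>(b, a) (c, d). m a c d) + red_ent ({()} \<times> C) (A \<times> D) (\<lambda>(b, c) (a, d). m a c d)"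
    using fin A by (intro strong_subadditivity[of A "{()}" C D "\<lambda>a b c d. m a c d"]) auto
  have b1: "bij_betw (\<lambda>((u, a), c). (a, c)) (({()} \<times> A) \<times> C) (A \<times> C)"
    by (rule bij_betw_byWitness[where f' = "\<lambda>(a, c). (((), a), c)"]) auto
  have b2: "bij_betw snd ({()} \<times> Y) Y" for Y :: "'z set"
    by (rule bij_betw_byWitness[where f' = "\<lambda>a. ((), a)"]) auto
  have 1: "red_ent (({()} \<times> A) \<times> C) D (\<lambda>((b, a), c) d. m a c d) = red_ent (A \<times> C) D (\<lambda>(a, c) d. m a c d)"
    using fin by (subst red_ent_reindex[OF _ b1, symmetric]) (auto intro!: arg_cong[of _ _ "red_ent _ _"] simp: fun_eq_iff)
  have 2: "red_ent ({()} \<times> A) (C \<times> D) (\<lambda>(b, a) (c, d). m a c d) = red_ent A (C \<times> D) (\<lambda>a (c, d). m a c d)"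
    using fin by (subst red_ent_reindex[OF _ b2, symmetric]) (auto intro!: arg_cong[of _ _ "red_ent _ _"] simp: fun_eq_iff)
  have 3: "red_ent ({()} \<times> C) (A \<times> D) (\<lambda>(b, c) (a, d). m a c d) = red_ent C (A \<times> D) (\<lambda>c (a, d). m a c d)"
    using fin by (subst red_ent_reindex[OF _ b2, symmetric]) (auto intro!: arg_cong[of _ _ "red_ent _ _"] simp: fun_eq_iff)
  have "red_ent {()} (A \<times> C \<times> D) (\<lambda>b (a, c, d). m a c d)
      = red_ent {()} (A \<times> C \<times> D) (\<lambda>b t. 1 * (\<lambda>(a, c, d). m a c d) t)" by simp
  also have "\<dots> = - eta (\<Sum>t\<in>A \<times> C \<times> D. (cmod ((\<lambda>(a, c, d). m a c d) t))\<^sup>2)"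
    by (rule red_ent_unit_vector) auto
  also have "\<dots> = 0" unfolding sum_product_set using norm by (simp add: eta_def)
  finally show ?thesis using ssa unfolding 1 2 3 by simp
qed

text \<open>I(AX;B) - lam H(A|X) for the ensemble with weights and signal states given by the squared norms and
  directions of the amplitudes; by purity the entropy of AB given x is that of E, and the terms
  in eta make up - lam H(X).\<close>

definition ce_value :: "real \<Rightarrow> 'a set \<Rightarrow> 'b set \<Rightarrow> 'e set \<Rightarrow> ('b \<Rightarrow> 'e \<Rightarrow> 'a \<Rightarrow> complex) \<Rightarrow>
    'x set \<Rightarrow> 'r set \<Rightarrow> ('x \<Rightarrow> 'r \<Rightarrow> 'a \<Rightarrow> complex) \<Rightarrow> real" where
  "ce_value lam A B E W X R \<psi> =
     red_ent B (X \<times> R \<times> E) (\<lambda>b (x, r, e). \<Sum>a\<in>A. W b e a * \<psi> x r a)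
     + (\<Sum>x\<in>X. (1 - lam) * red_ent R A (\<psi> x) - red_ent E (R \<times> B) (\<lambda>e (r, b). \<Sum>a\<in>A. W b e a * \<psi> x r a)
         - lam * eta (\<Sum>r\<in>R. \<Sum>a\<in>A. (cmod (\<psi> x r a))\<^sup>2))"

text \<open>Initial segments of the naturals stand for all finite alphabets and references, since a
  definition cannot range over their types; \<open>ce_boundedD\<close> transfers the bound to index
  sets such as products.\<close>

definition ce_bounded :: "real \<Rightarrow> 'a set \<Rightarrow> 'b set \<Rightarrow> 'e set \<Rightarrow> ('b \<Rightarrow> 'e \<Rightarrow> 'a \<Rightarrow> complex) \<Rightarrow> real \<Rightarrow> bool" where
  "ce_bounded lam A B E W g \<longleftrightarrow> (\<forall>(n::nat) (d::nat) \<psi>.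
     (\<Sum>x<n. \<Sum>r<d. \<Sum>a\<in>A. (cmod (\<psi> x r a))\<^sup>2) = 1 \<longrightarrow> ce_value lam A B E W {..<n} {..<d} \<psi> \<le> g)"

section \<open>Independence of labels, and additivity of the optimal value\<close>

lemma ce_value_reindex:
  assumes X: "bij_betw \<pi> X' X" and R: "bij_betw \<kappa> R' R" and fin: "finite R"
  shows "ce_value lam A B E W X' R' (\<lambda>x r. \<psi> (\<pi> x) (\<kappa> r)) = ce_value lam A B E W X R \<psi>"
proof -
  have b1: "bij_betw (\<lambda>(x, r, e). (\<pi> x, \<kappa> r, e)) (X' \<times> R' \<times> E) (X \<times> R \<times> E)"
    using X R by (auto simp: bij_betw_def inj_on_def image_iff)
  have b2: "bij_betw (\<lambda>(r, b). (\<kappa> r, b)) (R' \<times> B) (R \<times> B)"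
    using R by (auto simp: bij_betw_def inj_on_def image_iff)
  have 1: "red_ent B (X' \<times> R' \<times> E) (\<lambda>b (x, r, e). \<Sum>a\<in>A. W b e a * \<psi> (\<pi> x) (\<kappa> r) a)
     = red_ent B (X \<times> R \<times> E) (\<lambda>b (x, r, e). \<Sum>a\<in>A. W b e a * \<psi> x r a)"
    by (subst red_ent_reindex_env[OF b1, symmetric]) (auto intro!: arg_cong[of _ _ "red_ent _ _"] simp: fun_eq_iff)
  have 2: "red_ent E (R' \<times> B) (\<lambda>e (r, b). \<Sum>a\<in>A. W b e a * \<psi> x (\<kappa> r) a)
     = red_ent E (R \<times> B) (\<lambda>e (r, b). \<Sum>a\<in>A. W b e a * \<psi> x r a)" for x
    by (subst red_ent_reindex_env[OF b2, symmetric]) (auto intro!: arg_cong[of _ _ "red_ent _ _"] simp: fun_eq_iff)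
  have 3: "red_ent R' A (\<lambda>r. \<psi> x (\<kappa> r)) = red_ent R A (\<psi> x)" for x
    by (rule red_ent_reindex[OF fin R])
  have 4: "(\<Sum>r\<in>R'. \<Sum>a\<in>A. (cmod (\<psi> x (\<kappa> r) a))\<^sup>2) = (\<Sum>r\<in>R. \<Sum>a\<in>A. (cmod (\<psi> x r a))\<^sup>2)" for x
    by (rule sum.reindex_bij_betw[OF R])
  show ?thesis
    unfolding ce_value_def 1 2 3 4
    by (rule arg_cong[of _ _ "(+) _"], rule sum.reindex_bij_betw[OF X])
qed

lemma ce_boundedD:
  assumes "ce_bounded lam A B E W g" "finite X" "finite R"
    and "(\<Sum>x\<in>X. \<Sum>r\<in>R. \<Sum>a\<in>A. (cmod (\<psi> x r a))\<^sup>2) = 1"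
  shows "ce_value lam A B E W X R \<psi> \<le> g"
proof -
  obtain \<pi> where \<pi>: "bij_betw \<pi> {..<card X} X" using bij_betw_from_nat_into_finite assms(2) by blast
  obtain \<kappa> where \<kappa>: "bij_betw \<kappa> {..<card R} R" using bij_betw_from_nat_into_finite assms(3) by blast
  have "(\<Sum>x<card X. \<Sum>r<card R. \<Sum>a\<in>A. (cmod (\<psi> (\<pi> x) (\<kappa> r) a))\<^sup>2) = (\<Sum>x\<in>X. \<Sum>r\<in>R. \<Sum>a\<in>A. (cmod (\<psi> x r a))\<^sup>2)"
    unfolding sum.reindex_bij_betw[OF \<kappa>, of "\<lambda>r. \<Sum>a\<in>A. (cmod (\<psi> x r a))\<^sup>2" for x]
    by (rule sum.reindex_bij_betw[OF \<pi>])
  hence "ce_value lam A B E W {..<card X} {..<card R} (\<lambda>x r. \<psi> (\<pi> x) (\<kappa> r)) \<le> g"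
    using assms(1,4) by (simp add: ce_bounded_def)
  thus ?thesis by (simp only: ce_value_reindex[OF \<pi> \<kappa> assms(3)])
qed

text \<open>\<open>had\<close> is the entanglement-breaking form of the complement of N1: measure
  with the \<open>l k\<close>, prepare the \<open>w k\<close>. The output entropy is split by
  \<open>subadditivity\<close>, the remaining terms by \<open>pair_bound\<close> for each
  \<open>x\<close>; the work lies in recognising the resulting reduced states as those of the
  ensembles \<open>\<psi>1\<close> and \<open>\<psi>2\<close>.\<close>

lemma ce_additive:
  fixes A1 :: "'a1 set" and A2 :: "'a2 set" and B1 :: "'b1 set" and B2 :: "'b2 set" and E1 :: "'e1 set" and E2 :: "'e2 set"
    and K :: "'k set"
  assumes fin: "finite A1" "finite A2" "finite B1" "finite B2" "finite E1" "finite E2" "finite K"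
    and iso2: "chan_isometric A2 B2 E2 W2" and iso1: "chan_isometric A1 B1 E1 W1"
    and unit_w: "\<And>k. k \<in> K \<Longrightarrow> (\<Sum>e\<in>E1. cnj (w k e) * w k e) = 1"
    and had: "\<And>e e' a a'. e \<in> E1 \<Longrightarrow> e' \<in> E1 \<Longrightarrow> a \<in> A1 \<Longrightarrow> a' \<in> A1 \<Longrightarrow>
      (\<Sum>b\<in>B1. W1 b e a * cnj (W1 b e' a')) = (\<Sum>k\<in>K. l k a * cnj (l k a') * (w k e * cnj (w k e')))"
    and lam: "0 \<le> lam" "lam \<le> 1"
    and bd2: "ce_bounded lam A2 B2 E2 W2 g2" and bd1: "ce_bounded lam A1 B1 E1 W1 g1"
  shows "ce_bounded lam (A2 \<times> A1) (B2 \<times> B1) (E2 \<times> E1)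
    (\<lambda>(b2, b1) (e2, e1) (a2, a1). W2 b2 e2 a2 * W1 b1 e1 a1) (g2 + g1)"
  unfolding ce_bounded_def
proof (intro allI impI)
  fix n d :: nat and \<psi> :: "nat \<Rightarrow> nat \<Rightarrow> 'a2 \<times> 'a1 \<Rightarrow> complex"
  define X where "X = {..<n}"
  define R where "R = {..<d}"
  have finXR: "finite X" "finite R" by (simp_all add: X_def R_def)
  assume "(\<Sum>x<n. \<Sum>r<d. \<Sum>a\<in>A2 \<times> A1. (cmod (\<psi> x r a))\<^sup>2) = 1"
  hence norm: "(\<Sum>x\<in>X. \<Sum>r\<in>R. \<Sum>a2\<in>A2. \<Sum>a1\<in>A1. (cmod (\<psi> x r (a2, a1)))\<^sup>2) = 1"
    by (simp add: X_def R_def sum_product_set)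
  have A1: "A1 \<noteq> {}" using norm by auto
  \<comment> \<open>Tracing \<open>had\<close> over E1 turns the isometry of \<open>W1\<close> into
    that of \<open>l\<close>, because each \<open>w k\<close> is a unit vector.\<close>
  have iso_l: "(\<Sum>k\<in>K. cnj (l k a) * l k a') = (if a = a' then 1 else 0)" if "a \<in> A1" "a' \<in> A1" for a a'
  proof -
    have "(\<Sum>k\<in>K. cnj (l k a) * l k a') = (\<Sum>k\<in>K. cnj (l k a) * l k a' * (\<Sum>e\<in>E1. cnj (w k e) * w k e))"
      using unit_w by simp
    also have "\<dots> = (\<Sum>e\<in>E1. \<Sum>k\<in>K. l k a' * cnj (l k a) * (w k e * cnj (w k e)))"
      by (subst sum.swap) (simp add: sum_distrib_left mult_ac)
    also have "\<dots> = (\<Sum>e\<in>E1. \<Sum>b\<in>B1. W1 b e a' * cnj (W1 b e a))"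
      using had that by simp
    also have "\<dots> = (\<Sum>b\<in>B1. \<Sum>e\<in>E1. cnj (W1 b e a) * W1 b e a')"
      by (subst sum.swap) (simp add: mult.commute)
    finally show ?thesis using iso1 that by (simp add: chan_isometric_def)
  qed
  have K: "K \<noteq> {}"
  proof
    assume "K = {}"
    moreover obtain a where "a \<in> A1" using A1 by auto
    ultimately show False using iso_l[of a a] by simp
  qed
  have hp: "hadamard_pair R A2 A1 K E1 B2 E2 l w W2"
    using finXR fin K iso_l iso2 unit_w by (intro hadamard_pair.intro) auto
  define \<phi> where "\<phi> x = hadamard_pair.\<phi> A1 (\<lambda>r a2 a1. \<psi> x r (a2, a1)) l" for x
  define \<chi> where "\<chi> x = hadamard_pair.\<chi> A2 A1 (\<lambda>r a2 a1. \<psi> x r (a2, a1)) l W2" for x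
  have \<phi>: "\<phi> x k r a = (\<Sum>a1\<in>A1. l k a1 * \<psi> x r (a, a1))" for x k r a
    by (simp add: \<phi>_def hadamard_pair.\<phi>_def[OF hp])
  have \<chi>: "\<chi> x k r b e = (\<Sum>a\<in>A2. W2 b e a * \<phi> x k r a)" for x k r b e
    by (simp add: \<chi>_def \<phi>_def hadamard_pair.\<chi>_def[OF hp])
  define h1 where "h1 x = red_ent E1 (K \<times> R \<times> A2) (\<lambda>e (k, r, a). w k e * \<phi> x k r a)" for x
  define h12 where "h12 x = red_ent (E1 \<times> E2) (K \<times> R \<times> B2) (\<lambda>(e1, e2) (k, r, b). w k e1 * \<chi> x k r b e2)" for x
  define h2 where "h2 x k = red_ent E2 (R \<times> B2) (\<lambda>e (r, b). \<chi> x k r b e)" for x k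
  define q where "q x k = (\<Sum>r\<in>R. \<Sum>a\<in>A2. (cmod (\<phi> x k r a))\<^sup>2)" for x k
  have pair: "(1 - lam) * red_ent R (A2 \<times> A1) (\<psi> x) - h12 x
    \<le> ((1 - lam) * red_ent (R \<times> A2) A1 (\<lambda>(r, a) a1. \<psi> x r (a, a1)) - h1 x)
      + (\<Sum>k\<in>K. (1 - lam) * red_ent R A2 (\<phi> x k) - h2 x k - lam * eta (q x k))" for x
  proof -
    have "(\<lambda>r (a, a1). \<psi> x r (a, a1)) = \<psi> x" by (auto simp: fun_eq_iff)
    thus ?thesis
      using hadamard_pair.pair_bound[OF hp lam, of "\<lambda>r a2 a1. \<psi> x r (a2, a1)"]
      unfolding h1_def h12_def h2_def q_def \<phi>_def \<chi>_def
        hadamard_pair.hE1_def[OF hp] hadamard_pair.hE12_def[OF hp] hadamard_pair.hE2_def[OF hp] hadamard_pair.weight_def[OF hp]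
      by simp
  qed
  \<comment> \<open>\<open>had\<close> extended sesquilinearly from basis inputs to arbitrary
    amplitudes. Wherever B1 belongs to the environment, it may thus be replaced by the register
    \<open>K\<close>.\<close>
  have had_sum: "(\<Sum>b\<in>B1. (\<Sum>a\<in>A1. W1 b e a * f a) * cnj (\<Sum>a\<in>A1. W1 b e' a * g a))
     = (\<Sum>k\<in>K. w k e * cnj (w k e') * ((\<Sum>a\<in>A1. l k a * f a) * cnj (\<Sum>a\<in>A1. l k a * g a)))"
    if e: "e \<in> E1" "e' \<in> E1" for e e' f g
  proof -
    have "(\<Sum>b\<in>B1. (\<Sum>a\<in>A1. W1 b e a * f a) * cnj (\<Sum>a\<in>A1. W1 b e' a * g a))
       = (\<Sum>b\<in>B1. \<Sum>a\<in>A1. \<Sum>a'\<in>A1. f a * cnj (g a') * (W1 b e a * cnj (W1 b e' a')))"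
      by (simp add: sum_product mult_ac)
    also have "\<dots> = (\<Sum>a\<in>A1. \<Sum>a'\<in>A1. f a * cnj (g a') * (\<Sum>b\<in>B1. W1 b e a * cnj (W1 b e' a')))"
      by (subst sum.swap, rule sum.cong[OF refl], subst sum.swap) (simp add: sum_distrib_left)
    also have "\<dots> = (\<Sum>a\<in>A1. \<Sum>a'\<in>A1. f a * cnj (g a') * (\<Sum>k\<in>K. l k a * cnj (l k a') * (w k e * cnj (w k e'))))"
      using had e by simp
    also have "\<dots> = (\<Sum>k\<in>K. \<Sum>a\<in>A1. \<Sum>a'\<in>A1. f a * cnj (g a') * (l k a * cnj (l k a') * (w k e * cnj (w k e'))))"
      unfolding sum_distrib_left by (subst (2) sum.swap, subst sum.swap) (rule refl)
    also have "\<dots> = (\<Sum>k\<in>K. w k e * cnj (w k e') * ((\<Sum>a\<in>A1. l k a * f a) * cnj (\<Sum>a\<in>A1. l k a * g a)))"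
      by (simp add: sum_product sum_distrib_left mult_ac) (rule sum.cong[OF refl], rule sum.swap)
    finally show ?thesis .
  qed
  note inner1 = chan_isometric_inner[OF fin(1) iso1] and inner2 = chan_isometric_inner[OF fin(2) iso2]
  let ?W = "\<lambda>(b2, b1) (e2, e1) (a2, a1). W2 b2 e2 a2 * W1 b1 e1 a1"
  define out where "out x r b2 b1 e2 e1 = (\<Sum>a1\<in>A1. W1 b1 e1 a1 * (\<Sum>a2\<in>A2. W2 b2 e2 a2 * \<psi> x r (a2, a1)))" for x r b2 b1 e2 e1
  have out: "(\<Sum>a\<in>A2 \<times> A1. (case a of (a2, a1) \<Rightarrow> W2 b2 e2 a2 * W1 b1 e1 a1) * \<psi> x r a) = out x r b2 b1 e2 e1" for x r b2 b1 e2 e1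
    unfolding sum_product_set out_def by (subst sum.swap) (simp add: sum_distrib_left mult_ac)
  have out': "out x r b2 b1 e2 e1 = (\<Sum>a2\<in>A2. W2 b2 e2 a2 * (\<Sum>a1\<in>A1. W1 b1 e1 a1 * \<psi> x r (a2, a1)))" for x r b2 b1 e2 e1
    unfolding out_def sum_distrib_left by (subst sum.swap) (simp add: mult_ac)
  have \<chi>': "(\<Sum>a1\<in>A1. l k a1 * (\<Sum>a2\<in>A2. W2 b e a2 * \<psi> x r (a2, a1))) = \<chi> x k r b e" for x k r b e
    unfolding \<chi> \<phi> sum_distrib_left by (subst sum.swap) (simp add: mult_ac)
  have E12: "red_ent (E2 \<times> E1) (R \<times> (B2 \<times> B1)) (\<lambda>e (r, b). \<Sum>a\<in>A2 \<times> A1. ?W b e a * \<psi> x r a) = h12 x" for x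
  proof -
    have bij: "bij_betw (\<lambda>(e2, e1). (e1, e2)) (E2 \<times> E1) (E1 \<times> E2)"
      by (rule bij_betw_byWitness[where f' = "\<lambda>(e1, e2). (e2, e1)"]) auto
    have "red_ent (E2 \<times> E1) (R \<times> (B2 \<times> B1)) (\<lambda>e (r, b). \<Sum>a\<in>A2 \<times> A1. ?W b e a * \<psi> x r a)
       = red_ent (E2 \<times> E1) (K \<times> R \<times> B2) (\<lambda>z. (\<lambda>(e1, e2) (k, r, b). w k e1 * \<chi> x k r b e2) ((\<lambda>(e2, e1). (e1, e2)) z))"
    proof (rule red_ent_cong)
      fix z z' :: "'e2 \<times> 'e1" assume zz: "z \<in> E2 \<times> E1" "z' \<in> E2 \<times> E1"
      obtain e2 e1 e2' e1' where [simp]: "z = (e2, e1)" "z' = (e2', e1')" by (cases z; cases z')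
      have "gram (R \<times> (B2 \<times> B1)) (\<lambda>e (r, b). \<Sum>a\<in>A2 \<times> A1. ?W b e a * \<psi> x r a) z z'
         = (\<Sum>r\<in>R. \<Sum>b2\<in>B2. \<Sum>b1\<in>B1. out x r b2 b1 e2 e1 * cnj (out x r b2 b1 e2' e1'))"
        unfolding gram_def sum_product_set[of _ R] sum_product_set[of _ B2] by (simp only: out \<open>z = _\<close> \<open>z' = _\<close> prod.case)
      also have "\<dots> = (\<Sum>r\<in>R. \<Sum>b2\<in>B2. \<Sum>k\<in>K. w k e1 * cnj (w k e1') * (\<chi> x k r b2 e2 * cnj (\<chi> x k r b2 e2')))"
        unfolding out_def using zz by (simp only: had_sum \<chi>' mem_Sigma_iff \<open>z = _\<close> \<open>z' = _\<close>)
      also have "\<dots> = (\<Sum>k\<in>K. \<Sum>r\<in>R. \<Sum>b2\<in>B2. w k e1 * cnj (w k e1') * (\<chi> x k r b2 e2 * cnj (\<chi> x k r b2 e2')))"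
        by (subst (2) sum.swap, subst sum.swap) (rule refl)
      also have "\<dots> = gram (K \<times> R \<times> B2) (\<lambda>z. (\<lambda>(e1, e2) (k, r, b). w k e1 * \<chi> x k r b e2) ((\<lambda>(e2, e1). (e1, e2)) z)) z z'"
        unfolding gram_def sum_product_set by (simp add: mult_ac)
      finally show "gram (R \<times> (B2 \<times> B1)) (\<lambda>e (r, b). \<Sum>a\<in>A2 \<times> A1. ?W b e a * \<psi> x r a) z z'
         = gram (K \<times> R \<times> B2) (\<lambda>z. (\<lambda>(e1, e2) (k, r, b). w k e1 * \<chi> x k r b e2) ((\<lambda>(e2, e1). (e1, e2)) z)) z z'" .
    qed
    also have "\<dots> = h12 x" unfolding h12_def using fin by (intro red_ent_reindex bij) auto
    finally show ?thesis .
  qed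
  define \<psi>1 where "\<psi>1 x = (\<lambda>(r, a2) a1. \<psi> x r (a2, a1))" for x
  define \<psi>2 where "\<psi>2 = (\<lambda>(x, k). \<phi> x k)"
  have E1: "red_ent E1 ((R \<times> A2) \<times> B1) (\<lambda>e (r, b). \<Sum>a\<in>A1. W1 b e a * \<psi>1 x r a) = h1 x" for x
    unfolding h1_def
  proof (rule red_ent_cong)
    fix e e' assume e: "e \<in> E1" "e' \<in> E1"
    have "gram ((R \<times> A2) \<times> B1) (\<lambda>e (r, b). \<Sum>a\<in>A1. W1 b e a * \<psi>1 x r a) e e'
      = (\<Sum>r\<in>R. \<Sum>a2\<in>A2. \<Sum>b\<in>B1. (\<Sum>a\<in>A1. W1 b e a * \<psi> x r (a2, a)) * cnj (\<Sum>a\<in>A1. W1 b e' a * \<psi> x r (a2, a)))" (is "?lhs = _")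
      unfolding gram_def sum_product_set by (simp only: \<psi>1_def prod.case)
    also have "\<dots> = (\<Sum>r\<in>R. \<Sum>a2\<in>A2. \<Sum>k\<in>K. w k e * cnj (w k e') * (\<phi> x k r a2 * cnj (\<phi> x k r a2)))"
      by (simp only: had_sum[OF e] \<phi>)
    also have "\<dots> = (\<Sum>k\<in>K. \<Sum>r\<in>R. \<Sum>a2\<in>A2. w k e * cnj (w k e') * (\<phi> x k r a2 * cnj (\<phi> x k r a2)))"
      by (subst (2) sum.swap, subst sum.swap) (rule refl)
    also have "\<dots> = gram (K \<times> R \<times> A2) (\<lambda>e (k, r, a). w k e * \<phi> x k r a) e e'" (is "_ = ?rhs")
      unfolding gram_def sum_product_set by (simp add: mult_ac)
    finally show "?lhs = ?rhs" .
  qed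
  have sum_l: "(\<Sum>k\<in>K. (\<Sum>a\<in>A1. l k a * f a) * cnj (\<Sum>a\<in>A1. l k a * g a)) = (\<Sum>a\<in>A1. f a * cnj (g a))" for f g
    by (rule isometry_inner[OF fin(1) iso_l])
  have norm1: "(\<Sum>x\<in>X. \<Sum>r\<in>R \<times> A2. \<Sum>a\<in>A1. (cmod (\<psi>1 x r a))\<^sup>2) = 1"
    using norm by (simp add: sum_product_set \<psi>1_def)
  have q_sum: "(\<Sum>k\<in>K. \<Sum>r\<in>R. \<Sum>a\<in>A2. (cmod (\<phi> x k r a))\<^sup>2) = (\<Sum>r\<in>R. \<Sum>a2\<in>A2. \<Sum>a1\<in>A1. (cmod (\<psi> x r (a2, a1)))\<^sup>2)" for x
  proof -
    have "complex_of_real (\<Sum>k\<in>K. \<Sum>r\<in>R. \<Sum>a\<in>A2. (cmod (\<phi> x k r a))\<^sup>2)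
       = (\<Sum>k\<in>K. \<Sum>r\<in>R. \<Sum>a\<in>A2. \<phi> x k r a * cnj (\<phi> x k r a))"
      by (simp add: complex_norm_square del: of_real_power)
    also have "\<dots> = (\<Sum>r\<in>R. \<Sum>a\<in>A2. \<Sum>k\<in>K. \<phi> x k r a * cnj (\<phi> x k r a))"
      by (subst sum.swap, rule sum.cong[OF refl], rule sum.swap)
    also have "\<dots> = complex_of_real (\<Sum>r\<in>R. \<Sum>a2\<in>A2. \<Sum>a1\<in>A1. (cmod (\<psi> x r (a2, a1)))\<^sup>2)"
      unfolding \<phi> sum_l by (simp add: complex_norm_square del: of_real_power)
    finally show ?thesis by (simp only: of_real_eq_iff)
  qed
  have norm2: "(\<Sum>y\<in>X \<times> K. \<Sum>r\<in>R. \<Sum>a\<in>A2. (cmod (\<psi>2 y r a))\<^sup>2) = 1"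
    using norm by (simp add: sum_product_set \<psi>2_def q_sum)
  have le1: "ce_value lam A1 B1 E1 W1 X (R \<times> A2) \<psi>1 \<le> g1"
    using finXR fin by (intro ce_boundedD[OF bd1] norm1) auto
  have le2: "ce_value lam A2 B2 E2 W2 (X \<times> K) R \<psi>2 \<le> g2"
    using finXR fin by (intro ce_boundedD[OF bd2] norm2) auto
  have B: "red_ent (B2 \<times> B1) (X \<times> R \<times> (E2 \<times> E1)) (\<lambda>b (x, r, e). \<Sum>a\<in>A2 \<times> A1. ?W b e a * \<psi> x r a)
     \<le> red_ent B2 ((X \<times> K) \<times> R \<times> E2) (\<lambda>b (y, r, e). \<Sum>a\<in>A2. W2 b e a * \<psi>2 y r a)
      + red_ent B1 (X \<times> (R \<times> A2) \<times> E1) (\<lambda>b (x, r, e). \<Sum>a\<in>A1. W1 b e a * \<psi>1 x r a)"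
  proof -
    let ?D = "X \<times> R \<times> (E2 \<times> E1)"
    define m where "m = (\<lambda>b2 b1 (x, r, (e2, e1)). out x r b2 b1 e2 e1)"
    \<comment> \<open>Summing over both outputs of N1 undoes its isometry and leaves a sum over A1,
      which the isometry \<open>l\<close> rewrites as a sum over outcomes. So the B2 marginal of the
      pair is exactly the output state of the refined ensemble \<open>\<psi>2\<close>.\<close>
    have iso1_sum: "(\<Sum>b1\<in>B1. \<Sum>e1\<in>E1. out x r b2 b1 e2 e1 * cnj (out x r b2' b1 e2 e1))
        = (\<Sum>k\<in>K. \<chi> x k r b2 e2 * cnj (\<chi> x k r b2' e2))" for x r b2 b2' e2
      unfolding out_def inner1 \<chi>'[symmetric] sum_l ..
    \<comment> \<open>Likewise, discarding both outputs of N2 restores its input A2, which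
      \<open>\<psi>1\<close> counts as part of the reference.\<close>
    have iso2_sum: "(\<Sum>b2\<in>B2. \<Sum>e2\<in>E2. out x r b2 b1 e2 e1 * cnj (out x r b2 b1' e2 e1))
        = (\<Sum>a2\<in>A2. (\<Sum>a1\<in>A1. W1 b1 e1 a1 * \<psi> x r (a2, a1)) * cnj (\<Sum>a1\<in>A1. W1 b1' e1 a1 * \<psi> x r (a2, a1)))" for x r b1 b1' e1
      unfolding out' inner2 ..
    have "(\<Sum>b\<in>B2 \<times> B1. \<Sum>x\<in>X. \<Sum>r\<in>R. \<Sum>e\<in>E2 \<times> E1. (cmod (\<Sum>a\<in>A2 \<times> A1. ?W b e a * \<psi> x r a))\<^sup>2)
       = (\<Sum>x\<in>X. \<Sum>r\<in>R. \<Sum>b\<in>B2 \<times> B1. \<Sum>e\<in>E2 \<times> E1. (cmod (\<Sum>a\<in>A2 \<times> A1. ?W b e a * \<psi> x r a))\<^sup>2)"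
      by (subst sum.swap, rule sum.cong[OF refl], rule sum.swap)
    also have "\<dots> = 1"
      using fin norm by (subst chan_isometric_norm[OF _ chan_isometric_product[OF fin(1,2) iso1 iso2]]) (auto simp: sum_product_set)
    finally have norm_m: "(\<Sum>b2\<in>B2. \<Sum>b1\<in>B1. \<Sum>d\<in>?D. (cmod (m b2 b1 d))\<^sup>2) = 1"
      unfolding sum_product_set[of _ B2] sum_product_set[of _ X] sum_product_set[of _ R] sum_product_set[of _ E2]
      by (simp only: out m_def prod.case)
    have "red_ent (B2 \<times> B1) ?D (\<lambda>b (x, r, e). \<Sum>a\<in>A2 \<times> A1. ?W b e a * \<psi> x r a) = red_ent (B2 \<times> B1) ?D (\<lambda>(b2, b1) d. m b2 b1 d)"
    proof -
      have "(\<Sum>a\<in>A2 \<times> A1. ?W b e a * \<psi> x r a) = (case b of (b2, b1) \<Rightarrow> m b2 b1 (x, r, e))" for b e x r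
        by (cases b; cases e) (simp only: out m_def prod.case)
      thus ?thesis by (intro arg_cong[of _ _ "red_ent _ _"]) (auto simp: fun_eq_iff)
    qed
    also have "\<dots> \<le> red_ent B2 (B1 \<times> ?D) (\<lambda>b2 (b1, d). m b2 b1 d) + red_ent B1 (B2 \<times> ?D) (\<lambda>b1 (b2, d). m b2 b1 d)"
      using fin finXR by (intro subadditivity norm_m) auto
    also have "red_ent B2 (B1 \<times> ?D) (\<lambda>b2 (b1, d). m b2 b1 d)
       = red_ent B2 ((X \<times> K) \<times> R \<times> E2) (\<lambda>b (y, r, e). \<Sum>a\<in>A2. W2 b e a * \<psi>2 y r a)"
    proof (rule red_ent_cong)
      fix b b'
      have "gram (B1 \<times> ?D) (\<lambda>b2 (b1, d). m b2 b1 d) b b'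
         = (\<Sum>b1\<in>B1. \<Sum>x\<in>X. \<Sum>r\<in>R. \<Sum>e2\<in>E2. \<Sum>e1\<in>E1. out x r b b1 e2 e1 * cnj (out x r b' b1 e2 e1))"
        unfolding gram_def sum_product_set by (simp add: m_def)
      also have "\<dots> = (\<Sum>x\<in>X. \<Sum>r\<in>R. \<Sum>e2\<in>E2. \<Sum>b1\<in>B1. \<Sum>e1\<in>E1. out x r b b1 e2 e1 * cnj (out x r b' b1 e2 e1))"
        by (subst sum.swap, rule sum.cong[OF refl], subst sum.swap, rule sum.cong[OF refl], rule sum.swap)
      also have "\<dots> = (\<Sum>x\<in>X. \<Sum>k\<in>K. \<Sum>r\<in>R. \<Sum>e2\<in>E2. \<chi> x k r b e2 * cnj (\<chi> x k r b' e2))"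
        unfolding iso1_sum by (rule sum.cong[OF refl], rule trans[OF sum.cong[OF refl sum.swap] sum.swap])
      also have "\<dots> = gram ((X \<times> K) \<times> R \<times> E2) (\<lambda>b (y, r, e). \<Sum>a\<in>A2. W2 b e a * \<psi>2 y r a) b b'"
        unfolding gram_def sum_product_set by (simp only: \<psi>2_def \<chi> prod.case)
      finally show "gram (B1 \<times> ?D) (\<lambda>b2 (b1, d). m b2 b1 d) b b'
         = gram ((X \<times> K) \<times> R \<times> E2) (\<lambda>b (y, r, e). \<Sum>a\<in>A2. W2 b e a * \<psi>2 y r a) b b'" .
    qed
    also have "red_ent B1 (B2 \<times> ?D) (\<lambda>b1 (b2, d). m b2 b1 d)
       = red_ent B1 (X \<times> (R \<times> A2) \<times> E1) (\<lambda>b (x, r, e). \<Sum>a\<in>A1. W1 b e a * \<psi>1 x r a)"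
    proof (rule red_ent_cong)
      fix b b'
      have "gram (B2 \<times> ?D) (\<lambda>b1 (b2, d). m b2 b1 d) b b'
         = (\<Sum>b2\<in>B2. \<Sum>x\<in>X. \<Sum>r\<in>R. \<Sum>e2\<in>E2. \<Sum>e1\<in>E1. out x r b2 b e2 e1 * cnj (out x r b2 b' e2 e1))"
        unfolding gram_def sum_product_set by (simp add: m_def)
      also have "\<dots> = (\<Sum>x\<in>X. \<Sum>r\<in>R. \<Sum>b2\<in>B2. \<Sum>e1\<in>E1. \<Sum>e2\<in>E2. out x r b2 b e2 e1 * cnj (out x r b2 b' e2 e1))"
        by (subst sum.swap, rule sum.cong[OF refl], subst sum.swap, rule sum.cong[OF refl], rule sum.cong[OF refl], rule sum.swap)
      also have "\<dots> = (\<Sum>x\<in>X. \<Sum>r\<in>R. \<Sum>e1\<in>E1. \<Sum>b2\<in>B2. \<Sum>e2\<in>E2. out x r b2 b e2 e1 * cnj (out x r b2 b' e2 e1))"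
        by (rule sum.cong[OF refl], rule sum.cong[OF refl], rule sum.swap)
      also have "\<dots> = (\<Sum>x\<in>X. \<Sum>r\<in>R. \<Sum>a2\<in>A2. \<Sum>e1\<in>E1. (\<Sum>a1\<in>A1. W1 b e1 a1 * \<psi> x r (a2, a1)) * cnj (\<Sum>a1\<in>A1. W1 b' e1 a1 * \<psi> x r (a2, a1)))"
        unfolding iso2_sum by (rule sum.cong[OF refl], rule sum.cong[OF refl], rule sum.swap)
      also have "\<dots> = gram (X \<times> (R \<times> A2) \<times> E1) (\<lambda>b (x, r, e). \<Sum>a\<in>A1. W1 b e a * \<psi>1 x r a) b b'"
        unfolding gram_def sum_product_set by (simp only: \<psi>1_def prod.case)
      finally show "gram (B2 \<times> ?D) (\<lambda>b1 (b2, d). m b2 b1 d) b b'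
         = gram (X \<times> (R \<times> A2) \<times> E1) (\<lambda>b (x, r, e). \<Sum>a\<in>A1. W1 b e a * \<psi>1 x r a) b b'" .
    qed
    finally show ?thesis .
  qed
  define qx where "qx x = (\<Sum>r\<in>R. \<Sum>a\<in>A2 \<times> A1. (cmod (\<psi> x r a))\<^sup>2)" for x
  have "ce_value lam (A2 \<times> A1) (B2 \<times> B1) (E2 \<times> E1) ?W X R \<psi>
    \<le> ce_value lam A2 B2 E2 W2 (X \<times> K) R \<psi>2 + ce_value lam A1 B1 E1 W1 X (R \<times> A2) \<psi>1"
  proof -
    have v: "ce_value lam (A2 \<times> A1) (B2 \<times> B1) (E2 \<times> E1) ?W X R \<psi>
       = red_ent (B2 \<times> B1) (X \<times> R \<times> (E2 \<times> E1)) (\<lambda>b (x, r, e). \<Sum>a\<in>A2 \<times> A1. ?W b e a * \<psi> x r a)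
         + (\<Sum>x\<in>X. (1 - lam) * red_ent R (A2 \<times> A1) (\<psi> x) - h12 x - lam * eta (qx x))"
      unfolding ce_value_def E12 qx_def ..
    have v1: "ce_value lam A1 B1 E1 W1 X (R \<times> A2) \<psi>1
       = red_ent B1 (X \<times> (R \<times> A2) \<times> E1) (\<lambda>b (x, r, e). \<Sum>a\<in>A1. W1 b e a * \<psi>1 x r a)
         + (\<Sum>x\<in>X. (1 - lam) * red_ent (R \<times> A2) A1 (\<lambda>(r, a) a1. \<psi> x r (a, a1)) - h1 x - lam * eta (qx x))"
      unfolding ce_value_def E1 qx_def by (simp add: sum_product_set \<psi>1_def)
    have v2: "ce_value lam A2 B2 E2 W2 (X \<times> K) R \<psi>2
       = red_ent B2 ((X \<times> K) \<times> R \<times> E2) (\<lambda>b (y, r, e). \<Sum>a\<in>A2. W2 b e a * \<psi>2 y r a)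
         + (\<Sum>x\<in>X. \<Sum>k\<in>K. (1 - lam) * red_ent R A2 (\<phi> x k) - h2 x k - lam * eta (q x k))"
      unfolding ce_value_def sum_product_set[of _ X K] by (simp add: \<psi>2_def h2_def q_def \<chi>)
    \<comment> \<open>The weight of \<open>x\<close> is the same \<open>qx x\<close> for the pair
      and for N1, so its term matches; the weights \<open>q x k\<close> of the refined alphabet
      belong to the value of N2.\<close>
    have "(\<Sum>x\<in>X. (1 - lam) * red_ent R (A2 \<times> A1) (\<psi> x) - h12 x - lam * eta (qx x))
      \<le> (\<Sum>x\<in>X. ((1 - lam) * red_ent (R \<times> A2) A1 (\<lambda>(r, a) a1. \<psi> x r (a, a1)) - h1 x - lam * eta (qx x))
         + (\<Sum>k\<in>K. (1 - lam) * red_ent R A2 (\<phi> x k) - h2 x k - lam * eta (q x k)))"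
      using pair by (intro sum_mono) (simp add: algebra_simps)
    thus ?thesis using B unfolding v v1 v2 sum.distrib by linarith
  qed
  thus "ce_value lam (A2 \<times> A1) (B2 \<times> B1) (E2 \<times> E1) ?W {..<n} {..<d} \<psi> \<le> g2 + g1"
    using le1 le2 by (simp add: X_def R_def)
qed

section \<open>Matrices as amplitudes\<close>

lemma index_mat_adjoint:
  assumes "i < dim_col A" "j < dim_row A"
  shows "mat_adjoint A $$ (i, j) = cnj (A $$ (j, i) :: complex)"
  using assms by (simp add: mat_adjoint_def mat_of_rows_def)

lemma dim_mat_adjoint [simp]:
  "dim_row (mat_adjoint A) = dim_col A" "dim_col (mat_adjoint A) = dim_row A"
  by (simp_all add: mat_adjoint_def mat_of_rows_def)

lemma mult_add_less:
  assumes "x < n" "(y::nat) < d"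
  shows "x * d + y < n * d"
proof -
  have "x * d + y < x * d + d" using assms by simp
  also have "\<dots> = Suc x * d" by simp
  also have "\<dots> \<le> n * d" using assms by (intro mult_le_mono1) simp
  finally show ?thesis .
qed

lemma mult_add_eq_iff:
  assumes "(y::nat) < d" "y' < d"
  shows "x * d + y = x' * d + y' \<longleftrightarrow> x = x' \<and> y = y'"
proof
  assume eq: "x * d + y = x' * d + y'"
  have "x = (x * d + y) div d" "x' = (x' * d + y') div d" using assms by simp_all
  hence "x = x'" using eq by simp
  thus "x = x' \<and> y = y'" using eq by simp
qed simp

lemma bij_mult_add:
  "bij_betw (\<lambda>(x, y). x * d + y) ({..<n} \<times> {..<d}) {..<n * (d::nat)}"
proof (rule bij_betw_byWitness[where f' = "\<lambda>i. (i div d, i mod d)"])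
  show "(\<lambda>i. (i div d, i mod d)) ` {..<n * d} \<subseteq> {..<n} \<times> {..<d}"
    by (cases "d = 0") (auto simp: less_mult_imp_div_less)
qed (auto simp: mult_add_less)

lemma sum_mult_add: "(\<Sum>k<n * d. g k) = (\<Sum>x<n. \<Sum>y<d. g (x * d + y :: nat))"
  using sum.reindex_bij_betw[OF bij_mult_add[of d n], of g] by (simp add: sum_product_set)

lemma index_tensor:
  assumes "i < dim_row A" "j < dim_col A" "k < dim_row B" "l < dim_col B"
  shows "tensor A B $$ (i * dim_row B + k, j * dim_col B + l) = A $$ (i, j) * B $$ (k, l)"
  using assms by (simp add: tensor_def mult_add_less)

lemma dim_tensor [simp]:
  "dim_row (tensor A B) = dim_row A * dim_row B" "dim_col (tensor A B) = dim_col A * dim_col B"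
  by (simp_all add: tensor_def)

lemma index_extension:
  fixes V :: "complex mat"
  assumes V: "V \<in> carrier_mat D d" and v: "v \<in> carrier_vec (dA * d)"
    and r: "r < dA" "r' < dA" and k: "k < D" "k' < D"
  shows "(tensor (1\<^sub>m dA) V * proj v * mat_adjoint (tensor (1\<^sub>m dA) V)) $$ (r * D + k, r' * D + k')
    = (\<Sum>a<d. V $$ (k, a) * v $ (r * d + a)) * cnj (\<Sum>a<d. V $$ (k', a) * v $ (r' * d + a))"
proof -
  define T where "T = tensor (1\<^sub>m dA) V"
  have T: "T \<in> carrier_mat (dA * D) (dA * d)" using V by (auto simp: T_def)
  have P: "proj v \<in> carrier_mat (dA * d) (dA * d)" using v by (auto simp: proj_def)
  have Ta: "mat_adjoint T \<in> carrier_mat (dA * d) (dA * D)" using T by auto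
  have TP: "T * proj v \<in> carrier_mat (dA * D) (dA * d)" using T P by simp
  have amp: "(\<Sum>j<dA * d. T $$ (r * D + k, j) * v $ j) = (\<Sum>a<d. V $$ (k, a) * v $ (r * d + a))"
    if "r < dA" "k < D" for r k
  proof -
    have "(\<Sum>j<dA * d. T $$ (r * D + k, j) * v $ j)
       = (\<Sum>s<dA. \<Sum>a<d. (if s = r then V $$ (k, a) * v $ (r * d + a) else 0))"
      unfolding sum_mult_add
    proof (intro sum.cong refl)
      fix s a assume "s \<in> {..<dA}" "a \<in> {..<d}"
      thus "T $$ (r * D + k, s * d + a) * v $ (s * d + a) = (if s = r then V $$ (k, a) * v $ (r * d + a) else 0)"
        using index_tensor[of r "1\<^sub>m dA" s k V a] that V by (auto simp: T_def)
    qed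
    also have "\<dots> = (\<Sum>s<dA. if s = r then \<Sum>a<d. V $$ (k, a) * v $ (r * d + a) else 0)"
      by (intro sum.cong refl) auto
    finally show ?thesis using that by simp
  qed
  have rk: "r * D + k < dA * D" "r' * D + k' < dA * D" using r k by (auto simp: mult_add_less)
  have "(T * proj v * mat_adjoint T) $$ (r * D + k, r' * D + k')
     = (\<Sum>j'<dA * d. (T * proj v) $$ (r * D + k, j') * mat_adjoint T $$ (j', r' * D + k'))"
    by (rule index_mult_mat_sum[OF TP Ta rk])
  also have "\<dots> = (\<Sum>j'<dA * d. (\<Sum>j<dA * d. T $$ (r * D + k, j) * v $ j) * cnj (T $$ (r' * D + k', j') * v $ j'))"
  proof (intro sum.cong refl)
    fix j' assume j': "j' \<in> {..<dA * d}"
    have "(T * proj v) $$ (r * D + k, j') = (\<Sum>j<dA * d. T $$ (r * D + k, j) * proj v $$ (j, j'))"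
      using j' rk by (intro index_mult_mat_sum[OF T P]) auto
    also have "\<dots> = (\<Sum>j<dA * d. T $$ (r * D + k, j) * v $ j) * cnj (v $ j')"
      using j' v by (simp add: proj_def sum_distrib_right mult.assoc)
    finally show "(T * proj v) $$ (r * D + k, j') * mat_adjoint T $$ (j', r' * D + k')
       = (\<Sum>j<dA * d. T $$ (r * D + k, j) * v $ j) * cnj (T $$ (r' * D + k', j') * v $ j')"
      using j' rk T by (simp add: index_mat_adjoint)
  qed
  also have "\<dots> = (\<Sum>a<d. V $$ (k, a) * v $ (r * d + a)) * cnj (\<Sum>a<d. V $$ (k', a) * v $ (r' * d + a))"
    unfolding sum_distrib_left[symmetric] cnj_sum[symmetric] by (simp only: amp r k)
  finally show ?thesis by (simp only: T_def)
qed

definition chan_amp :: "complex mat \<Rightarrow> nat \<Rightarrow> nat \<Rightarrow> nat \<Rightarrow> nat \<Rightarrow> complex" where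
  "chan_amp V dE b e a = V $$ (b * dE + e, a)"

text \<open>The weight of each signal state is absorbed into its amplitude.\<close>

definition ens_amp :: "nat \<Rightarrow> (nat \<Rightarrow> real) \<Rightarrow> (nat \<Rightarrow> complex vec) \<Rightarrow> nat \<Rightarrow> nat \<Rightarrow> nat \<Rightarrow> complex" where
  "ens_amp d p \<psi> x r a = of_real (sqrt (p x)) * \<psi> x $ (r * d + a)"

definition out_amp :: "complex mat \<Rightarrow> nat \<Rightarrow> (nat \<Rightarrow> real) \<Rightarrow> (nat \<Rightarrow> complex vec) \<Rightarrow> nat \<Rightarrow> nat \<Rightarrow> nat \<Rightarrow> nat \<Rightarrow> complex" where
  "out_amp V dE p \<psi> x r b e = (\<Sum>a<dim_col V. chan_amp V dE b e a * ens_amp (dim_col V) p \<psi> x r a)"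

text \<open>Block diagonal in \<open>x\<close>, with a rank-one block for each \<open>x\<close>. All
  partial traces of the state are sums of these entries over flattened indices.\<close>

lemma index_cq_state:
  assumes V: "V \<in> carrier_mat (dB * dE) d" and adm: "admissible d n p dA \<psi>"
    and x: "x < n" "x' < n" and r: "r < dA" "r' < dA" and b: "b < dB" "b' < dB" and e: "e < dE" "e' < dE"
  shows "cq_state V n p dA \<psi> $$ ((x * dA + r) * (dB * dE) + (b * dE + e), (x' * dA + r') * (dB * dE) + (b' * dE + e'))
    = (if x = x' then out_amp V dE p \<psi> x r b e * cnj (out_amp V dE p \<psi> x r' b' e') else 0)"
proof -
  define D where "D = dB * dE"
  define M where "M y = tensor (1\<^sub>m dA) V * proj (\<psi> y) * mat_adjoint (tensor (1\<^sub>m dA) V)" for y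
  have dim: "dim_row V = D" "dim_col V = d" using V by (auto simp: D_def)
  have M: "dim_row (M y) = dA * D" "dim_col (M y) = dA * D" for y by (simp_all add: M_def dim)
  have k: "b * dE + e < D" "b' * dE + e' < D" using b e by (auto simp: D_def mult_add_less)
  have rk: "r * D + (b * dE + e) < dA * D" "r' * D + (b' * dE + e') < dA * D" using r k by (auto simp: mult_add_less)
  have i: "(x * dA + r) * D + (b * dE + e) = x * (dA * D) + (r * D + (b * dE + e))"
    "(x' * dA + r') * D + (b' * dE + e') = x' * (dA * D) + (r' * D + (b' * dE + e'))"
    by (simp_all add: algebra_simps)
  have il: "x * (dA * D) + (r * D + (b * dE + e)) < n * (dA * D)" "x' * (dA * D) + (r' * D + (b' * dE + e')) < n * (dA * D)"
    using x rk by (auto intro: mult_add_less)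
  have "cq_state V n p dA \<psi> $$ (x * (dA * D) + (r * D + (b * dE + e)), x' * (dA * D) + (r' * D + (b' * dE + e')))
     = (\<Sum>y<n. (of_real (p y) \<cdot>\<^sub>m tensor (ketbra n y) (M y)) $$ (x * (dA * D) + (r * D + (b * dE + e)), x' * (dA * D) + (r' * D + (b' * dE + e'))))"
    unfolding cq_state_def matsum_def dim M_def[symmetric] using il by simp
  also have "\<dots> = (\<Sum>y<n. if y = x then (if x = x' then of_real (p x) * M x $$ (r * D + (b * dE + e), r' * D + (b' * dE + e')) else 0) else 0)"
  proof (intro sum.cong refl)
    fix y assume "y \<in> {..<n}"
    have "(of_real (p y) \<cdot>\<^sub>m tensor (ketbra n y) (M y)) $$ (x * (dA * D) + (r * D + (b * dE + e)), x' * (dA * D) + (r' * D + (b' * dE + e')))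
       = of_real (p y) * tensor (ketbra n y) (M y) $$ (x * (dA * D) + (r * D + (b * dE + e)), x' * (dA * D) + (r' * D + (b' * dE + e')))"
      using il by (simp add: M ketbra_def)
    also have "tensor (ketbra n y) (M y) $$ (x * (dA * D) + (r * D + (b * dE + e)), x' * (dA * D) + (r' * D + (b' * dE + e')))
       = ketbra n y $$ (x, x') * M y $$ (r * D + (b * dE + e), r' * D + (b' * dE + e'))"
      using index_tensor[of x "ketbra n y" x' "r * D + (b * dE + e)" "M y" "r' * D + (b' * dE + e')"] x rk
      by (simp add: M ketbra_def)
    finally show "(of_real (p y) \<cdot>\<^sub>m tensor (ketbra n y) (M y)) $$ (x * (dA * D) + (r * D + (b * dE + e)), x' * (dA * D) + (r' * D + (b' * dE + e')))
       = (if y = x then (if x = x' then of_real (p x) * M x $$ (r * D + (b * dE + e), r' * D + (b' * dE + e')) else 0) else 0)"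
      using x by (auto simp: ketbra_def)
  qed
  also have "\<dots> = (if x = x' then of_real (p x) * M x $$ (r * D + (b * dE + e), r' * D + (b' * dE + e')) else 0)"
    using x by simp
  also have "of_real (p x) * M x $$ (r * D + (b * dE + e), r' * D + (b' * dE + e'))
     = out_amp V dE p \<psi> x r b e * cnj (out_amp V dE p \<psi> x r' b' e')"
  proof -
    have p: "0 \<le> p x" and \<psi>: "\<psi> x \<in> carrier_vec (dA * d)" using adm x by (auto simp: admissible_def)
    have sq: "complex_of_real (sqrt (p x)) * of_real (sqrt (p x)) = of_real (p x)"
      using p by (simp flip: of_real_mult)
    have out: "out_amp V dE p \<psi> x r b e = of_real (sqrt (p x)) * (\<Sum>a<d. V $$ (b * dE + e, a) * \<psi> x $ (r * d + a))" for r b e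
      by (simp add: out_amp_def chan_amp_def ens_amp_def dim sum_distrib_left mult_ac)
    have "M x $$ (r * D + (b * dE + e), r' * D + (b' * dE + e'))
       = (\<Sum>a<d. V $$ (b * dE + e, a) * \<psi> x $ (r * d + a)) * cnj (\<Sum>a<d. V $$ (b' * dE + e', a) * \<psi> x $ (r' * d + a))"
      unfolding M_def using V \<psi> r k by (intro index_extension) (auto simp: D_def)
    thus ?thesis unfolding out complex_cnj_mult complex_cnj_complex_of_real sq[symmetric] by (simp only: mult_ac)
  qed
  finally show ?thesis using i by (simp only: D_def)
qed

text \<open>The bridge between matrices and amplitudes: \<pi> flattens tuples of system indices into
  matrix indices, and the Gram form supplies the hermiticity that \<open>vN_entropy_ent\<close> asks
  for.\<close>

lemma vN_entropy_red_ent: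
  assumes M: "M \<in> carrier_mat d d" and S: "finite S" and \<pi>: "bij_betw \<pi> S {..<d}"
    and eq: "\<And>a b. a \<in> S \<Longrightarrow> b \<in> S \<Longrightarrow> M $$ (\<pi> a, \<pi> b) = gram T m a b"
  shows "vN_entropy M = red_ent S T m"
proof -
  have herm: "hermitian {..<d} (\<lambda>i j. M $$ (i, j))"
    unfolding hermitian_def
  proof (intro ballI)
    fix i j assume "i \<in> {..<d}" "j \<in> {..<d}"
    then obtain a b where "a \<in> S" "b \<in> S" "i = \<pi> a" "j = \<pi> b"
      using bij_betw_imp_surj_on[OF \<pi>] by blast
    thus "cnj (M $$ (j, i)) = M $$ (i, j)" by (simp add: eq gram_def mult.commute)
  qed
  have "vN_entropy M = ent {..<d} (\<lambda>i j. M $$ (i, j))" by (rule vN_entropy_ent[OF M herm])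
  also have "\<dots> = ent S (\<lambda>a b. M $$ (\<pi> a, \<pi> b))" by (rule ent_reindex[OF _ herm \<pi>, symmetric]) simp
  also have "\<dots> = red_ent S T m" unfolding red_ent_def by (rule ent_cong[OF eq])
  finally show ?thesis .
qed

section \<open>Entropies of the classical-quantum state, expressed through amplitudes\<close>

context
  fixes V :: "complex mat" and d dB dE n dA :: nat and p :: "nat \<Rightarrow> real" and \<psi> :: "nat \<Rightarrow> complex vec"
  assumes V: "V \<in> carrier_mat (dB * dE) d"
    and iso: "chan_isometric {..<d} {..<dB} {..<dE} (chan_amp V dE)"
    and adm: "admissible d n p dA \<psi>"
begin

private lemma dims: "dim_row V = dB * dE" "dim_col V = d"
  using V by auto

private definition "rR = (\<Sum>x<n. red_ent {..<dA} {..<d} (ens_amp d p \<psi> x))"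
private definition "rE = (\<Sum>x<n. red_ent {..<dE} ({..<dA} \<times> {..<dB}) (\<lambda>e (r, b). out_amp V dE p \<psi> x r b e))"
private definition "rB = red_ent {..<dB} ({..<n} \<times> {..<dA} \<times> {..<dE}) (\<lambda>b (x, r, e). out_amp V dE p \<psi> x r b e)"
private definition "rX = (\<Sum>x<n. - eta (\<Sum>r<dA. \<Sum>a<d. (cmod (ens_amp d p \<psi> x r a))\<^sup>2))"

private lemma out_inner: "(\<Sum>b<dB. \<Sum>e<dE. out_amp V dE p \<psi> x r b e * cnj (out_amp V dE p \<psi> x' r' b e))
   = (\<Sum>a<d. ens_amp d p \<psi> x r a * cnj (ens_amp d p \<psi> x' r' a))"
  unfolding out_amp_def dims
  by (rule chan_isometric_inner[OF _ iso]) simp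

private lemma out_norm: "(\<Sum>r<dA. \<Sum>b<dB. \<Sum>e<dE. (cmod (out_amp V dE p \<psi> x r b e))\<^sup>2)
   = (\<Sum>r<dA. \<Sum>a<d. (cmod (ens_amp d p \<psi> x r a))\<^sup>2)"
  unfolding out_amp_def dims by (simp add: chan_isometric_norm[OF _ iso])

private lemma weight_eq:
  assumes "x < n"
  shows "(\<Sum>r<dA. \<Sum>a<d. (cmod (ens_amp d p \<psi> x r a))\<^sup>2) = p x"
proof -
  have "0 \<le> p x" and "(\<Sum>i<dA * d. (cmod (\<psi> x $ i))\<^sup>2) = 1"
    using adm assms by (auto simp: admissible_def)
  moreover have "(\<Sum>r<dA. \<Sum>a<d. (cmod (ens_amp d p \<psi> x r a))\<^sup>2) = (\<Sum>r<dA. \<Sum>a<d. p x * (cmod (\<psi> x $ (r * d + a)))\<^sup>2)"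
    using \<open>0 \<le> p x\<close> by (simp add: ens_amp_def norm_mult power_mult_distrib)
  ultimately show ?thesis unfolding sum_mult_add by (simp add: sum_distrib_left[symmetric])
qed

lemma ens_amp_norm: "(\<Sum>x<n. \<Sum>r<dA. \<Sum>a<d. (cmod (ens_amp d p \<psi> x r a))\<^sup>2) = 1"
  using adm weight_eq by (simp add: admissible_def)

text \<open>A classical \<open>X\<close> is purified by a copy \<open>x'\<close> in the environment,
  which makes the state a Gram matrix with blocks indexed by \<open>x\<close>. Within a block, B and
  E together may be replaced by the channel input because the channel is isometric.\<close>

private lemma vN_AX: "vN_entropy (ptrace_right (n * dA) (dB * dE) (cq_state V n p dA \<psi>)) = rR"
proof -
  have "vN_entropy (ptrace_right (n * dA) (dB * dE) (cq_state V n p dA \<psi>))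
     = red_ent ({..<n} \<times> {..<dA}) ({..<n} \<times> ({..<dB} \<times> {..<dE}))
        (\<lambda>(x, r) (x', b, e). if x = x' then out_amp V dE p \<psi> x r b e else 0)"
  proof (rule vN_entropy_red_ent[OF _ _ bij_mult_add])
    fix y y' assume y: "y \<in> {..<n} \<times> {..<dA}" "y' \<in> {..<n} \<times> {..<dA}"
    obtain x r x' r' where [simp]: "y = (x, r)" "y' = (x', r')" by (cases y; cases y')
    have l: "x * dA + r < n * dA" "x' * dA + r' < n * dA" using y by (auto simp: mult_add_less)
    have "ptrace_right (n * dA) (dB * dE) (cq_state V n p dA \<psi>) $$ (x * dA + r, x' * dA + r')
       = (\<Sum>b<dB. \<Sum>e<dE. if x = x' then out_amp V dE p \<psi> x r b e * cnj (out_amp V dE p \<psi> x r' b e) else 0)"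
      using l y by (simp add: ptrace_right_def sum_mult_add index_cq_state[OF V adm])
    also have "\<dots> = (\<Sum>y<n. if y = x then (\<Sum>b<dB. \<Sum>e<dE. if x = x' then out_amp V dE p \<psi> x r b e * cnj (out_amp V dE p \<psi> x r' b e) else 0) else 0)"
      using y by simp
    also have "\<dots> = gram ({..<n} \<times> ({..<dB} \<times> {..<dE})) (\<lambda>(x, r) (x', b, e). if x = x' then out_amp V dE p \<psi> x r b e else 0) y y'"
      unfolding gram_def sum_product_set by (intro sum.cong refl) (auto intro!: sum.cong)
    finally show "ptrace_right (n * dA) (dB * dE) (cq_state V n p dA \<psi>) $$ ((\<lambda>(x, y). x * dA + y) y, (\<lambda>(x, y). x * dA + y) y')
       = gram ({..<n} \<times> ({..<dB} \<times> {..<dE})) (\<lambda>(x, r) (x', b, e). if x = x' then out_amp V dE p \<psi> x r b e else 0) y y'" by simp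
  qed (auto simp: ptrace_right_def)
  also have "\<dots> = (\<Sum>x<n. red_ent {..<dA} ({..<dB} \<times> {..<dE}) (\<lambda>r (b, e). out_amp V dE p \<psi> x r b e))"
    by (rule red_ent_block_env[where \<kappa> = id and \<zeta> = id]) (auto simp: bij_betw_def)
  also have "\<dots> = rR" unfolding rR_def
    by (intro sum.cong refl red_ent_cong) (simp add: gram_def sum_product_set out_inner)
  finally show ?thesis .
qed

private lemma vN_X: "vN_entropy (ptrace_right n (dA * (dB * dE)) (cq_state V n p dA \<psi>)) = rX"
proof -
  \<comment> \<open>The one-point factor gives each block a one-dimensional system, so that
    \<open>red_ent_block_env\<close> applies and every block contributes minus \<open>eta\<close> of
    its weight.\<close>
  have bij: "bij_betw fst ({..<n} \<times> {()}) {..<n}"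
    by (rule bij_betw_byWitness[where f' = "\<lambda>x. (x, ())"]) auto
  have "vN_entropy (ptrace_right n (dA * (dB * dE)) (cq_state V n p dA \<psi>))
     = red_ent ({..<n} \<times> {()}) ({..<n} \<times> ({..<dA} \<times> {..<dB} \<times> {..<dE}))
        (\<lambda>(x, u) (x', r, b, e). if x = x' then out_amp V dE p \<psi> x r b e else 0)"
  proof (rule vN_entropy_red_ent[OF _ _ bij])
    fix y y' assume y: "y \<in> {..<n} \<times> {()}" "y' \<in> {..<n} \<times> {()}"
    obtain x x' where [simp]: "y = (x, ())" "y' = (x', ())" by (cases y; cases y') auto
    have idx: "z * (dA * (dB * dE)) + (r * (dB * dE) + k) = (z * dA + r) * (dB * dE) + k" for z r k
      by (simp add: algebra_simps)
    have "ptrace_right n (dA * (dB * dE)) (cq_state V n p dA \<psi>) $$ (x, x')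
       = (\<Sum>r<dA. \<Sum>b<dB. \<Sum>e<dE. if x = x' then out_amp V dE p \<psi> x r b e * cnj (out_amp V dE p \<psi> x r b e) else 0)"
      using y by (simp add: ptrace_right_def sum_mult_add idx index_cq_state[OF V adm])
    also have "\<dots> = (\<Sum>y<n. if y = x then (\<Sum>r<dA. \<Sum>b<dB. \<Sum>e<dE. if x = x' then out_amp V dE p \<psi> x r b e * cnj (out_amp V dE p \<psi> x r b e) else 0) else 0)"
      using y by simp
    also have "\<dots> = gram ({..<n} \<times> ({..<dA} \<times> {..<dB} \<times> {..<dE})) (\<lambda>(x, u) (x', r, b, e). if x = x' then out_amp V dE p \<psi> x r b e else 0) y y'"
      unfolding gram_def sum_product_set by (intro sum.cong refl) (auto intro!: sum.cong)
    finally show "ptrace_right n (dA * (dB * dE)) (cq_state V n p dA \<psi>) $$ (fst y, fst y')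
       = gram ({..<n} \<times> ({..<dA} \<times> {..<dB} \<times> {..<dE})) (\<lambda>(x, u) (x', r, b, e). if x = x' then out_amp V dE p \<psi> x r b e else 0) y y'" by simp
  qed (auto simp: ptrace_right_def)
  also have "\<dots> = (\<Sum>x<n. red_ent {()} ({..<dA} \<times> {..<dB} \<times> {..<dE}) (\<lambda>u t. 1 * (\<lambda>(r, b, e). out_amp V dE p \<psi> x r b e) t))"
    by (rule red_ent_block_env[where \<kappa> = id and \<zeta> = id]) (auto simp: bij_betw_def)
  also have "\<dots> = rX"
    unfolding rX_def out_norm[symmetric]
    by (intro sum.cong refl, subst red_ent_unit_vector) (auto simp: sum_product_set)
  finally show ?thesis .
qed

private lemma vN_B: "vN_entropy (ptrace_right dB dE (ptrace_left (n * dA) (dB * dE) (cq_state V n p dA \<psi>))) = rB"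
  unfolding rB_def
proof (rule vN_entropy_red_ent[of _ dB _ "\<lambda>b. b"])
  fix b b' assume b: "b \<in> {..<dB}" "b' \<in> {..<dB}"
  have "ptrace_right dB dE (ptrace_left (n * dA) (dB * dE) (cq_state V n p dA \<psi>)) $$ (b, b')
     = (\<Sum>e<dE. \<Sum>x<n. \<Sum>r<dA. out_amp V dE p \<psi> x r b e * cnj (out_amp V dE p \<psi> x r b' e))" (is "?lhs = _")
    using b by (simp add: ptrace_right_def ptrace_left_def sum_mult_add index_cq_state[OF V adm] mult_add_less)
  also have "\<dots> = (\<Sum>x<n. \<Sum>r<dA. \<Sum>e<dE. out_amp V dE p \<psi> x r b e * cnj (out_amp V dE p \<psi> x r b' e))"
    by (subst sum.swap, rule sum.cong[OF refl], rule sum.swap)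
  also have "\<dots> = gram ({..<n} \<times> {..<dA} \<times> {..<dE}) (\<lambda>b (x, r, e). out_amp V dE p \<psi> x r b e) b b'" (is "_ = ?rhs")
    unfolding gram_def sum_product_set by simp
  finally show "?lhs = ?rhs" .
qed (auto simp: ptrace_right_def bij_betw_def)

private lemma vN_AXB: "vN_entropy (ptrace_right (n * dA * dB) dE (cq_state V n p dA \<psi>))
  = red_ent (({..<n} \<times> {..<dA}) \<times> {..<dB}) ({..<n} \<times> {..<dE})
      (\<lambda>((x, r), b) (x', e). if x = x' then out_amp V dE p \<psi> x r b e else 0)"
proof -
  have "bij_betw (map_prod (\<lambda>(x, r). x * dA + r) (\<lambda>b. b)) (({..<n} \<times> {..<dA}) \<times> {..<dB}) ({..<n * dA} \<times> {..<dB})"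
    by (intro bij_betw_map_prod bij_mult_add) (auto simp: bij_betw_def)
  from bij_betw_trans[OF this bij_mult_add]
  have bij: "bij_betw ((\<lambda>(x, y). x * dB + y) \<circ> map_prod (\<lambda>(x, r). x * dA + r) (\<lambda>b. b)) (({..<n} \<times> {..<dA}) \<times> {..<dB}) {..<n * dA * dB}" .
  show ?thesis
  proof (rule vN_entropy_red_ent[OF _ _ bij])
    fix y y' assume y: "y \<in> ({..<n} \<times> {..<dA}) \<times> {..<dB}" "y' \<in> ({..<n} \<times> {..<dA}) \<times> {..<dB}"
    obtain x r b x' r' b' where [simp]: "y = ((x, r), b)" "y' = ((x', r'), b')" by (metis prod.collapse)
    have l: "(x * dA + r) * dB + b < n * dA * dB" "(x' * dA + r') * dB + b' < n * dA * dB"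
      using y by (auto simp: mult_add_less)
    have idx: "((z * dA + r) * dB + b) * dE + e = (z * dA + r) * (dB * dE) + (b * dE + e)" for z r b e
      by (simp add: algebra_simps)
    have "ptrace_right (n * dA * dB) dE (cq_state V n p dA \<psi>) $$ ((x * dA + r) * dB + b, (x' * dA + r') * dB + b')
       = (\<Sum>e<dE. if x = x' then out_amp V dE p \<psi> x r b e * cnj (out_amp V dE p \<psi> x r' b' e) else 0)"
      using l y by (simp add: ptrace_right_def idx index_cq_state[OF V adm])
    also have "\<dots> = (\<Sum>y<n. if y = x then (\<Sum>e<dE. if x = x' then out_amp V dE p \<psi> x r b e * cnj (out_amp V dE p \<psi> x r' b' e) else 0) else 0)"
      using y by simp
    also have "\<dots> = gram ({..<n} \<times> {..<dE}) (\<lambda>((x, r), b) (x', e). if x = x' then out_amp V dE p \<psi> x r b e else 0) y y'"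
      unfolding gram_def sum_product_set by (intro sum.cong refl) (auto intro!: sum.cong)
    finally show "ptrace_right (n * dA * dB) dE (cq_state V n p dA \<psi>) $$
        (((\<lambda>(x, y). x * dB + y) \<circ> map_prod (\<lambda>(x, r). x * dA + r) (\<lambda>b. b)) y, ((\<lambda>(x, y). x * dB + y) \<circ> map_prod (\<lambda>(x, r). x * dA + r) (\<lambda>b. b)) y')
       = gram ({..<n} \<times> {..<dE}) (\<lambda>((x, r), b) (x', e). if x = x' then out_amp V dE p \<psi> x r b e else 0) y y'" by simp
  qed (auto simp: ptrace_right_def)
qed

text \<open>Given \<open>x\<close> the state on A B E is pure, so \<open>red_ent_swap\<close>
  replaces A B by E in each block.\<close>

private lemma AXB_block: "red_ent (({..<n} \<times> {..<dA}) \<times> {..<dB}) ({..<n} \<times> {..<dE})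
      (\<lambda>((x, r), b) (x', e). if x = x' then out_amp V dE p \<psi> x r b e else 0) = rE"
proof -
  have bij: "bij_betw (\<lambda>((x, r), b). (x, r, b)) (({..<n} \<times> {..<dA}) \<times> {..<dB}) ({..<n} \<times> ({..<dA} \<times> {..<dB}))"
    by (rule bij_betw_byWitness[where f' = "\<lambda>(x, r, b). ((x, r), b)"]) auto
  have "red_ent (({..<n} \<times> {..<dA}) \<times> {..<dB}) ({..<n} \<times> {..<dE})
      (\<lambda>((x, r), b) (x', e). if x = x' then out_amp V dE p \<psi> x r b e else 0)
     = (\<Sum>x<n. red_ent ({..<dA} \<times> {..<dB}) {..<dE} (\<lambda>(r, b) e. out_amp V dE p \<psi> x r b e))"
    by (rule red_ent_block_env[OF _ _ _ bij, where \<zeta> = id]) (auto simp: bij_betw_def)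
  also have "\<dots> = rE" unfolding rE_def
    by (intro sum.cong refl, subst red_ent_swap) (auto intro!: arg_cong[of _ _ "red_ent _ _"] simp: fun_eq_iff)
  finally show ?thesis .
qed

lemma ce_value_eq:
  "I_AX_B V dB dE n p dA \<psi> - lam * H_A_given_X V dB dE n p dA \<psi>
   = ce_value lam {..<d} {..<dB} {..<dE} (chan_amp V dE) {..<n} {..<dA} (ens_amp d p \<psi>)"
proof -
  have "I_AX_B V dB dE n p dA \<psi> - lam * H_A_given_X V dB dE n p dA \<psi> = rR + rB - rE - lam * (rR - rX)"
    unfolding I_AX_B_def H_A_given_X_def Let_def vN_AX vN_X vN_B vN_AXB AXB_block ..
  also have "\<dots> = rB + ((1 - lam) * rR - rE + lam * rX)" by (simp add: algebra_simps)
  also have "\<dots> = ce_value lam {..<d} {..<dB} {..<dE} (chan_amp V dE) {..<n} {..<dA} (ens_amp d p \<psi>)"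
    unfolding ce_value_def rR_def rB_def rE_def rX_def out_amp_def dims
    by (simp add: sum_subtractf sum_distrib_left sum_negf)
  finally show ?thesis .
qed

text \<open>Subadditivity between A X and B, for the purification with a copy of \<open>x\<close>.
  The one-shot region only admits rates \<open>0 \<le> C\<close>, so this is what places the optimal
  point itself in the region.\<close>

lemma I_AX_B_nonneg: "0 \<le> I_AX_B V dB dE n p dA \<psi>"
proof -
  let ?D = "{..<n} \<times> {..<dE}"
  define m where "m = (\<lambda>(x, r) b (x', e). if x = x' then out_amp V dE p \<psi> x r b e else 0)"
  have "(\<Sum>y\<in>{..<n} \<times> {..<dA}. \<Sum>b<dB. \<Sum>z\<in>?D. (cmod (m y b z))\<^sup>2)
     = (\<Sum>x<n. \<Sum>r<dA. \<Sum>b<dB. \<Sum>x'<n. if x' = x then (\<Sum>e<dE. (cmod (out_amp V dE p \<psi> x r b e))\<^sup>2) else 0)"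
    unfolding sum_product_set by (intro sum.cong refl) (auto simp: m_def)
  also have "\<dots> = 1" using ens_amp_norm by (simp add: out_norm)
  finally have norm: "(\<Sum>y\<in>{..<n} \<times> {..<dA}. \<Sum>b<dB. \<Sum>z\<in>?D. (cmod (m y b z))\<^sup>2) = 1" .
  have sub: "red_ent (({..<n} \<times> {..<dA}) \<times> {..<dB}) ?D (\<lambda>(y, b) z. m y b z)
     \<le> red_ent ({..<n} \<times> {..<dA}) ({..<dB} \<times> ?D) (\<lambda>y (b, z). m y b z) + red_ent {..<dB} (({..<n} \<times> {..<dA}) \<times> ?D) (\<lambda>b (y, z). m y b z)"
    by (rule subadditivity[OF _ _ _ norm]) auto
  have 1: "red_ent (({..<n} \<times> {..<dA}) \<times> {..<dB}) ?D (\<lambda>(y, b) z. m y b z) = rE"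
    unfolding AXB_block[symmetric] by (rule arg_cong[of _ _ "red_ent _ _"]) (auto simp: fun_eq_iff m_def)
  have bij: "bij_betw (\<lambda>(b, x, e). (x, b, e)) ({..<dB} \<times> ?D) ({..<n} \<times> ({..<dB} \<times> {..<dE}))"
    by (rule bij_betw_byWitness[where f' = "\<lambda>(x, b, e). (b, x, e)"]) auto
  have 2: "red_ent ({..<n} \<times> {..<dA}) ({..<dB} \<times> ?D) (\<lambda>y (b, z). m y b z) = rR"
  proof -
    have "red_ent ({..<n} \<times> {..<dA}) ({..<dB} \<times> ?D) (\<lambda>y (b, z). m y b z)
       = (\<Sum>x<n. red_ent {..<dA} ({..<dB} \<times> {..<dE}) (\<lambda>r (b, e). out_amp V dE p \<psi> x r b e))"
      by (rule red_ent_block_env[OF _ _ _ _ bij, where \<kappa> = id]) (auto simp: bij_betw_def m_def)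
    also have "\<dots> = rR" unfolding rR_def
      by (intro sum.cong refl red_ent_cong) (simp add: gram_def sum_product_set out_inner)
    finally show ?thesis .
  qed
  have 3: "red_ent {..<dB} (({..<n} \<times> {..<dA}) \<times> ?D) (\<lambda>b (y, z). m y b z) = rB"
    unfolding rB_def
  proof (rule red_ent_cong)
    fix b b'
    have "gram (({..<n} \<times> {..<dA}) \<times> ?D) (\<lambda>b (y, z). m y b z) b b'
       = (\<Sum>x<n. \<Sum>r<dA. \<Sum>x'<n. if x' = x then (\<Sum>e<dE. out_amp V dE p \<psi> x r b e * cnj (out_amp V dE p \<psi> x r b' e)) else 0)"
      unfolding gram_def sum_product_set by (intro sum.cong refl) (auto simp: m_def)
    also have "\<dots> = gram ({..<n} \<times> {..<dA} \<times> {..<dE}) (\<lambda>b (x, r, e). out_amp V dE p \<psi> x r b e) b b'"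
      by (simp add: gram_def sum_product_set)
    finally show "gram (({..<n} \<times> {..<dA}) \<times> ?D) (\<lambda>b (y, z). m y b z) b b'
       = gram ({..<n} \<times> {..<dA} \<times> {..<dE}) (\<lambda>b (x, r, e). out_amp V dE p \<psi> x r b e) b b'" .
  qed
  have "I_AX_B V dB dE n p dA \<psi> = rR + rB - rE"
    unfolding I_AX_B_def Let_def vN_AX vN_B vN_AXB AXB_block ..
  thus ?thesis using sub unfolding 1 2 3 by simp
qed

end

section \<open>Bounds on amplitudes are bounds on admissible states, whatever the labelling\<close>

lemma ce_value_cong:
  assumes "\<And>x r a. x \<in> X \<Longrightarrow> r \<in> R \<Longrightarrow> a \<in> A \<Longrightarrow> \<psi> x r a = \<psi>' x r a"
  shows "ce_value lam A B E W X R \<psi> = ce_value lam A B E W X R \<psi>'"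
proof -
  have 1: "red_ent B (X \<times> R \<times> E) (\<lambda>b (x, r, e). \<Sum>a\<in>A. W b e a * \<psi> x r a)
     = red_ent B (X \<times> R \<times> E) (\<lambda>b (x, r, e). \<Sum>a\<in>A. W b e a * \<psi>' x r a)"
    using assms by (intro red_ent_cong) (simp add: gram_def sum_product_set)
  have 2: "red_ent E (R \<times> B) (\<lambda>e (r, b). \<Sum>a\<in>A. W b e a * \<psi> x r a)
     = red_ent E (R \<times> B) (\<lambda>e (r, b). \<Sum>a\<in>A. W b e a * \<psi>' x r a)" if "x \<in> X" for x
    using assms that by (intro red_ent_cong) (simp add: gram_def sum_product_set)
  have 3: "red_ent R A (\<psi> x) = red_ent R A (\<psi>' x)" if "x \<in> X" for x
    using assms that by (intro red_ent_cong) (simp add: gram_def)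
  show ?thesis unfolding ce_value_def 1 using 2 3 assms by simp
qed

text \<open>A weighted family of unit vectors becomes unnormalised amplitudes by
  \<open>ens_amp\<close>; conversely the squared norm is the weight and the direction the signal.
  Total norm one forces the reference and the input to have positive dimension.\<close>

lemma ce_bounded_iff:
  assumes V: "V \<in> carrier_mat (dB * dE) d"
    and iso: "chan_isometric {..<d} {..<dB} {..<dE} (chan_amp V dE)"
  shows "ce_bounded lam {..<d} {..<dB} {..<dE} (chan_amp V dE) g \<longleftrightarrow>
    (\<forall>n p dA \<psi>. admissible d n p dA \<psi> \<longrightarrow>
       I_AX_B V dB dE n p dA \<psi> - lam * H_A_given_X V dB dE n p dA \<psi> \<le> g)"
proof (intro iffI allI impI)
  fix n p dA \<psi> assume b: "ce_bounded lam {..<d} {..<dB} {..<dE} (chan_amp V dE) g" and adm: "admissible d n p dA \<psi>"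
  show "I_AX_B V dB dE n p dA \<psi> - lam * H_A_given_X V dB dE n p dA \<psi> \<le> g"
    unfolding ce_value_eq[OF V iso adm] using b ens_amp_norm[OF V iso adm] by (intro ce_boundedD) auto
next
  assume *: "\<forall>n p dA \<psi>. admissible d n p dA \<psi> \<longrightarrow>
       I_AX_B V dB dE n p dA \<psi> - lam * H_A_given_X V dB dE n p dA \<psi> \<le> g"
  show "ce_bounded lam {..<d} {..<dB} {..<dE} (chan_amp V dE) g"
    unfolding ce_bounded_def
  proof (intro allI impI)
    fix n dA :: nat and \<phi> :: "nat \<Rightarrow> nat \<Rightarrow> nat \<Rightarrow> complex"
    assume norm: "(\<Sum>x<n. \<Sum>r<dA. \<Sum>a<d. (cmod (\<phi> x r a))\<^sup>2) = 1"
    define p where "p x = (\<Sum>r<dA. \<Sum>a<d. (cmod (\<phi> x r a))\<^sup>2)" for x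
    \<comment> \<open>Signals of weight zero may be replaced by an arbitrary unit vector.\<close>
    define \<psi> where "\<psi> x = vec (dA * d) (\<lambda>i. if p x = 0 then (if i = 0 then 1 else 0)
        else \<phi> x (i div d) (i mod d) / of_real (sqrt (p x)))" for x
    have p0: "0 \<le> p x" for x by (simp add: p_def sum_nonneg)
    have pos: "0 < dA" "0 < d" using norm by (auto intro: Nat.gr0I)
    have \<psi>_index: "\<psi> x $ (r * d + a) = (if p x = 0 then (if r * d + a = 0 then 1 else 0) else \<phi> x r a / of_real (sqrt (p x)))"
      if "r < dA" "a < d" for x r a
      using that by (simp add: \<psi>_def mult_add_less)
    have "(\<Sum>i<dA * d. (cmod (\<psi> x $ i))\<^sup>2) = 1" for x
    proof (cases "p x = 0")
      case True
      have "(\<Sum>i<dA * d. (cmod (\<psi> x $ i))\<^sup>2) = (\<Sum>i<dA * d. if i = 0 then 1 else 0)"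
        using True by (intro sum.cong refl) (simp add: \<psi>_def)
      thus ?thesis using pos by simp
    next
      case False
      have "(\<Sum>i<dA * d. (cmod (\<psi> x $ i))\<^sup>2) = (\<Sum>r<dA. \<Sum>a<d. (cmod (\<phi> x r a))\<^sup>2 / p x)"
        unfolding sum_mult_add using False p0[of x]
        by (intro sum.cong refl) (simp add: \<psi>_index norm_divide power_divide)
      also have "\<dots> = (\<Sum>r<dA. \<Sum>a<d. (cmod (\<phi> x r a))\<^sup>2) / p x" by (simp only: sum_divide_distrib)
      also have "\<dots> = p x / p x" by (simp only: p_def)
      finally show ?thesis using False by simp
    qed
    hence adm: "admissible d n p dA \<psi>"
      using pos p0 norm unfolding admissible_def by (simp add: p_def \<psi>_def)
    have "ens_amp d p \<psi> x r a = \<phi> x r a" if "r < dA" "a < d" for x r a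
    proof (cases "p x = 0")
      case True
      hence "(\<Sum>a<d. (cmod (\<phi> x r a))\<^sup>2) = 0"
        using that by (simp add: p_def sum_nonneg_eq_0_iff sum_nonneg)
      hence "\<phi> x r a = 0" using that by (simp add: sum_nonneg_eq_0_iff)
      thus ?thesis using True by (simp add: ens_amp_def)
    next
      case False
      thus ?thesis using that p0[of x] by (simp add: ens_amp_def \<psi>_index)
    qed
    hence "ce_value lam {..<d} {..<dB} {..<dE} (chan_amp V dE) {..<n} {..<dA} \<phi>
       = ce_value lam {..<d} {..<dB} {..<dE} (chan_amp V dE) {..<n} {..<dA} (ens_amp d p \<psi>)"
      by (intro ce_value_cong) auto
    also have "\<dots> \<le> g"
      unfolding ce_value_eq[OF V iso adm, symmetric] using * adm by blast
    finally show "ce_value lam {..<d} {..<dB} {..<dE} (chan_amp V dE) {..<n} {..<dA} \<phi> \<le> g" .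
  qed
qed

lemma chan_isometric_matrix:
  assumes "isometry V d (dB * dE)"
  shows "chan_isometric {..<d} {..<dB} {..<dE} (chan_amp V dE)"
  unfolding chan_isometric_def
proof (intro ballI)
  fix a a' assume a: "a \<in> {..<d}" "a' \<in> {..<d}"
  have V: "V \<in> carrier_mat (dB * dE) d" and VV: "mat_adjoint V * V = 1\<^sub>m d"
    using assms by (auto simp: isometry_def)
  have Va: "mat_adjoint V \<in> carrier_mat d (dB * dE)" using V by auto
  have "(\<Sum>b<dB. \<Sum>e<dE. cnj (chan_amp V dE b e a) * chan_amp V dE b e a') = (\<Sum>k<dB * dE. cnj (V $$ (k, a)) * V $$ (k, a'))"
    by (simp add: sum_mult_add chan_amp_def)
  also have "\<dots> = (\<Sum>k<dB * dE. mat_adjoint V $$ (a, k) * V $$ (k, a'))"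
    using a V by (intro sum.cong refl) (simp add: index_mat_adjoint)
  also have "\<dots> = (mat_adjoint V * V) $$ (a, a')"
    using a by (intro index_mult_mat_sum[OF Va V, symmetric]) auto
  finally show "(\<Sum>b<dB. \<Sum>e<dE. cnj (chan_amp V dE b e a) * chan_amp V dE b e a') = (if a = a' then 1 else 0)"
    using a by (simp add: VV)
qed

lemma ce_bounded_reindex:
  assumes \<alpha>: "bij_betw \<alpha> A' A" and \<beta>: "bij_betw \<beta> B' B" and \<gamma>: "bij_betw \<gamma> E' E"
    and fin: "finite A" "finite B" "finite E"
    and W: "\<And>b e a. b \<in> B' \<Longrightarrow> e \<in> E' \<Longrightarrow> a \<in> A' \<Longrightarrow> W' b e a = W (\<beta> b) (\<gamma> e) (\<alpha> a)"
    and bd: "ce_bounded lam A' B' E' W' g"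
  shows "ce_bounded lam A B E W g"
  unfolding ce_bounded_def
proof (intro allI impI)
  fix n d :: nat and \<psi> :: "nat \<Rightarrow> nat \<Rightarrow> 'b \<Rightarrow> complex"
  assume norm: "(\<Sum>x<n. \<Sum>r<d. \<Sum>a\<in>A. (cmod (\<psi> x r a))\<^sup>2) = 1"
  define \<psi>' where "\<psi>' x r a = \<psi> x r (\<alpha> a)" for x r a
  have n': "(\<Sum>a\<in>A'. (cmod (\<psi>' x r a))\<^sup>2) = (\<Sum>a\<in>A. (cmod (\<psi> x r a))\<^sup>2)" for x r
    unfolding \<psi>'_def by (rule sum.reindex_bij_betw[OF \<alpha>])
  have amp: "(\<Sum>a\<in>A'. W' b e a * \<psi>' x r a) = (\<Sum>a\<in>A. W (\<beta> b) (\<gamma> e) a * \<psi> x r a)" if "b \<in> B'" "e \<in> E'" for b e x r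
    unfolding \<psi>'_def using W that sum.reindex_bij_betw[OF \<alpha>, of "\<lambda>a. W (\<beta> b) (\<gamma> e) a * \<psi> x r a"] by simp
  have c1: "bij_betw (\<lambda>(x, r, e). (x, r, \<gamma> e)) ({..<n} \<times> {..<d} \<times> E') ({..<n} \<times> {..<d} \<times> E)"
    using \<gamma> by (auto simp: bij_betw_def inj_on_def image_iff)
  have c2: "bij_betw (\<lambda>(r, b). (r, \<beta> b)) ({..<d} \<times> B') ({..<d} \<times> B)"
    using \<beta> by (auto simp: bij_betw_def inj_on_def image_iff)
  have 1: "red_ent B' ({..<n} \<times> {..<d} \<times> E') (\<lambda>b (x, r, e). \<Sum>a\<in>A'. W' b e a * \<psi>' x r a)
     = red_ent B ({..<n} \<times> {..<d} \<times> E) (\<lambda>b (x, r, e). \<Sum>a\<in>A. W b e a * \<psi> x r a)"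
  proof -
    have "red_ent B' ({..<n} \<times> {..<d} \<times> E') (\<lambda>b (x, r, e). \<Sum>a\<in>A'. W' b e a * \<psi>' x r a)
       = red_ent B' ({..<n} \<times> {..<d} \<times> E') (\<lambda>b z. (\<lambda>b (x, r, e). \<Sum>a\<in>A. W b e a * \<psi> x r a) (\<beta> b) ((\<lambda>(x, r, e). (x, r, \<gamma> e)) z))"
      by (intro red_ent_cong) (simp add: gram_def sum_product_set amp)
    also have "\<dots> = red_ent B ({..<n} \<times> {..<d} \<times> E) (\<lambda>b (x, r, e). \<Sum>a\<in>A. W b e a * \<psi> x r a)"
      by (subst red_ent_reindex_env[OF c1], rule red_ent_reindex[OF fin(2) \<beta>])
    finally show ?thesis .
  qed
  have 2: "red_ent E' ({..<d} \<times> B') (\<lambda>e (r, b). \<Sum>a\<in>A'. W' b e a * \<psi>' x r a)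
     = red_ent E ({..<d} \<times> B) (\<lambda>e (r, b). \<Sum>a\<in>A. W b e a * \<psi> x r a)" for x
  proof -
    have "red_ent E' ({..<d} \<times> B') (\<lambda>e (r, b). \<Sum>a\<in>A'. W' b e a * \<psi>' x r a)
       = red_ent E' ({..<d} \<times> B') (\<lambda>e z. (\<lambda>e (r, b). \<Sum>a\<in>A. W b e a * \<psi> x r a) (\<gamma> e) ((\<lambda>(r, b). (r, \<beta> b)) z))"
      by (intro red_ent_cong) (simp add: gram_def sum_product_set amp)
    also have "\<dots> = red_ent E ({..<d} \<times> B) (\<lambda>e (r, b). \<Sum>a\<in>A. W b e a * \<psi> x r a)"
      by (subst red_ent_reindex_env[OF c2], rule red_ent_reindex[OF fin(3) \<gamma>])
    finally show ?thesis .
  qed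
  have 3: "red_ent {..<d} A' (\<psi>' x) = red_ent {..<d} A (\<psi> x)" for x
    using red_ent_reindex_env[OF \<alpha>, of "{..<d}" "\<psi> x"] by (simp add: \<psi>'_def[abs_def])
  have "ce_value lam A' B' E' W' {..<n} {..<d} \<psi>' = ce_value lam A B E W {..<n} {..<d} \<psi>"
    unfolding ce_value_def 1 2 3 n' ..
  moreover have "ce_value lam A' B' E' W' {..<n} {..<d} \<psi>' \<le> g"
    using bd norm by (simp add: ce_bounded_def n')
  ultimately show "ce_value lam A B E W {..<n} {..<d} \<psi> \<le> g" by simp
qed

section \<open>Tensor powers\<close>

lemma chan_isometric_reindex:
  assumes \<alpha>: "bij_betw \<alpha> A' A" and \<beta>: "bij_betw \<beta> B' B" and \<gamma>: "bij_betw \<gamma> E' E"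
    and W: "\<And>b e a. b \<in> B' \<Longrightarrow> e \<in> E' \<Longrightarrow> a \<in> A' \<Longrightarrow> W' b e a = W (\<beta> b) (\<gamma> e) (\<alpha> a)"
    and iso: "chan_isometric A' B' E' W'"
  shows "chan_isometric A B E W"
  unfolding chan_isometric_def
proof (intro ballI)
  fix a a' assume "a \<in> A" "a' \<in> A"
  then obtain c c' where c: "c \<in> A'" "c' \<in> A'" "a = \<alpha> c" "a' = \<alpha> c'"
    using bij_betw_imp_surj_on[OF \<alpha>] by blast
  have "(\<Sum>b\<in>B. \<Sum>e\<in>E. cnj (W b e a) * W b e a') = (\<Sum>b\<in>B'. \<Sum>e\<in>E'. cnj (W (\<beta> b) (\<gamma> e) a) * W (\<beta> b) (\<gamma> e) a')"
    unfolding sum.reindex_bij_betw[OF \<gamma>, of "\<lambda>e. cnj (W b e a) * W b e a'" for b]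
    by (rule sum.reindex_bij_betw[OF \<beta>, symmetric])
  also have "\<dots> = (\<Sum>b\<in>B'. \<Sum>e\<in>E'. cnj (W' b e c) * W' b e c')"
    using c W by simp
  also have "\<dots> = (if c = c' then 1 else 0)" using iso c by (simp add: chan_isometric_def)
  finally show "(\<Sum>b\<in>B. \<Sum>e\<in>E. cnj (W b e a) * W b e a') = (if a = a' then 1 else 0)"
    using c bij_betw_imp_inj_on[OF \<alpha>] by (auto simp: inj_on_eq_iff)
qed

text \<open>\<open>swap_mid\<close> is a permutation matrix: row \<open>r\<close> has its single 1
  in the column whose mixed-radix digits are those of \<open>r\<close> with the middle two
  exchanged.\<close>

lemma index_swap_mid_mult:
  assumes T: "T \<in> carrier_mat (d1 * d2 * d3 * d4) m" and j: "j < m"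
    and abce: "a < d1" "b < d2" "c < d3" "e < d4"
  shows "(swap_mid d1 d2 d3 d4 * T) $$ (((a * d3 + c) * d2 + b) * d4 + e, j) = T $$ (((a * d2 + b) * d3 + c) * d4 + e, j)"
proof -
  let ?D = "d1 * d2 * d3 * d4"
  let ?r = "((a * d3 + c) * d2 + b) * d4 + e"
  let ?s = "((a * d2 + b) * d3 + c) * d4 + e"
  have r: "?r < ?D"
  proof -
    have "?r < d1 * d3 * d2 * d4" using abce by (intro mult_add_less)
    thus ?thesis by (simp add: mult_ac)
  qed
  have s: "?s < ?D" using abce by (intro mult_add_less)
  have S: "swap_mid d1 d2 d3 d4 \<in> carrier_mat ?D ?D" by (simp add: swap_mid_def)
  have "(swap_mid d1 d2 d3 d4 * T) $$ (?r, j) = (\<Sum>s'<?D. swap_mid d1 d2 d3 d4 $$ (?r, s') * T $$ (s', j))"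
    by (rule index_mult_mat_sum[OF S T r j])
  also have "\<dots> = (\<Sum>s'<?D. if s' = ?s then T $$ (s', j) else 0)"
  proof (intro sum.cong refl)
    fix s' assume s': "s' \<in> {..<?D}"
    define e' where "e' = s' mod d4"
    define c' where "c' = (s' div d4) mod d3"
    define b' where "b' = (s' div (d4 * d3)) mod d2"
    define a' where "a' = s' div (d4 * d3 * d2)"
    have lt: "e' < d4" "c' < d3" "b' < d2" using abce by (auto simp: e'_def c'_def b'_def)
    have dec: "s' = ((a' * d2 + b') * d3 + c') * d4 + e'"
    proof -
      have "a' * d2 + b' = s' div (d4 * d3)" by (simp add: a'_def b'_def div_mult2_eq)
      hence "(a' * d2 + b') * d3 + c' = s' div d4" by (simp add: c'_def div_mult2_eq)
      thus ?thesis by (simp add: e'_def)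
    qed
    have "swap_mid d1 d2 d3 d4 $$ (?r, s') = (if ?r = ((a' * d3 + c') * d2 + b') * d4 + e' then 1 else 0)"
      using r s' by (simp add: swap_mid_def Let_def e'_def c'_def b'_def a'_def)
    moreover have "?r = ((a' * d3 + c') * d2 + b') * d4 + e' \<longleftrightarrow> a = a' \<and> b = b' \<and> c = c' \<and> e = e'"
      using abce lt by (auto simp: mult_add_eq_iff)
    moreover have "s' = ?s \<longleftrightarrow> a = a' \<and> b = b' \<and> c = c' \<and> e = e'"
      unfolding dec using abce lt by (auto simp: mult_add_eq_iff)
    ultimately show "swap_mid d1 d2 d3 d4 $$ (?r, s') * T $$ (s', j) = (if s' = ?s then T $$ (s', j) else 0)"
      by simp
  qed
  also have "\<dots> = T $$ (?s, j)" using s by simp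
  finally show ?thesis .
qed

lemma pow_iso_carrier:
  assumes "V \<in> carrier_mat (dB * dE) d"
  shows "pow_iso V dB dE k \<in> carrier_mat (dB ^ k * dE ^ k) (d ^ k)"
proof (induction k)
  case (Suc k)
  thus ?case using assms by (auto simp: swap_mid_def tensor_def mult_ac)
qed simp

text \<open>The tensor product orders the outputs as the first \<open>k\<close> B systems, the first
  \<open>k\<close> E systems, the new B, the new E. \<open>swap_mid\<close> exchanges the middle
  two, after which the flattened B and E indices each end in the digit of the new copy.\<close>

lemma chan_amp_pow_iso_Suc:
  assumes V: "V \<in> carrier_mat (dB * dE) d"
    and lt: "b2 < dB ^ k" "b1 < dB" "e2 < dE ^ k" "e1 < dE" "a2 < d ^ k" "a1 < d"
  shows "chan_amp (pow_iso V dB dE (Suc k)) (dE ^ Suc k) (b2 * dB + b1) (e2 * dE + e1) (a2 * d + a1)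
    = chan_amp (pow_iso V dB dE k) (dE ^ k) b2 e2 a2 * chan_amp V dE b1 e1 a1"
proof -
  let ?P = "pow_iso V dB dE k"
  note P = pow_iso_carrier[OF V, of k]
  have T: "tensor ?P V \<in> carrier_mat (dB ^ k * dE ^ k * dB * dE) (d ^ k * d)"
    using P V by (auto simp: tensor_def)
  have row: "(b2 * dB + b1) * dE ^ Suc k + (e2 * dE + e1) = ((b2 * dB + b1) * dE ^ k + e2) * dE + e1"
    by (simp add: algebra_simps)
  have col: "((b2 * dE ^ k + e2) * dB + b1) * dE + e1 = (b2 * dE ^ k + e2) * (dB * dE) + (b1 * dE + e1)"
    by (simp add: algebra_simps)
  have "pow_iso V dB dE (Suc k) $$ (((b2 * dB + b1) * dE ^ k + e2) * dE + e1, a2 * d + a1)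
     = tensor ?P V $$ (((b2 * dE ^ k + e2) * dB + b1) * dE + e1, a2 * d + a1)"
    unfolding pow_iso.simps using lt by (intro index_swap_mid_mult[OF T]) (auto simp: mult_add_less)
  also have "\<dots> = ?P $$ (b2 * dE ^ k + e2, a2) * V $$ (b1 * dE + e1, a1)"
    unfolding col using index_tensor[of "b2 * dE ^ k + e2" ?P a2 "b1 * dE + e1" V a1] P V lt by (simp add: mult_add_less)
  finally show ?thesis unfolding chan_amp_def row .
qed

lemma pow_iso_1:
  assumes V: "V \<in> carrier_mat (dB * dE) d"
  shows "pow_iso V dB dE 1 = V"
proof (rule eq_matI)
  have P: "pow_iso V dB dE 1 \<in> carrier_mat (dB * dE) d" using pow_iso_carrier[OF V, of 1] by (simp del: pow_iso.simps)
  thus "dim_row (pow_iso V dB dE 1) = dim_row V" "dim_col (pow_iso V dB dE 1) = dim_col V"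
    by (simp_all only: carrier_matD[OF P] carrier_matD[OF V])
  fix i a assume i: "i < dim_row V" and a: "a < dim_col V"
  hence i': "i < dB * dE" and a': "a < d" using V by auto
  have "0 < dE" using i' by (cases dE) auto
  hence b: "i div dE < dB" "i mod dE < dE" using i' by (auto simp: less_mult_imp_div_less)
  have "chan_amp (pow_iso V dB dE (Suc 0)) (dE ^ Suc 0) (0 * dB + i div dE) (0 * dE + i mod dE) (0 * d + a)
     = chan_amp (pow_iso V dB dE 0) (dE ^ 0) 0 0 0 * chan_amp V dE (i div dE) (i mod dE) a"
    using b a' by (intro chan_amp_pow_iso_Suc[OF V]) auto
  moreover have "chan_amp (pow_iso V dB dE 0) (dE ^ 0) 0 0 0 = 1" by (simp add: chan_amp_def)
  ultimately show "pow_iso V dB dE 1 $$ (i, a) = V $$ (i, a)" by (simp add: chan_amp_def del: pow_iso.simps)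
qed

lemma chan_amp_pow_iso_product:
  assumes V: "V \<in> carrier_mat (dB * dE) d"
    and "b \<in> {..<dB ^ k} \<times> {..<dB}" "e \<in> {..<dE ^ k} \<times> {..<dE}" "a \<in> {..<d ^ k} \<times> {..<d}"
  shows "(\<lambda>(b2, b1) (e2, e1) (a2, a1). chan_amp (pow_iso V dB dE k) (dE ^ k) b2 e2 a2 * chan_amp V dE b1 e1 a1) b e a
    = chan_amp (pow_iso V dB dE (Suc k)) (dE ^ Suc k) ((\<lambda>(x, y). x * dB + y) b) ((\<lambda>(x, y). x * dE + y) e) ((\<lambda>(x, y). x * d + y) a)"
proof -
  obtain b2 b1 e2 e1 a2 a1 where eq: "b = (b2, b1)" "e = (e2, e1)" "a = (a2, a1)"
    by (cases b; cases e; cases a) auto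
  have "b2 < dB ^ k" "b1 < dB" "e2 < dE ^ k" "e1 < dE" "a2 < d ^ k" "a1 < d"
    using assms(2-4) by (simp_all add: eq)
  thus ?thesis unfolding eq prod.case by (rule chan_amp_pow_iso_Suc[OF V, symmetric])
qed

lemma pow_iso_isometric:
  assumes V: "V \<in> carrier_mat (dB * dE) d" and iso: "chan_isometric {..<d} {..<dB} {..<dE} (chan_amp V dE)"
  shows "chan_isometric {..<d ^ k} {..<dB ^ k} {..<dE ^ k} (chan_amp (pow_iso V dB dE k) (dE ^ k))"
proof (induction k)
  case 0
  show ?case by (simp add: chan_isometric_def chan_amp_def)
next
  case (Suc k)
  show ?case
  proof (rule chan_isometric_reindex)
    show "chan_isometric ({..<d ^ k} \<times> {..<d}) ({..<dB ^ k} \<times> {..<dB}) ({..<dE ^ k} \<times> {..<dE})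
        (\<lambda>(b2, b1) (e2, e1) (a2, a1). chan_amp (pow_iso V dB dE k) (dE ^ k) b2 e2 a2 * chan_amp V dE b1 e1 a1)"
      by (intro chan_isometric_product Suc iso) auto
    show "bij_betw (\<lambda>(x, y). x * d + y) ({..<d ^ k} \<times> {..<d}) {..<d ^ Suc k}"
      "bij_betw (\<lambda>(x, y). x * dB + y) ({..<dB ^ k} \<times> {..<dB}) {..<dB ^ Suc k}"
      "bij_betw (\<lambda>(x, y). x * dE + y) ({..<dE ^ k} \<times> {..<dE}) {..<dE ^ Suc k}"
      by (subst power_Suc2, rule bij_mult_add)+
  qed (rule chan_amp_pow_iso_product[OF V])
qed

section \<open>Kernels of Hadamard channels\<close>

lemma psd_decomposition:
  assumes "psd d M"
  shows "\<exists>l u. (\<forall>i<d. 0 \<le> l i) \<and> spectral {..<d} (\<lambda>a b. M $$ (a, b)) {..<d} l u"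
proof -
  have M: "M \<in> carrier_mat d d" and adj: "mat_adjoint M = M"
    and pos: "\<And>v. v \<in> carrier_vec d \<Longrightarrow> 0 \<le> Re (conjugate v \<bullet> (M *\<^sub>v v))"
    using assms by (auto simp: psd_def)
  have "hermitian {..<d} (\<lambda>a b. M $$ (a, b))"
    unfolding hermitian_def
  proof (intro ballI)
    fix a b assume "a \<in> {..<d}" "b \<in> {..<d}"
    hence "mat_adjoint M $$ (a, b) = cnj (M $$ (b, a))" using M by (intro index_mat_adjoint) auto
    thus "cnj (M $$ (b, a)) = M $$ (a, b)" by (simp add: adj)
  qed
  then obtain l u where sp: "spectral {..<d} (\<lambda>a b. M $$ (a, b)) {..<d} l u"
    using spectral_exists_nat by blast
  have "0 \<le> l i" if i: "i < d" for i
  proof -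
    have "conjugate (vec d (u i)) \<bullet> (M *\<^sub>v vec d (u i)) = (\<Sum>a<d. \<Sum>b<d. cnj (u i a) * M $$ (a, b) * u i b)"
      using M by (simp add: scalar_prod_def atLeast0LessThan sum_distrib_left mult.assoc)
    also have "\<dots> = of_real (l i)" using i by (intro spectral_expectation[OF sp]) simp
    finally show ?thesis using pos[of "vec d (u i)"] by simp
  qed
  thus ?thesis using sp by blast
qed

text \<open>The measurement and the prepared states are refined to rank one; k = (y, i, j) picks an eigenvector i of the
  effect and j of the state with outcome y.\<close>

lemma hadamard_kernel:
  assumes V: "V \<in> carrier_mat (dB * dE) d" and had: "hadamard V dB dE"
  shows "\<exists>(K :: (nat \<times> nat \<times> nat) set) l w. finite K \<and>
    (\<forall>k\<in>K. (\<Sum>e<dE. cnj (w k e) * w k e) = 1) \<and>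
    (\<forall>e<dE. \<forall>e'<dE. \<forall>a<d. \<forall>a'<d. (\<Sum>b<dB. chan_amp V dE b e a * cnj (chan_amp V dE b e' a'))
       = (\<Sum>k\<in>K. l k a * cnj (l k a') * (w k e * cnj (w k e'))))"
proof -
  have dV: "dim_col V = d" "dim_row V = dB * dE" using V by auto
  obtain m \<Lambda> \<omega> where povm: "POVM d m \<Lambda>" and dens: "\<forall>y<m. density dE (\<omega> y)"
    and ch: "\<forall>\<sigma>\<in>carrier_mat d d. compl_channel V dB dE \<sigma> = matsum dE m (\<lambda>y. mtrace (\<Lambda> y * \<sigma>) \<cdot>\<^sub>m \<omega> y)"
    using had unfolding hadamard_def entanglement_breaking_def dV by blast
  have "\<forall>y. \<exists>l u. y < m \<longrightarrow> (\<forall>i<d. 0 \<le> l i) \<and> spectral {..<d} (\<lambda>a b. \<Lambda> y $$ (a, b)) {..<d} l u"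
    using povm psd_decomposition unfolding POVM_def by blast
  then obtain \<alpha> u where "\<And>y. y < m \<longrightarrow> (\<forall>i<d. 0 \<le> \<alpha> y i) \<and> spectral {..<d} (\<lambda>a b. \<Lambda> y $$ (a, b)) {..<d} (\<alpha> y) (u y)"
    by metis
  hence \<Lambda>: "\<And>y i. y < m \<Longrightarrow> i < d \<Longrightarrow> 0 \<le> \<alpha> y i"
      "\<And>y. y < m \<Longrightarrow> spectral {..<d} (\<lambda>a b. \<Lambda> y $$ (a, b)) {..<d} (\<alpha> y) (u y)"
    by simp_all
  have "\<forall>y. \<exists>l u. y < m \<longrightarrow> (\<forall>i<dE. 0 \<le> l i) \<and> spectral {..<dE} (\<lambda>a b. \<omega> y $$ (a, b)) {..<dE} l u"
    using dens psd_decomposition unfolding density_def by blast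
  then obtain \<beta> v where "\<And>y. y < m \<longrightarrow> (\<forall>i<dE. 0 \<le> \<beta> y i) \<and> spectral {..<dE} (\<lambda>a b. \<omega> y $$ (a, b)) {..<dE} (\<beta> y) (v y)"
    by metis
  hence \<omega>: "\<And>y i. y < m \<Longrightarrow> i < dE \<Longrightarrow> 0 \<le> \<beta> y i"
      "\<And>y. y < m \<Longrightarrow> spectral {..<dE} (\<lambda>a b. \<omega> y $$ (a, b)) {..<dE} (\<beta> y) (v y)"
    by simp_all
  define K where "K = {..<m} \<times> {..<d} \<times> {..<dE}"
  \<comment> \<open>Both eigenvalues go into \<open>l\<close>, so that the \<open>w k\<close> remain
    unit vectors. The conjugate is due to the trace of the effect against a matrix unit, which picks
    the entry \<open>(a', a)\<close> rather than \<open>(a, a')\<close>.\<close>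
  define l where "l = (\<lambda>(y, i, j) a. of_real (sqrt (\<alpha> y i * \<beta> y j)) * cnj (u y i a))"
  define w where "w = (\<lambda>(y, i :: nat, j). v y j)"
  have "(\<Sum>e<dE. cnj (w k e) * w k e) = 1" if k: "k \<in> K" for k
  proof -
    obtain y i j where [simp]: "k = (y, i, j)" by (metis prod.collapse)
    have "orthonormal {..<dE} {..<dE} (v y)" "j < dE"
      using k \<omega>(2)[of y] by (auto simp: K_def spectral_def)
    thus ?thesis using orthonormalD[of "{..<dE}" "{..<dE}" "v y" j j] by (simp add: w_def)
  qed
  moreover have "(\<Sum>b<dB. chan_amp V dE b e a * cnj (chan_amp V dE b e' a'))
       = (\<Sum>k\<in>K. l k a * cnj (l k a') * (w k e * cnj (w k e')))"
    if e: "e < dE" "e' < dE" and a: "a < d" "a' < d" for e e' a a'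
  proof -
    \<comment> \<open>A matrix unit as input: the entry \<open>(e, e')\<close> of its image under
      the complementary channel is precisely the sum over \<open>b\<close> to be computed.\<close>
    define \<sigma> where "\<sigma> = mat d d (\<lambda>(i, j). if i = a \<and> j = a' then 1 else 0 :: complex)"
    have \<sigma>: "\<sigma> \<in> carrier_mat d d" by (simp add: \<sigma>_def)
    have Va: "mat_adjoint V \<in> carrier_mat d (dB * dE)" using V by auto
    have V\<sigma>: "V * \<sigma> \<in> carrier_mat (dB * dE) d" using V \<sigma> by simp
    have entry: "(V * \<sigma> * mat_adjoint V) $$ (i, j) = V $$ (i, a) * cnj (V $$ (j, a'))"
      if ij: "i < dB * dE" "j < dB * dE" for i j
    proof -
      have "(V * \<sigma> * mat_adjoint V) $$ (i, j) = (\<Sum>c<d. (V * \<sigma>) $$ (i, c) * mat_adjoint V $$ (c, j))"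
        by (rule index_mult_mat_sum[OF V\<sigma> Va ij])
      also have "\<dots> = (\<Sum>c<d. if c = a' then V $$ (i, a) * cnj (V $$ (j, a')) else 0)"
      proof (intro sum.cong refl)
        fix c assume c: "c \<in> {..<d}"
        have "(V * \<sigma>) $$ (i, c) = (\<Sum>b<d. V $$ (i, b) * \<sigma> $$ (b, c))"
          using c ij by (intro index_mult_mat_sum[OF V \<sigma>]) auto
        also have "\<dots> = (\<Sum>b<d. if b = a then (if c = a' then V $$ (i, a) else 0) else 0)"
          using c a by (intro sum.cong refl) (auto simp: \<sigma>_def)
        also have "\<dots> = (if c = a' then V $$ (i, a) else 0)" using a by simp
        finally show "(V * \<sigma>) $$ (i, c) * mat_adjoint V $$ (c, j) = (if c = a' then V $$ (i, a) * cnj (V $$ (j, a')) else 0)"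
          using c ij V by (auto simp: index_mat_adjoint)
      qed
      finally show ?thesis using a by simp
    qed
    have tr: "mtrace (\<Lambda> y * \<sigma>) = \<Lambda> y $$ (a', a)" if y: "y < m" for y
    proof -
      have L: "\<Lambda> y \<in> carrier_mat d d" using povm y by (auto simp: POVM_def psd_def)
      have "mtrace (\<Lambda> y * \<sigma>) = (\<Sum>i<d. (\<Lambda> y * \<sigma>) $$ (i, i))" using L by (simp add: mtrace_def)
      also have "\<dots> = (\<Sum>i<d. \<Sum>j<d. \<Lambda> y $$ (i, j) * \<sigma> $$ (j, i))"
        using index_mult_mat_sum[OF L \<sigma>] by (intro sum.cong refl) auto
      also have "\<dots> = (\<Sum>i<d. \<Sum>j<d. if j = a then (if i = a' then \<Lambda> y $$ (a', a) else 0) else 0)"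
        by (intro sum.cong refl) (auto simp: \<sigma>_def)
      finally show ?thesis using a by simp
    qed
    have "(\<Sum>b<dB. chan_amp V dE b e a * cnj (chan_amp V dE b e' a')) = compl_channel V dB dE \<sigma> $$ (e, e')"
      using e by (simp add: compl_channel_def ptrace_left_def entry mult_add_less chan_amp_def)
    also have "\<dots> = (\<Sum>y<m. (mtrace (\<Lambda> y * \<sigma>) \<cdot>\<^sub>m \<omega> y) $$ (e, e'))"
      using ch \<sigma> e by (simp add: matsum_def)
    also have "\<dots> = (\<Sum>y<m. \<Lambda> y $$ (a', a) * \<omega> y $$ (e, e'))"
    proof (intro sum.cong refl)
      fix y assume y: "y \<in> {..<m}"
      hence "\<omega> y \<in> carrier_mat dE dE" using dens by (auto simp: density_def psd_def)
      thus "(mtrace (\<Lambda> y * \<sigma>) \<cdot>\<^sub>m \<omega> y) $$ (e, e') = \<Lambda> y $$ (a', a) * \<omega> y $$ (e, e')"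
        using e y by (simp add: tr)
    qed
    also have "\<dots> = (\<Sum>y<m. (\<Sum>i<d. of_real (\<alpha> y i) * u y i a' * cnj (u y i a)) * (\<Sum>j<dE. of_real (\<beta> y j) * v y j e * cnj (v y j e')))"
      using \<Lambda>(2) \<omega>(2) a e by (intro sum.cong refl) (simp add: spectral_def)
    also have "\<dots> = (\<Sum>k\<in>K. l k a * cnj (l k a') * (w k e * cnj (w k e')))"
      unfolding K_def sum_product_set sum_product
    proof (intro sum.cong refl)
      fix y i j assume "y \<in> {..<m}" "i \<in> {..<d}" "j \<in> {..<dE}"
      hence "0 \<le> \<alpha> y i * \<beta> y j" using \<Lambda>(1) \<omega>(1) by simp
      hence sq: "complex_of_real (sqrt (\<alpha> y i * \<beta> y j)) * of_real (sqrt (\<alpha> y i * \<beta> y j)) = of_real (\<alpha> y i) * of_real (\<beta> y j)"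
        by (simp flip: of_real_mult)
      have "l (y, i, j) a * cnj (l (y, i, j) a') * (w (y, i, j) e * cnj (w (y, i, j) e'))
         = (complex_of_real (sqrt (\<alpha> y i * \<beta> y j)) * of_real (sqrt (\<alpha> y i * \<beta> y j))) * (u y i a' * cnj (u y i a) * (v y j e * cnj (v y j e')))"
        by (simp add: l_def w_def del: of_real_mult)
      thus "of_real (\<alpha> y i) * u y i a' * cnj (u y i a) * (of_real (\<beta> y j) * v y j e * cnj (v y j e'))
         = l (y, i, j) a * cnj (l (y, i, j) a') * (w (y, i, j) e * cnj (w (y, i, j) e'))"
        unfolding sq by simp
    qed
    finally show ?thesis .
  qed
  moreover have "finite K" by (simp add: K_def)
  ultimately show ?thesis
    by - (rule exI[of _ K], rule exI[of _ l], rule exI[of _ w], simp)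
qed

text \<open>Induction on the number of copies: \<open>ce_additive\<close> takes the first
  \<open>k\<close> copies as the arbitrary channel and the last copy as the Hadamard channel, so
  each step adds one \<open>g\<close>.\<close>

lemma ce_bounded_pow_iso:
  assumes V: "V \<in> carrier_mat (dB * dE) d" and iso: "chan_isometric {..<d} {..<dB} {..<dE} (chan_amp V dE)"
    and had: "hadamard V dB dE" and lam: "0 \<le> lam" "lam \<le> 1"
    and bd: "ce_bounded lam {..<d} {..<dB} {..<dE} (chan_amp V dE) g"
  shows "1 \<le> k \<Longrightarrow> ce_bounded lam {..<d ^ k} {..<dB ^ k} {..<dE ^ k} (chan_amp (pow_iso V dB dE k) (dE ^ k)) (real k * g)"
proof (induction k rule: nat_induct_at_least)
  case base
  show ?case using bd by (simp only: pow_iso_1[OF V] power_one_right of_nat_1 mult_1)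
next
  case (Suc k)
  obtain K :: "(nat \<times> nat \<times> nat) set" and l w where K: "finite K"
    "\<forall>k\<in>K. (\<Sum>e<dE. cnj (w k e) * w k e) = 1"
    "\<forall>e<dE. \<forall>e'<dE. \<forall>a<d. \<forall>a'<d.
       (\<Sum>b<dB. chan_amp V dE b e a * cnj (chan_amp V dE b e' a')) = (\<Sum>k\<in>K. l k a * cnj (l k a') * (w k e * cnj (w k e')))"
    using hadamard_kernel[OF V had] by (elim exE conjE) (rule that)
  show ?case
  proof (rule ce_bounded_reindex)
    show "bij_betw (\<lambda>(x, y). x * d + y) ({..<d ^ k} \<times> {..<d}) {..<d ^ Suc k}"
      "bij_betw (\<lambda>(x, y). x * dB + y) ({..<dB ^ k} \<times> {..<dB}) {..<dB ^ Suc k}"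
      "bij_betw (\<lambda>(x, y). x * dE + y) ({..<dE ^ k} \<times> {..<dE}) {..<dE ^ Suc k}"
      by (subst power_Suc2, rule bij_mult_add)+
    have "ce_bounded lam ({..<d ^ k} \<times> {..<d}) ({..<dB ^ k} \<times> {..<dB}) ({..<dE ^ k} \<times> {..<dE})
        (\<lambda>(b2, b1) (e2, e1) (a2, a1). chan_amp (pow_iso V dB dE k) (dE ^ k) b2 e2 a2 * chan_amp V dE b1 e1 a1) (real k * g + g)"
    proof (rule ce_additive[where K = K and l = l and w = w])
      show "chan_isometric {..<d ^ k} {..<dB ^ k} {..<dE ^ k} (chan_amp (pow_iso V dB dE k) (dE ^ k))"
        by (rule pow_iso_isometric[OF V iso])
    qed (use K lam bd iso Suc.IH in auto)
    thus "ce_bounded lam ({..<d ^ k} \<times> {..<d}) ({..<dB ^ k} \<times> {..<dB}) ({..<dE ^ k} \<times> {..<dE})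
        (\<lambda>(b2, b1) (e2, e1) (a2, a1). chan_amp (pow_iso V dB dE k) (dE ^ k) b2 e2 a2 * chan_amp V dE b1 e1 a1) (real (Suc k) * g)"
      by (simp add: algebra_simps)
  qed (rule finite_lessThan, rule finite_lessThan, rule finite_lessThan, rule chan_amp_pow_iso_product[OF V])
qed

text \<open>Optimality of the given state says that its own value \<open>g\<close> bounds one copy.
  \<open>ce_bounded_pow_iso\<close> gives \<open>k * g\<close> for \<open>k\<close> copies, and
  dividing rates by \<open>k\<close> returns the same half-plane for every \<open>k\<close>.\<close>

theorem theorem5:
  fixes V :: "complex mat" and dA' dB dE :: nat and lam :: real
    and n dA :: nat and p :: "nat \<Rightarrow> real" and \<psi> :: "nat \<Rightarrow> complex vec"
  assumes iso: "isometry V dA' (dB * dE)"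
    and had: "hadamard V dB dE"
    and lam: "0 \<le> lam" "lam \<le> 1"
    and adm: "admissible dA' n p dA \<psi>"
    and opt: "\<forall>n' p' dA'' \<psi>'. admissible dA' n' p' dA'' \<psi>' \<longrightarrow>
        I_AX_B V dB dE n' p' dA'' \<psi>' - lam * H_A_given_X V dB dE n' p' dA'' \<psi>'
        \<le> I_AX_B V dB dE n p dA \<psi> - lam * H_A_given_X V dB dE n p dA \<psi>"
  shows "(I_AX_B V dB dE n p dA \<psi>, H_A_given_X V dB dE n p dA \<psi>) \<in> CE_region V dB dE
    \<and> (\<forall>(C, E) \<in> CE_region V dB dE.
          C - lam * E \<le> I_AX_B V dB dE n p dA \<psi> - lam * H_A_given_X V dB dE n p dA \<psi>)
    \<and> I_AX_B V dB dE n p dA \<psi> - lam * H_A_given_X V dB dE n p dA \<psi> = g_lambda V dB dE lam"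
proof -
  let ?I = "I_AX_B V dB dE n p dA \<psi>" and ?H = "H_A_given_X V dB dE n p dA \<psi>"
  let ?R = "\<Union>k \<in> {1..}. (\<lambda>(C, E). (C / real k, E / real k)) ` CE_one_shot (pow_iso V dB dE k) (dB ^ k) (dE ^ k)"
  define g where "g = ?I - lam * ?H"
  have V: "V \<in> carrier_mat (dB * dE) dA'" using iso by (simp add: isometry_def)
  hence dV: "dim_col V = dA'" by auto
  note ci = chan_isometric_matrix[OF iso]
  have bd: "ce_bounded lam {..<dA'} {..<dB} {..<dE} (chan_amp V dE) g"
    unfolding ce_bounded_iff[OF V ci] g_def using opt by blast
  have "(?I, ?H) \<in> CE_one_shot V dB dE"
    using adm I_AX_B_nonneg[OF V ci adm] unfolding CE_one_shot_def dV by blast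
  hence "(?I, ?H) \<in> (\<lambda>(C, E). (C / real 1, E / real 1)) ` CE_one_shot (pow_iso V dB dE 1) (dB ^ 1) (dE ^ 1)"
    by (simp add: pow_iso_1[OF V] del: pow_iso.simps One_nat_def)
  hence "(?I, ?H) \<in> ?R" by (intro UN_I[of 1]) auto
  hence mem: "(?I, ?H) \<in> CE_region V dB dE" unfolding CE_region_def by (rule subsetD[OF closure_subset])
  have "?R \<subseteq> {z. fst z - lam * snd z \<le> g}"
  proof
    fix z assume "z \<in> ?R"
    then obtain k C E where k: "1 \<le> k" and CE: "(C, E) \<in> CE_one_shot (pow_iso V dB dE k) (dB ^ k) (dE ^ k)"
      and z: "z = (C / real k, E / real k)" by auto
    let ?P = "pow_iso V dB dE k"
    note P = pow_iso_carrier[OF V, of k]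
    obtain n' p' dA'' \<psi>' where adm': "admissible (dA' ^ k) n' p' dA'' \<psi>'"
      and C: "C \<le> I_AX_B ?P (dB ^ k) (dE ^ k) n' p' dA'' \<psi>'" and E: "H_A_given_X ?P (dB ^ k) (dE ^ k) n' p' dA'' \<psi>' \<le> E"
      using CE P unfolding CE_one_shot_def by auto
    \<comment> \<open>A point of the region may have a smaller \<open>C\<close> and a larger
      \<open>E\<close> than its state; with \<open>lam\<close> nonnegative both only lower the
      functional.\<close>
    have "C - lam * E \<le> I_AX_B ?P (dB ^ k) (dE ^ k) n' p' dA'' \<psi>' - lam * H_A_given_X ?P (dB ^ k) (dE ^ k) n' p' dA'' \<psi>'"
      using C mult_left_mono[OF E lam(1)] by linarith
    also have "\<dots> \<le> real k * g"
      using ce_bounded_pow_iso[OF V ci had lam bd k] adm'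
      unfolding ce_bounded_iff[OF P pow_iso_isometric[OF V ci]] by blast
    finally show "z \<in> {z. fst z - lam * snd z \<le> g}"
      using k by (simp add: z field_simps)
  qed
  \<comment> \<open>A closed half-plane containing all regularised one-shot regions contains the
    closure of their union.\<close>
  moreover have "closed {z :: real \<times> real. fst z - lam * snd z \<le> g}"
    by (intro closed_Collect_le continuous_intros)
  ultimately have "CE_region V dB dE \<subseteq> {z. fst z - lam * snd z \<le> g}"
    unfolding CE_region_def by (rule closure_minimal)
  hence bound: "\<forall>(C, E) \<in> CE_region V dB dE. C - lam * E \<le> ?I - lam * ?H" by (auto simp: g_def)
  have "g_lambda V dB dE lam = ?I - lam * ?H"
    unfolding g_lambda_def dV using adm opt by (intro cSup_eq_maximum) auto
  thus ?thesis using mem bound by simp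
qed

end
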